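(* No simplified weak Kohlenbach bar recursor $\Phi\in \mathsf{SP}^0(2\to 2\to 1)$ is left-well-founded (LWF). Hence no simplified weak Kohlenbach bar recursor in $\mathsf{SP}^0$ is definable in $\mathrm{T}+\mathit{min}$, and none is definable in $\mathrm{W}$.
   Context: **Types and languages.** Types are $\sigma,\tau ::= \mathtt N\mid \sigma\to\tau$; every type has the form $\sigma_0\to\cdots\to\sigma_{r-1}\to\mathtt N$. Pure types: $0=\mathtt N$, $k+1=k\to\mathtt N$. The base language $\mathrm B$ is the simply typed $\lambda$-calculus over constants $\widehat n:\mathtt N$ ($n\in\mathbb N$), $\mathit{suc},\mathit{pre}:\mathtt N\to\mathtt N$, $\mathit{ifzero}:\mathtt N\to\mathtt N\to\mathtt N\to\mathtt N$. Write $\mathit{ifzero}_\sigma=\lambda nxy\vec z.\,\mathit{ifzero}\,n\,(x\vec z)\,(y\vec z)$. Extensions of $\mathrm B$: - $\mathrm{PCF}+\mathit{byval}$ adds $Y_\sigma:(\sigma\to\sigma)\to\sigma$ and $\mathit{byval}^{\vec\sigma}_\tau:(\vec\sigma\to\mathtt N\to\tau)\to(\vec\sigma\to\mathtt N\to\tau)$ (with $\epsilon$ the empty list of types); - $\mathrm T+\mathit{min}$ adds $\mathit{rec}_\sigma:\sigma\to(\sigma\to\mathtt N\to\sigma)\to\mathtt N\to\sigma$ and $\mathit{min}:(\mathtt N\to\mathtt N)\to\mathtt N\to\mathtt N$; - $\mathrm W$ adds $\mathit{while}_\sigma:(\sigma\to\mathtt N)\to\sigma\to(\sigma\to\sigma)\to\sigma$;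 - $\mathrm T_0^{\mathrm{str}}$ adds $\mathit{byval}^\epsilon_{\mathtt N}$ and $\mathit{rec}^{\mathrm{str}}_{\mathtt N}$ (of the type of $\mathit{rec}_{\mathtt N}$). Terms of these languages are translated into $\mathrm{PCF}+\mathit{byval}$ by replacing constants by the following programs, where $\mathit{byval}^+_\sigma=\mathit{byval}^{\sigma,(\sigma\to\mathtt N\to\sigma)}_\sigma$ and $\rho,\mu$ are the types of $\mathit{rec}_\sigma,\mathit{min}$: $\mathit{Rec}_\sigma=\mathit{byval}^+_\sigma(Y_\rho(\lambda r.\lambda xfn.\,\mathit{ifzero}_\sigma\,n\,x\,(\mathit{byval}^\epsilon_\sigma(\lambda n'.f((\mathit{byval}^+_\sigma r)xfn')n')(\mathit{pre}\,n))))$; $\mathit{Min}=\mathit{byval}^{\mathtt N\to\mathtt N}_{\mathtt N}(Y_\mu(\lambda m.\lambda fn.\,\mathit{ifzero}(fn)\,n\,((\mathit{byval}^{\mathtt N\to\mathtt N}_{\mathtt N}m)f(\mathit{suc}\,n))))$; $\mathit{While}_\sigma=\lambda cxf.\,Y_{\sigma\to\sigma}(\lambda w.\lambda x'.\,\mathit{ifzero}_\sigma(cx')(w(fx'))x')\,x$; $\mathit{Rec}^{\mathrm{str}}_{\mathtt N}=\mathit{byval}^+_{\mathtt N}(Y(\lambda r.\lambda xfn.\,\mathit{ifzero}\,n\,x\,(\mathit{byval}^\epsilon_{\mathtt N}(\lambda n'.\mathit{byval}^\epsilon_{\mathtt N}(\lambda m.fmn')((\mathit{byval}^+_{\mathtt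 N}r)xfn'))(\mathit{pre}\,n))))$. **Nested sequential procedures (NSPs).** These are possibly infinite terms generated coinductively by: procedures $p,q::=\lambda x_0\ldots x_{r-1}.e$; expressions $d,e::=\bot\mid n\mid \mathtt{case}\ a\ \mathtt{of}\ (i\Rightarrow e_i\mid i\in\mathbb N)$; applications $a::=x\,q_0\ldots q_{r-1}$ (with $r\ge 0$; written $x()$ if $r=0$). Variables carry types; terms are taken up to $\alpha$-equivalence and are well-typed in the evident sense (expressions and applications have type $\mathtt N$). If $p=\lambda\vec y.e$, then $\lambda x.p$ means $\lambda x\vec y.e$. $\mathsf{SP}(\sigma)$ is the set of procedures of type $\sigma$, $\mathsf{SP}^0(\sigma)$ the set of closed ones; $\lambda.n,\lambda.\bot\in\mathsf{SP}^0(\mathtt N)$ are written $n$ ("numerals"), $\bot$. For $x$ of type $\sigma=\sigma_0\to\cdots\to\sigma_{r-1}\to\mathtt N$, $x^\eta=\lambda z_0\ldots z_{r-1}.\,\mathtt{case}\ x z_0^\eta\ldots z_{r-1}^\eta\ \mathtt{of}\ (i\Rightarrow i)$. *Meta-terms* (coinductive): $P,Q::=\lambda\vec x.E$; $D,E::=\bot\mid n\mid\mathtt{case}\ G\ \mathtt{of}\ (i\Rightarrow E_i)$; $G::=E\mid x\vec Q\mid P\vec Q$. Head reduction $\rightsquigarrow_h$: $(\lambda\vec x.E)\vec Q\rightsquigarrow_h E[\vec x\mapsto\vec Q]$; $\mathtt{case}\,\bot\,\mathtt{of}(i\Rightarrow E_i)\rightsquigarrow_h\bot$; $\mathtt{case}\,n\,\mathtt{of}(i\Rightarrow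 E_i)\rightsquigarrow_h E_n$; $\mathtt{case}(\mathtt{case}\,G\,\mathtt{of}(i\Rightarrow E_i))\mathtt{of}(j\Rightarrow F_j)\rightsquigarrow_h\mathtt{case}\,G\,\mathtt{of}(i\Rightarrow\mathtt{case}\,E_i\,\mathtt{of}(j\Rightarrow F_j))$; if $G\rightsquigarrow_h G'$ and $G$ is not a case meta-term, then $\mathtt{case}\,G\,\mathtt{of}(\cdots)\rightsquigarrow_h\mathtt{case}\,G'\,\mathtt{of}(\cdots)$; if $E\rightsquigarrow_hE'$ then $\lambda\vec x.E\rightsquigarrow_h\lambda\vec x.E'$. The normal form of a meta-term (Böhm-tree style): head-reduce; if no head normal form is reached it is $\bot$ (under the appropriate $\lambda\vec x$); if the head normal form is $\bot$ or $n$ (possibly under $\lambda$) that is the normal form; if it is $\mathtt{case}\,y\vec Q\,\mathtt{of}(i\Rightarrow E_i)$ (possibly under $\lambda$) or $y\vec Q$, normalize the $Q_j$, $E_i$ corecursively. For $p=\lambda x_0\cdots x_r.e\in\mathsf{SP}(\sigma\to\tau)$ and $q\in\mathsf{SP}(\sigma)$, $p\cdot q\in\mathsf{SP}(\tau)$ is the normal form of $\lambda x_1\cdots x_r.e[x_0\mapsto q]$. In mixed expressions a variable $z$ is read as $z^\eta$, and $\lambda z.(\cdots)$ is NSP abstraction. *Left-well-foundedness.* The application tree of an NSP term $t$ is the tree of all occurrences of applications $x\vec q$ in $t$, ordered by subterm inclusion. $t$ is left-well-founded (LWF) if this tree is well-founded, i.e. there is no infinite sequence of application occurrences each strictly inside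 the previous one. **Interpretation.** Each $\mathrm{PCF}+\mathit{byval}$ term $M:\sigma$ has a denotation $[\![M]\!]\in\mathsf{SP}(\sigma)$: $[\![x]\!]=x^\eta$; $[\![\lambda x.M]\!]=\lambda x.[\![M]\!]$; $[\![MN]\!]=[\![M]\!]\cdot[\![N]\!]$; $[\![\widehat n]\!]=\lambda.n$; $[\![\mathit{suc}]\!]=\lambda x.\mathtt{case}\,x()\,\mathtt{of}(i\Rightarrow i+1)$; $[\![\mathit{pre}]\!]=\lambda x.\mathtt{case}\,x()\,\mathtt{of}(0\Rightarrow0\mid i+1\Rightarrow i)$; $[\![\mathit{ifzero}]\!]=\lambda xyz.\mathtt{case}\,x()\,\mathtt{of}(0\Rightarrow\mathtt{case}\,y()\,\mathtt{of}(j\Rightarrow j)\mid i+1\Rightarrow\mathtt{case}\,z()\,\mathtt{of}(j\Rightarrow j))$; $[\![\mathit{byval}^{\vec\sigma}_\tau]\!]=\lambda f\vec xn\vec y.\mathtt{case}\,n()\,\mathtt{of}(i\Rightarrow\mathtt{case}\,f\vec x^{\,\eta}(\lambda.i)\vec y^{\,\eta}\,\mathtt{of}(j\Rightarrow j))$; $[\![Y_\sigma]\!]=\lambda f\vec x.\mathtt{case}\,f\,q\,\vec x^{\,\eta}\,\mathtt{of}(i\Rightarrow i)$, where $q$ is the infinite procedure with $q=\lambda\vec y.\mathtt{case}\,f\,q\,\vec y^{\,\eta}\,\mathtt{of}(i\Rightarrow i)$. Terms of $\mathrm T+\mathit{min}$, $\mathrm W$, $\mathrm T_0^{\mathrm{str}}$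 are interpreted in $\mathsf{SP}$ via their translations. An element of $\mathsf{SP}^0(\sigma)$ is definable in one of these languages if it is the interpretation of a closed term of that language. **Trees and bar recursors.** $\langle\cdots\rangle:\mathbb N^*\to\mathbb N$ is a fixed standard (injective) primitive recursive coding of finite sequences. Write $\mathtt N^*$ for $\mathtt N$ when used for sequence codes. Fix closed $\mathrm T_0^{\mathrm{str}}$ programs $\mathrm{add}:\mathtt N^*\to\mathtt N\to\mathtt N^*$ and $\mathrm{basic}:\mathtt N^*\to\mathtt N\to(\mathtt N\to\mathtt N)$ such that $\mathrm{add}\,\langle\vec x\rangle\,z$ evaluates to $\langle\vec x,z\rangle$ and $\mathrm{basic}\,\langle\vec x\rangle\,j\,i$ evaluates to $x_i$ if $i<|\vec x|$ and to $j$ otherwise; identify them with their interpretations in $\mathsf{SP}^0$. For $F\in\mathsf{SP}^0(2)$, $\vec x\in\mathbb N^*$ satisfies the Kohlenbach bar condition w.r.t. $F$ if $F\cdot(\mathrm{basic}\cdot\langle\vec x\rangle\cdot0)=F\cdot(\mathrm{basic}\cdot\langle\vec x\rangle\cdot1)$. The tree $\mathcal T^K(F)\subseteq\mathbb N^*$ consists of all $\vec x$ no proper prefix of which satisfies this condition. $\mathcal T^K(F)^l$ is the set of leaves (nodes with no child in the tree) and $\mathcal T^K(F)^n$ the set of internal nodes (all of whose children $(\vec x,y)$, $y\in\mathbb N$, are in the tree). A *simplified weak Kohlenbach bar recursor* is an element $\Phi\in\mathsf{SP}^0(2\to2\to1)$ such that for all $\mathrm T_0^{\mathrm{str}}$-definable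 $F,G\in\mathsf{SP}^0(2)$ and all $\vec x\in\mathcal T^K(F)$: $\Phi\cdot F\cdot G\cdot\langle\vec x\rangle=2\langle\vec x\rangle+1$ if $\vec x\in\mathcal T^K(F)^l$; and $\Phi\cdot F\cdot G\cdot\langle\vec x\rangle=G\cdot(\lambda z^{\mathtt N}.\,\Phi\cdot F\cdot G\cdot(\mathrm{add}\cdot\langle\vec x\rangle\cdot z))$ if $\vec x\in\mathcal T^K(F)^n$. *)

theory Defs
  imports Main "HOL-Library.Nat_Bijection" "HOL-Library.Sublist"
begin

section \<open>Simple types\<close>

datatype ty = TN | Fun ty ty (infixr "\<Rrightarrow>" 60)

abbreviation funs :: "ty list \<Rightarrow> ty \<Rightarrow> ty" where
  "funs \<sigma>s \<tau> \<equiv> foldr Fun \<sigma>s \<tau>"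

fun args :: "ty \<Rightarrow> ty list" where
  "args TN = []"
| "args (\<sigma> \<Rrightarrow> \<tau>) = \<sigma> # args \<tau>"

primrec pure_ty :: "nat \<Rightarrow> ty" where
  "pure_ty 0 = TN"
| "pure_ty (Suc k) = pure_ty k \<Rrightarrow> TN"


section \<open>Nested sequential procedures\<close>

text \<open>
  Alpha-equivalence is built in by de Bruijn indices. An abstraction block binds its variables from
  left to right, the last one getting index 0; thus the body of \<open>Lam [\<sigma>\<^sub>0, \<dots>, \<sigma>\<^sub>r\<^sub>-\<^sub>1] e\<close> in context
  \<open>\<Gamma>\<close> lives in context \<open>rev [\<sigma>\<^sub>0, \<dots>, \<sigma>\<^sub>r\<^sub>-\<^sub>1] @ \<Gamma>\<close>. The terms are raw; well-typedness is
  imposed by the coinductive judgement below.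
\<close>

codatatype nsp_proc = Lam "ty list" nsp_exp
  and nsp_exp = Bot | Num nat | Case nsp_app "nat \<Rightarrow> nsp_exp"
  and nsp_app = App nat "nsp_proc list"

coinductive wtP :: "ty list \<Rightarrow> nsp_proc \<Rightarrow> ty \<Rightarrow> bool"
  and wtE :: "ty list \<Rightarrow> nsp_exp \<Rightarrow> bool"
  and wtA :: "ty list \<Rightarrow> nsp_app \<Rightarrow> bool"
where
  "wtE (rev \<sigma>s @ \<Gamma>) e \<Longrightarrow> wtP \<Gamma> (Lam \<sigma>s e) (funs \<sigma>s TN)"
| "wtE \<Gamma> Bot"
| "wtE \<Gamma> (Num n)"
| "wtA \<Gamma> a \<Longrightarrow> (\<And>i. wtE \<Gamma> (F i)) \<Longrightarrow> wtE \<Gamma> (Case a F)"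
| "x < length \<Gamma> \<Longrightarrow> \<Gamma> ! x = funs \<sigma>s TN \<Longrightarrow> list_all2 (wtP \<Gamma>) qs \<sigma>s \<Longrightarrow> wtA \<Gamma> (App x qs)"

definition SP0 :: "ty \<Rightarrow> nsp_proc set" where
  "SP0 \<sigma> = {p. wtP [] p \<sigma>}"

abbreviation num :: "nat \<Rightarrow> nsp_proc" where
  "num n \<equiv> Lam [] (Num n)"

text \<open>\<open>\<lambda>x. p\<close> where \<open>x\<close> is the variable with index 0 in \<open>p\<close>.\<close>

fun lam :: "ty \<Rightarrow> nsp_proc \<Rightarrow> nsp_proc" where
  "lam \<sigma> (Lam \<tau>s e) = Lam (\<sigma> # \<tau>s) e"

lemma size_list_args: "size_list size (args \<sigma>) = size \<sigma>"
  by (induction \<sigma>) auto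

text \<open>
  \<open>eta \<sigma> x\<close> is the eta-expansion of the variable \<open>x\<close> of type \<open>\<sigma>\<close>; \<open>etas k \<sigma>s\<close> lists the
  eta-expansions of consecutively bound variables of types \<open>\<sigma>s\<close>, the last of which has index \<open>k\<close>.
\<close>

function eta :: "ty \<Rightarrow> nat \<Rightarrow> nsp_proc"
  and etas :: "nat \<Rightarrow> ty list \<Rightarrow> nsp_proc list"
where
  "eta \<sigma> x = Lam (args \<sigma>) (Case (App (x + length (args \<sigma>)) (etas 0 (args \<sigma>))) Num)"
| "etas k [] = []"
| "etas k (\<sigma> # \<sigma>s) = eta \<sigma> (k + length \<sigma>s) # etas k \<sigma>s"
  by pat_completeness auto
termination
  by (relation "measure (case_sum (\<lambda>(\<sigma>, _). 2 * size \<sigma> + 1) (\<lambda>(_, \<sigma>s). 2 * size_list size \<sigma>s))")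
    (auto simp: size_list_args)

declare eta.simps [simp del]


section \<open>Left-well-foundedness\<close>

text \<open>
  An application occurrence is given by its path from the root: \<open>Br i\<close> enters the \<open>i\<close>-th branch of a
  case expression, \<open>Hd\<close> goes to its scrutinised application, and \<open>Arg j\<close> from there to the \<open>j\<close>-th
  argument. One application occurrence is strictly inside another iff its path properly extends the
  path of the other.
\<close>

datatype step = Hd | Arg nat | Br nat

inductive occP :: "step list \<Rightarrow> nsp_proc \<Rightarrow> bool"
  and occE :: "step list \<Rightarrow> nsp_exp \<Rightarrow> bool"
where
  "occE \<pi> e \<Longrightarrow> occP \<pi> (Lam \<sigma>s e)"
| "occE [Hd] (Case a F)"
| "j < length qs \<Longrightarrow> occP \<pi> (qs ! j) \<Longrightarrow> occE (Hd # Arg j # \<pi>) (Case (App x qs) F)"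
| "occE \<pi> (F i) \<Longrightarrow> occE (Br i # \<pi>) (Case a F)"

definition lwf :: "nsp_proc \<Rightarrow> bool" where
  "lwf p \<longleftrightarrow> \<not> (\<exists>f :: nat \<Rightarrow> step list. \<forall>k. occP (f k) p \<and> strict_prefix (f k) (f (Suc k)))"


section \<open>Meta-terms, head reduction and normal forms\<close>

codatatype mproc = MLam "ty list" mexp
  and mexp = MBot | MNum nat | MCase mgnd "nat \<Rightarrow> mexp"
  and mgnd = MExp mexp | MVar (mvar: nat) (margs: "mproc list") | MApp mproc "mproc list"

primcorec embP :: "nsp_proc \<Rightarrow> mproc"
  and embE :: "nsp_exp \<Rightarrow> mexp"
  and embA :: "nsp_app \<Rightarrow> mgnd"
where
  "embP p = (case p of Lam \<sigma>s e \<Rightarrow> MLam \<sigma>s (embE e))"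
| "embE e = (case e of Bot \<Rightarrow> MBot | Num n \<Rightarrow> MNum n | Case a F \<Rightarrow> MCase (embA a) (\<lambda>i. embE (F i)))"
| "embA a = (case a of App x qs \<Rightarrow> MVar x (map embP qs))"

definition up_ren :: "nat \<Rightarrow> (nat \<Rightarrow> nat) \<Rightarrow> nat \<Rightarrow> nat" where
  "up_ren k r i = (if i < k then i else r (i - k) + k)"

primcorec renP :: "(nat \<Rightarrow> nat) \<Rightarrow> mproc \<Rightarrow> mproc"
  and renE :: "(nat \<Rightarrow> nat) \<Rightarrow> mexp \<Rightarrow> mexp"
  and renG :: "(nat \<Rightarrow> nat) \<Rightarrow> mgnd \<Rightarrow> mgnd"
where
  "renP r P = (case P of MLam \<sigma>s E \<Rightarrow> MLam \<sigma>s (renE (up_ren (length \<sigma>s) r) E))"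
| "renE r E = (case E of MBot \<Rightarrow> MBot | MNum n \<Rightarrow> MNum n
     | MCase G F \<Rightarrow> MCase (renG r G) (\<lambda>i. renE r (F i)))"
| "renG r G = (case G of MExp E \<Rightarrow> MExp (renE r E)
     | MVar x Qs \<Rightarrow> MVar (r x) (map (renP r) Qs)
     | MApp P Qs \<Rightarrow> MApp (renP r P) (map (renP r) Qs))"

text \<open>
  A simultaneous substitution maps each variable either to a variable or to a meta-procedure; in the
  latter case \<open>x Q\<^sub>0 \<dots> Q\<^sub>r\<^sub>-\<^sub>1\<close> becomes an application of that meta-procedure.
\<close>

type_synonym msubst = "nat \<Rightarrow> nat + mproc"

definition up_subst :: "nat \<Rightarrow> msubst \<Rightarrow> msubst" where
  "up_subst k s i = (if i < k then Inl i else
     (case s (i - k) of Inl y \<Rightarrow> Inl (y + k) | Inr P \<Rightarrow> Inr (renP (\<lambda>j. j + k) P)))"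

primcorec substP :: "msubst \<Rightarrow> mproc \<Rightarrow> mproc"
  and substE :: "msubst \<Rightarrow> mexp \<Rightarrow> mexp"
  and substG :: "msubst \<Rightarrow> mgnd \<Rightarrow> mgnd"
where
  "substP s P = (case P of MLam \<sigma>s E \<Rightarrow> MLam \<sigma>s (substE (up_subst (length \<sigma>s) s) E))"
| "substE s E = (case E of MBot \<Rightarrow> MBot | MNum n \<Rightarrow> MNum n
     | MCase G F \<Rightarrow> MCase (substG s G) (\<lambda>i. substE s (F i)))"
| "substG s G = (case G of MExp E \<Rightarrow> MExp (substE s E)
     | MVar x Qs \<Rightarrow> (case s x of Inl y \<Rightarrow> MVar y (map (substP s) Qs)
                              | Inr P \<Rightarrow> MApp P (map (substP s) Qs))
     | MApp P Qs \<Rightarrow> MApp (substP s P) (map (substP s) Qs))"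

text \<open>
  Replaces the variables of the innermost binding block by \<open>Qs\<close> and removes that block from the
  context. The list is reversed because the last variable of a block has index 0.
\<close>

definition inst :: "mproc list \<Rightarrow> msubst" where
  "inst Qs i = (if i < length Qs then Inr (rev Qs ! i) else Inl (i - length Qs))"

inductive hredG :: "mgnd \<Rightarrow> mgnd \<Rightarrow> bool"
  and hredE :: "mexp \<Rightarrow> mexp \<Rightarrow> bool"
where
  "length Qs = length \<sigma>s \<Longrightarrow> hredG (MApp (MLam \<sigma>s E) Qs) (MExp (substE (inst Qs) E))"
| "hredE E E' \<Longrightarrow> hredG (MExp E) (MExp E')"
| "hredE (MCase (MExp MBot) F) MBot"
| "hredE (MCase (MExp (MNum n)) F) (F n)"
| "hredE (MCase (MExp (MCase G E)) F) (MCase G (\<lambda>i. MCase (MExp (E i)) F))"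
| "hredG G G' \<Longrightarrow> (\<nexists>H E. G = MExp (MCase H E)) \<Longrightarrow> hredE (MCase G F) (MCase G' F)"

fun is_hnf :: "mexp \<Rightarrow> bool" where
  "is_hnf MBot = True"
| "is_hnf (MNum n) = True"
| "is_hnf (MCase (MVar x Qs) F) = True"
| "is_hnf (MCase _ F) = False"

lemma value_irreducible: "\<not> hredG (MExp MBot) G" "\<not> hredG (MExp (MNum n)) G"
proof -
  have "\<not> hredE MBot E" "\<not> hredE (MNum n) E" for E
    by (rule notI, erule hredE.cases, simp_all)+
  then show "\<not> hredG (MExp MBot) G" "\<not> hredG (MExp (MNum n)) G"
    by - (rule notI, erule hredG.cases, simp_all)+
qed

lemma hred_deterministic:
  "hredG G G1 \<Longrightarrow> \<forall>G2. hredG G G2 \<longrightarrow> G1 = G2"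
  "hredE E E1 \<Longrightarrow> \<forall>E2. hredE E E2 \<longrightarrow> E1 = E2"
proof (induction rule: hredG_hredE.inducts)
  case (1 Qs \<sigma>s E) show ?case by (intro allI impI, erule hredG.cases) simp_all
next
  case (2 E E')
  show ?case
  proof (intro allI impI)
    fix G2 assume "hredG (MExp E) G2"
    then show "MExp E' = G2" by cases (use 2 in auto)
  qed
next
  case (3 F)
  show ?case
  proof (intro allI impI)
    fix E2 assume "hredE (MCase (MExp MBot) F) E2"
    then show "MBot = E2" by cases (auto simp: value_irreducible)
  qed
next
  case (4 n F)
  show ?case
  proof (intro allI impI)
    fix E2 assume "hredE (MCase (MExp (MNum n)) F) E2"
    then show "F n = E2" by cases (auto simp: value_irreducible)
  qed
next
  case (5 G E F)
  show ?case
  proof (intro allI impI)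
    fix E2 assume "hredE (MCase (MExp (MCase G E)) F) E2"
    then show "MCase G (\<lambda>i. MCase (MExp (E i)) F) = E2" by cases auto
  qed
next
  case (6 G G' F)
  have not_value: "G \<noteq> MExp MBot" "G \<noteq> MExp (MNum n)" for n
    using 6(1) by (rule contrapos_pn, simp add: value_irreducible)+
  show ?case
  proof (intro allI impI)
    fix E2 assume "hredE (MCase G F) E2"
    then show "MCase G' F = E2"
    proof cases
      case (4 G2)
      with 6(3) show ?thesis by blast
    qed (use 6(2) not_value in simp_all)
  qed
qed

definition hnf :: "mexp \<Rightarrow> mexp" where
  "hnf E = (if \<exists>E'. hredE\<^sup>*\<^sup>* E E' \<and> is_hnf E' then THE E'. hredE\<^sup>*\<^sup>* E E' \<and> is_hnf E' else MBot)"

text \<open>In \<open>nfE\<close> the scrutinee \<open>G\<close> is always of the form \<open>MVar x Qs\<close>, so \<open>mvar\<close> and \<open>margs\<close> are defined.\<close>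

primcorec nfP :: "mproc \<Rightarrow> nsp_proc"
  and nfE :: "mexp \<Rightarrow> nsp_exp"
  and nfG :: "mgnd \<Rightarrow> nsp_app"
where
  "nfP P = (case P of MLam \<sigma>s E \<Rightarrow> Lam \<sigma>s (nfE E))"
| "nfE E = (case hnf E of MBot \<Rightarrow> Bot | MNum n \<Rightarrow> Num n | MCase G F \<Rightarrow> Case (nfG G) (\<lambda>i. nfE (F i)))"
| "nfG G = App (mvar G) (map nfP (margs G))"

text \<open>
  Application of procedures. With \<open>p = Lam (\<sigma> # \<tau>s) e\<close>, the argument replaces the first variable of
  the block, which has index \<open>length \<tau>s\<close> in \<open>e\<close>. The value on an abstraction over the empty block
  (a procedure of type \<open>TN\<close>) is a dummy.
\<close>

fun dot :: "nsp_proc \<Rightarrow> nsp_proc \<Rightarrow> nsp_proc" (infixl "\<cdot>" 75) where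
  "Lam (\<sigma> # \<tau>s) e \<cdot> q = nfP (MLam \<tau>s (substE (up_subst (length \<tau>s) (inst [embP q])) (embE e)))"
| "Lam [] e \<cdot> q = Lam [] Bot"


section \<open>Languages\<close>

datatype 'c tm = Var nat | Abs ty "'c tm" | Ap "'c tm" "'c tm" (infixl "$$" 75) | Con 'c

inductive wt :: "('c \<Rightarrow> ty) \<Rightarrow> ty list \<Rightarrow> 'c tm \<Rightarrow> ty \<Rightarrow> bool" for ct :: "'c \<Rightarrow> ty" where
  "x < length \<Gamma> \<Longrightarrow> wt ct \<Gamma> (Var x) (\<Gamma> ! x)"
| "wt ct (\<sigma> # \<Gamma>) M \<tau> \<Longrightarrow> wt ct \<Gamma> (Abs \<sigma> M) (\<sigma> \<Rrightarrow> \<tau>)"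
| "wt ct \<Gamma> M (\<sigma> \<Rrightarrow> \<tau>) \<Longrightarrow> wt ct \<Gamma> L \<sigma> \<Longrightarrow> wt ct \<Gamma> (M $$ L) \<tau>"
| "wt ct \<Gamma> (Con c) (ct c)"

datatype pcf = Numeral nat | Succ | Pre | Ifzero | Y ty | Byval "ty list" ty

datatype const = PCF pcf | Rec ty | Min | While ty | RecStr

abbreviation rec_ty :: "ty \<Rightarrow> ty" where
  "rec_ty \<sigma> \<equiv> \<sigma> \<Rrightarrow> (\<sigma> \<Rrightarrow> TN \<Rrightarrow> \<sigma>) \<Rrightarrow> TN \<Rrightarrow> \<sigma>"

abbreviation min_ty :: ty where
  "min_ty \<equiv> (TN \<Rrightarrow> TN) \<Rrightarrow> TN \<Rrightarrow> TN"

primrec pcf_ty :: "pcf \<Rightarrow> ty" where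
  "pcf_ty (Numeral n) = TN"
| "pcf_ty Succ = TN \<Rrightarrow> TN"
| "pcf_ty Pre = TN \<Rrightarrow> TN"
| "pcf_ty Ifzero = TN \<Rrightarrow> TN \<Rrightarrow> TN \<Rrightarrow> TN"
| "pcf_ty (Y \<sigma>) = (\<sigma> \<Rrightarrow> \<sigma>) \<Rrightarrow> \<sigma>"
| "pcf_ty (Byval \<sigma>s \<tau>) = funs \<sigma>s (TN \<Rrightarrow> \<tau>) \<Rrightarrow> funs \<sigma>s (TN \<Rrightarrow> \<tau>)"

primrec const_ty :: "const \<Rightarrow> ty" where
  "const_ty (PCF c) = pcf_ty c"
| "const_ty (Rec \<sigma>) = rec_ty \<sigma>"
| "const_ty Min = min_ty"
| "const_ty (While \<sigma>) = (\<sigma> \<Rrightarrow> TN) \<Rrightarrow> \<sigma> \<Rrightarrow> (\<sigma> \<Rrightarrow> \<sigma>) \<Rrightarrow> \<sigma>"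
| "const_ty RecStr = rec_ty TN"

text \<open>
  A language is given by its set of constants. The interpretation is defined on \<open>pcf tm\<close> only, the
  terms of PCF + byval; the remaining constants are eliminated by \<open>translate\<close> below.
\<close>

definition lang_B :: "const set" where
  "lang_B = {PCF Succ, PCF Pre, PCF Ifzero} \<union> range (\<lambda>n. PCF (Numeral n))"

definition lang_Tmin :: "const set" where
  "lang_Tmin = lang_B \<union> range Rec \<union> {Min}"

definition lang_W :: "const set" where
  "lang_W = lang_B \<union> range While"

definition lang_T0str :: "const set" where
  "lang_T0str = lang_B \<union> {PCF (Byval [] TN), RecStr}"

abbreviation ifzero_at :: "ty \<Rightarrow> pcf tm" where
  "ifzero_at \<sigma> \<equiv>
     (let \<tau>s = args \<sigma>; r = length \<tau>s; zs = map Var (rev [0..<r]) in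
      \<comment> \<open>\<open>\<lambda>n x y z\<^sub>0 \<dots> z\<^sub>r\<^sub>-\<^sub>1. ifzero n (x z\<^sub>0 \<dots> z\<^sub>r\<^sub>-\<^sub>1) (y z\<^sub>0 \<dots> z\<^sub>r\<^sub>-\<^sub>1)\<close>\<close>
      Abs TN (Abs \<sigma> (Abs \<sigma> (foldr Abs \<tau>s
        (Con Ifzero $$ Var (r + 2) $$ foldl Ap (Var (r + 1)) zs $$ foldl Ap (Var r) zs)))))"

abbreviation byval_plus :: "ty \<Rightarrow> pcf tm" where
  "byval_plus \<sigma> \<equiv> Con (Byval [\<sigma>, \<sigma> \<Rrightarrow> TN \<Rrightarrow> \<sigma>] \<sigma>)"

text \<open>
  The programs replacing the constants. The comments list the variables in scope with decreasing
  index, the last one having index 0.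
\<close>

fun prog :: "const \<Rightarrow> pcf tm" where
  "prog (PCF c) = Con c"
| "prog (Rec \<sigma>) =
    byval_plus \<sigma> $$ (Con (Y (rec_ty \<sigma>)) $$
      Abs (rec_ty \<sigma>) (Abs \<sigma> (Abs (\<sigma> \<Rrightarrow> TN \<Rrightarrow> \<sigma>) (Abs TN  \<comment> \<open>\<open>r x f n\<close>\<close>
        (ifzero_at \<sigma> $$ Var 0 $$ Var 2 $$
          (Con (Byval [] \<sigma>) $$
            Abs TN  \<comment> \<open>\<open>r x f n n'\<close>\<close>
              (Var 2 $$ (byval_plus \<sigma> $$ Var 4 $$ Var 3 $$ Var 2 $$ Var 0) $$ Var 0) $$
            (Con Pre $$ Var 0)))))))"
| "prog Min =
    Con (Byval [TN \<Rrightarrow> TN] TN) $$ (Con (Y min_ty) $$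
      Abs min_ty (Abs (TN \<Rrightarrow> TN) (Abs TN  \<comment> \<open>\<open>m f n\<close>\<close>
        (Con Ifzero $$ (Var 1 $$ Var 0) $$ Var 0 $$
          (Con (Byval [TN \<Rrightarrow> TN] TN) $$ Var 2 $$ Var 1 $$ (Con Succ $$ Var 0))))))"
| "prog (While \<sigma>) =
    Abs (\<sigma> \<Rrightarrow> TN) (Abs \<sigma> (Abs (\<sigma> \<Rrightarrow> \<sigma>)  \<comment> \<open>\<open>c x f\<close>\<close>
      (Con (Y (\<sigma> \<Rrightarrow> \<sigma>)) $$
        Abs (\<sigma> \<Rrightarrow> \<sigma>) (Abs \<sigma>  \<comment> \<open>\<open>c x f w x'\<close>\<close>
          (ifzero_at \<sigma> $$ (Var 4 $$ Var 0) $$ (Var 1 $$ (Var 2 $$ Var 0)) $$ Var 0)) $$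
        Var 1)))"
| "prog RecStr =
    byval_plus TN $$ (Con (Y (rec_ty TN)) $$
      Abs (rec_ty TN) (Abs TN (Abs (TN \<Rrightarrow> TN \<Rrightarrow> TN) (Abs TN  \<comment> \<open>\<open>r x f n\<close>\<close>
        (Con Ifzero $$ Var 0 $$ Var 2 $$
          (Con (Byval [] TN) $$
            Abs TN  \<comment> \<open>\<open>r x f n n'\<close>\<close>
              (Con (Byval [] TN) $$
                Abs TN  \<comment> \<open>\<open>r x f n n' m\<close>\<close>
                  (Var 3 $$ Var 0 $$ Var 1) $$
                (byval_plus TN $$ Var 4 $$ Var 3 $$ Var 2 $$ Var 0)) $$
            (Con Pre $$ Var 0)))))))"

primrec translate :: "const tm \<Rightarrow> pcf tm" where
  "translate (Var x) = Var x"
| "translate (Abs \<sigma> M) = Abs \<sigma> (translate M)"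
| "translate (M $$ L) = translate M $$ translate L"
| "translate (Con c) = prog c"


section \<open>Interpretation in nested sequential procedures\<close>

text \<open>
  \<open>yproc \<sigma> k\<close> is the infinite procedure \<open>q\<close> with \<open>q = \<lambda>y\<^sub>0 \<dots> y\<^sub>r\<^sub>-\<^sub>1. case f q y\<^sub>0 \<dots> y\<^sub>r\<^sub>-\<^sub>1 of (i \<Rightarrow> i)\<close>, where
  \<open>k\<close> is the index of \<open>f\<close> outside \<open>q\<close>, so that \<open>k + r\<close> is its index in the body. In the argument
  list, \<open>None\<close> stands for the inner \<open>q\<close>.
\<close>

primcorec yproc :: "ty \<Rightarrow> nat \<Rightarrow> nsp_proc"
  and yexp :: "ty \<Rightarrow> nat \<Rightarrow> nsp_exp"
  and yapp :: "ty \<Rightarrow> nat \<Rightarrow> nsp_app"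
where
  "yproc \<sigma> k = Lam (args \<sigma>) (yexp \<sigma> (k + length (args \<sigma>)))"
| "yexp \<sigma> k = Case (yapp \<sigma> k) Num"
| "yapp \<sigma> k = App k (map (\<lambda>a. case a of None \<Rightarrow> yproc \<sigma> k | Some q \<Rightarrow> q)
                         (None # map Some (etas 0 (args \<sigma>))))"

lemma yproc_unfold:
  "yproc \<sigma> k = (let r = length (args \<sigma>) in
     Lam (args \<sigma>) (Case (App (k + r) (yproc \<sigma> (k + r) # etas 0 (args \<sigma>))) Num))"
  by (subst yproc.code, subst yexp.code, subst yapp.code) (simp add: comp_def Let_def)

fun pcf_den :: "pcf \<Rightarrow> nsp_proc" where
  "pcf_den (Numeral n) = num n"
| "pcf_den Succ = Lam [TN] (Case (App 0 []) (\<lambda>i. Num (Suc i)))"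
| "pcf_den Pre = Lam [TN] (Case (App 0 []) (\<lambda>i. case i of 0 \<Rightarrow> Num 0 | Suc j \<Rightarrow> Num j))"
| "pcf_den Ifzero = Lam [TN, TN, TN] (Case (App 2 [])
     (\<lambda>i. case i of 0 \<Rightarrow> Case (App 1 []) Num | Suc _ \<Rightarrow> Case (App 0 []) Num))"
| "pcf_den (Y \<sigma>) = lam (\<sigma> \<Rrightarrow> \<sigma>) (yproc \<sigma> 0)"
| "pcf_den (Byval \<sigma>s \<tau>) =
     (let r = length (args \<tau>) in
      Lam (funs \<sigma>s (TN \<Rrightarrow> \<tau>) # \<sigma>s @ TN # args \<tau>)
        (Case (App r [])
          (\<lambda>i. Case (App (r + 1 + length \<sigma>s) (etas (r + 1) \<sigma>s @ num i # etas 0 (args \<tau>))) Num)))"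

primrec den :: "ty list \<Rightarrow> pcf tm \<Rightarrow> nsp_proc" where
  "den \<Gamma> (Var x) = eta (\<Gamma> ! x) x"
| "den \<Gamma> (Abs \<sigma> M) = lam \<sigma> (den (\<sigma> # \<Gamma>) M)"
| "den \<Gamma> (M $$ L) = den \<Gamma> M \<cdot> den \<Gamma> L"
| "den \<Gamma> (Con c) = pcf_den c"

definition definable :: "const set \<Rightarrow> ty \<Rightarrow> nsp_proc \<Rightarrow> bool" where
  "definable L \<sigma> p \<longleftrightarrow>
     (\<exists>M. set_tm M \<subseteq> L \<and> wt const_ty [] M \<sigma> \<and> p = den [] (translate M))"


section \<open>Bar recursors\<close>

text \<open>The coding of finite sequences is the library bijection \<^const>\<open>list_encode\<close>.\<close>

abbreviation code :: "nat list \<Rightarrow> nsp_proc" where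
  "code xs \<equiv> num (list_encode xs)"

definition is_add :: "nsp_proc \<Rightarrow> bool" where
  "is_add add \<longleftrightarrow> definable lang_T0str (TN \<Rrightarrow> TN \<Rrightarrow> TN) add \<and>
     (\<forall>xs z. add \<cdot> code xs \<cdot> num z = code (xs @ [z]))"

definition is_basic :: "nsp_proc \<Rightarrow> bool" where
  "is_basic basic \<longleftrightarrow> definable lang_T0str (TN \<Rrightarrow> TN \<Rrightarrow> TN \<Rrightarrow> TN) basic \<and>
     (\<forall>xs j i. basic \<cdot> code xs \<cdot> num j \<cdot> num i = num (if i < length xs then xs ! i else j))"

definition kohlenbach_bar :: "nsp_proc \<Rightarrow> nsp_proc \<Rightarrow> nat list \<Rightarrow> bool" where
  "kohlenbach_bar basic F xs \<longleftrightarrow> F \<cdot> (basic \<cdot> code xs \<cdot> num 0) = F \<cdot> (basic \<cdot> code xs \<cdot> num 1)"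

definition ktree :: "nsp_proc \<Rightarrow> nsp_proc \<Rightarrow> nat list set" where
  "ktree basic F = {xs. \<forall>ys. strict_prefix ys xs \<longrightarrow> \<not> kohlenbach_bar basic F ys}"

definition leaves :: "nat list set \<Rightarrow> nat list set" where
  "leaves T = {xs \<in> T. \<forall>y. xs @ [y] \<notin> T}"

definition internal_nodes :: "nat list set \<Rightarrow> nat list set" where
  "internal_nodes T = {xs \<in> T. \<forall>y. xs @ [y] \<in> T}"

text \<open>
  In the second equation \<open>eta TN 0\<close> is the variable \<open>z\<close> bound by \<^const>\<open>lam\<close>; the procedures
  \<open>\<Phi>\<close>, \<open>F\<close>, \<open>G\<close>, \<open>add\<close> are closed and need no index shift.
\<close>

definition simplified_weak_kohlenbach_bar_recursor ::
  "nsp_proc \<Rightarrow> nsp_proc \<Rightarrow> nsp_proc \<Rightarrow> bool" where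
  "simplified_weak_kohlenbach_bar_recursor add basic \<Phi> \<longleftrightarrow>
     \<Phi> \<in> SP0 (pure_ty 2 \<Rrightarrow> pure_ty 2 \<Rrightarrow> pure_ty 1) \<and>
     (\<forall>F G. definable lang_T0str (pure_ty 2) F \<longrightarrow> definable lang_T0str (pure_ty 2) G \<longrightarrow>
       (\<forall>xs \<in> leaves (ktree basic F). \<Phi> \<cdot> F \<cdot> G \<cdot> code xs = num (2 * list_encode xs + 1)) \<and>
       (\<forall>xs \<in> internal_nodes (ktree basic F).
          \<Phi> \<cdot> F \<cdot> G \<cdot> code xs = G \<cdot> lam TN (\<Phi> \<cdot> F \<cdot> G \<cdot> (add \<cdot> code xs \<cdot> eta TN 0))))"

end

theory Submission
  imports Defs "HOL-Library.Multiset"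
begin

text \<open>
  A left-well-founded \<open>\<Phi>\<close> can nest its calls of \<open>G\<close> only to a well-founded extent, and an adversary
  exploits this. Given a path \<open>ys\<close>, let \<open>F\<close> return \<open>g k\<close> for the first \<open>k\<close> at which \<open>g\<close> leaves \<open>ys\<close>.
  Then the nodes on \<open>ys\<close> are internal, and their children off the path are leaves. Let \<open>G\<close> follow
  the path and pass on the value of the leaf at its end, but only if it receives exactly this value
  from the next node on the path. A run of \<open>\<Phi>\<close> is finite, so extending \<open>ys\<close> by a sufficiently large
  entry \<open>y\<close> changes its course only where \<open>G\<close> now calls its argument at \<open>y\<close>. These calls sit strictly
  deeper in the application tree, so the procedure ends with a path whose leaf value \<open>\<Phi>\<close> does not
  return, against the recursion equations.

  The denotations of T + min and W are hereditarily left-well-founded by a reducibility argument in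
  the style of Tait. Primitive recursion unfolds finitely often at each numeral, whereas minimisation
  and iteration unfold forever, but only in tail position, which adds no nesting. All this rests on
  the fact that equality of normal forms is a congruence for substitution.
\<close>

section \<open>Substitution in meta-terms\<close>

text \<open>Both halves of the theorem meet in one statement: \<open>good\<close> fails for
  \<open>\<Phi>\<close> applied to two type-2 variables and the code of the empty sequence.
  Left-well-foundedness yields \<open>good\<close> by following the application tree, definability
  yields it by reducibility, and \<open>not_good\<close> refutes it.

  The adversary must alter \<open>G\<close> without losing termination, hence the flag
  \<open>b\<close>. With \<open>False\<close>, \<open>G\<close> asks the same questions but returns
  0 on every node of the path; the whole run then ends in 0, which forces the calls added by a
  longer path to terminate. With \<open>True\<close>, \<open>G\<close> passes the leaf value on, and
  the recursion equations force that value at the root. Stability compares a run for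
  \<open>False\<close> on the old path with runs for either flag on the longer one.

  Path entries are at least 2 because the bar condition compares the default entries 0 and 1: on a
  path node \<open>F\<close> leaves the path at once and returns the default itself. The equations
  of \<open>\<Phi>\<close> are granted for definable \<open>F\<close> and \<open>G\<close> only, so
  both are finite decision trees realised by terms.\<close>

lemma emb_simps [simp]:
  "embP (Lam \<sigma>s e) = MLam \<sigma>s (embE e)"
  "embE Bot = MBot" "embE (Num n) = MNum n"
  "embE (Case a F) = MCase (embA a) (\<lambda>i. embE (F i))"
  "embA (App x qs) = MVar x (map embP qs)"
  by (subst embP.code embE.code embA.code; simp)+

lemma ren_simps [simp]:
  "renP r (MLam \<sigma>s E) = MLam \<sigma>s (renE (up_ren (length \<sigma>s) r) E)"
  "renE r MBot = MBot" "renE r (MNum n) = MNum n"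
  "renE r (MCase G F) = MCase (renG r G) (\<lambda>i. renE r (F i))"
  "renG r (MExp E) = MExp (renE r E)"
  "renG r (MVar x Qs) = MVar (r x) (map (renP r) Qs)"
  "renG r (MApp P Qs) = MApp (renP r P) (map (renP r) Qs)"
  by (subst renP.code renE.code renG.code; simp)+

lemma subst_simps [simp]:
  "substP s (MLam \<sigma>s E) = MLam \<sigma>s (substE (up_subst (length \<sigma>s) s) E)"
  "substE s MBot = MBot" "substE s (MNum n) = MNum n"
  "substE s (MCase G F) = MCase (substG s G) (\<lambda>i. substE s (F i))"
  "substG s (MExp E) = MExp (substE s E)"
  "substG s (MVar x Qs) = (case s x of Inl y \<Rightarrow> MVar y (map (substP s) Qs)
     | Inr P \<Rightarrow> MApp P (map (substP s) Qs))"
  "substG s (MApp P Qs) = MApp (substP s P) (map (substP s) Qs)"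
  by (subst substP.code substE.code substG.code; simp split: sum.splits)+


text \<open>The generated principle is used with each relation joined with equality, so that a
  clause may end in identical subterms. The disjunct \<open>P = P'\<close> for heads serves
  substitution: a procedure put in place of a variable is the same on both sides without being
  related by \<open>R1\<close>.\<close>

lemma meta_coinduct:
  assumes P: "\<And>P P'. R1 P P' \<Longrightarrow> \<exists>\<sigma>s E E'. P = MLam \<sigma>s E \<and> P' = MLam \<sigma>s E' \<and> R2 E E'"
    and E: "\<And>E E'. R2 E E' \<Longrightarrow> E = E' \<or> (\<exists>G G' F F'. E = MCase G F \<and> E' = MCase G' F' \<and>
      R3 G G' \<and> (\<forall>i. R2 (F i) (F' i)))"
    and G: "\<And>G G'. R3 G G' \<Longrightarrow> (\<exists>E E'. G = MExp E \<and> G' = MExp E' \<and> R2 E E') \<or>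
      (\<exists>x Qs Qs'. G = MVar x Qs \<and> G' = MVar x Qs' \<and> list_all2 R1 Qs Qs') \<or>
      (\<exists>P P' Qs Qs'. G = MApp P Qs \<and> G' = MApp P' Qs' \<and> (R1 P P' \<or> P = P') \<and> list_all2 R1 Qs Qs')"
  shows "R1 P P' \<Longrightarrow> P = P'" "R2 E E' \<Longrightarrow> E = E'" "R3 G G' \<Longrightarrow> G = G'"
proof -
  let ?R1 = "\<lambda>P P'. R1 P P' \<or> P = P'" and ?R2 = "\<lambda>E E'. R2 E E' \<or> E = E'"
    and ?R3 = "\<lambda>G G'. R3 G G' \<or> G = G'"
  have *: "(?R1 P P' \<longrightarrow> P = P') \<and> (?R2 E E' \<longrightarrow> E = E') \<and> (?R3 G G' \<longrightarrow> G = G')"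
  proof (rule mproc_mexp_mgnd.coinduct, goal_cases)
    case (1 P P')
    then show ?case using P[of P P'] by auto
  next
    case (2 E E')
    then show ?case using E[of E E'] by (auto simp: rel_fun_def)
  next
    case (3 G G')
    have mono: "list_all2 ?R1 Qs Qs'" if "list_all2 R1 Qs Qs'" for Qs Qs'
      using that by (rule list_all2_mono) simp
    from 3 show ?case using G[of G G'] by (auto simp: list_all2_refl dest!: mono)
  qed
  show "R1 P P' \<Longrightarrow> P = P'" "R2 E E' \<Longrightarrow> E = E'" "R3 G G' \<Longrightarrow> G = G'"
    using * by auto
qed

text \<open>The laws of renaming and substitution compare two functions that traverse a meta-term
  alike and differ at variables only. \<open>a\<close> stands for the maps being carried and
  \<open>u k a\<close> for their lifting under \<open>k\<close> binders. What remains of each law is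
  that lifting commutes with the operation, and the variable clause \<open>V\<close>.\<close>

lemma meta_fun_coinduct:
  assumes P: "\<And>a \<sigma>s E. fP a (MLam \<sigma>s E) = MLam \<sigma>s (fE (u (length \<sigma>s) a) E) \<and>
      gP a (MLam \<sigma>s E) = MLam \<sigma>s (gE (u (length \<sigma>s) a) E)"
    and B: "\<And>a. fE a MBot = gE a MBot" and N: "\<And>a n. fE a (MNum n) = gE a (MNum n)"
    and C: "\<And>a G F. fE a (MCase G F) = MCase (fG a G) (\<lambda>i. fE a (F i))"
       "\<And>a G F. gE a (MCase G F) = MCase (gG a G) (\<lambda>i. gE a (F i))"
    and G: "\<And>a E. fG a (MExp E) = MExp (fE a E)"
        "\<And>a E. gG a (MExp E) = MExp (gE a E)"
        "\<And>a P Qs. fG a (MApp P Qs) = MApp (fP a P) (map (fP a) Qs)"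
        "\<And>a P Qs. gG a (MApp P Qs) = MApp (gP a P) (map (gP a) Qs)"
    and V: "\<And>a x Qs. (\<exists>y. fG a (MVar x Qs) = MVar y (map (fP a) Qs) \<and> gG a (MVar x Qs) = MVar y (map (gP a) Qs)) \<or>
        (\<exists>P. fG a (MVar x Qs) = MApp P (map (fP a) Qs) \<and> gG a (MVar x Qs) = MApp P (map (gP a) Qs))"
  shows "fP a P = gP a P" "fE a E = gE a E"
proof -
  define R1 where "R1 P P' \<longleftrightarrow> (\<exists>a Q. P = fP a Q \<and> P' = gP a Q)" for P P'
  define R2 where "R2 E E' \<longleftrightarrow> (\<exists>a D. E = fE a D \<and> E' = gE a D)" for E E'
  define R3 where "R3 G G' \<longleftrightarrow> (\<exists>a H. G = fG a H \<and> G' = gG a H)" for G G'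
  have list: "list_all2 R1 (map (fP a) Qs) (map (gP a) Qs)" for a Qs
    by (auto simp: list_all2_conv_all_nth R1_def)
  have 1: "\<exists>\<sigma>s E E'. P = MLam \<sigma>s E \<and> P' = MLam \<sigma>s E' \<and> R2 E E'" if "R1 P P'" for P P'
  proof -
    from that obtain a Q where a: "P = fP a Q" "P' = gP a Q" by (auto simp: R1_def)
    obtain \<sigma>s E where "Q = MLam \<sigma>s E" by (cases Q)
    moreover have "R2 (fE (u (length \<sigma>s) a) E) (gE (u (length \<sigma>s) a) E)"
      using P[of a \<sigma>s E] by (auto simp: R2_def)
    ultimately show ?thesis using P[of a \<sigma>s E] a by simp
  qed
  have 2: "E = E' \<or> (\<exists>G G' F F'. E = MCase G F \<and> E' = MCase G' F' \<and>
      R3 G G' \<and> (\<forall>i. R2 (F i) (F' i)))" if "R2 E E'" for E E'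
  proof -
    from that obtain a D where a: "E = fE a D" "E' = gE a D" by (auto simp: R2_def)
    show ?thesis
    proof (cases D)
      case (MCase G F)
      moreover have "R3 (fG a G) (gG a G)" "R2 (fE a (F i)) (gE a (F i))" for i
        by (auto simp: R2_def R3_def)
      ultimately show ?thesis using C a by simp
    qed (use a B N in auto)
  qed
  have 3: "(\<exists>E E'. G = MExp E \<and> G' = MExp E' \<and> R2 E E') \<or>
      (\<exists>x Qs Qs'. G = MVar x Qs \<and> G' = MVar x Qs' \<and> list_all2 R1 Qs Qs') \<or>
      (\<exists>P P' Qs Qs'. G = MApp P Qs \<and> G' = MApp P' Qs' \<and> (R1 P P' \<or> P = P') \<and> list_all2 R1 Qs Qs')"
    if "R3 G G'" for G G'
  proof -
    from that obtain a H where a: "G = fG a H" "G' = gG a H" by (auto simp: R3_def)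
    show ?thesis
    proof (cases H)
      case (MExp E)
      then show ?thesis using a G(1,2) by (auto simp: R2_def)
    next
      case (MVar x Qs)
      then show ?thesis using a V[of a x Qs] list[of a Qs] by auto
    next
      case (MApp P Qs)
      then show ?thesis using a G(3,4) list[of a Qs] by (auto simp: R1_def)
    qed
  qed
  show "fP a P = gP a P"
    by (rule meta_coinduct(1)[of R1 R2 R3], erule 1, erule 2, erule 3) (auto simp: R1_def)
  show "fE a E = gE a E"
    by (rule meta_coinduct(2)[of R1 R2 R3], erule 1, erule 2, erule 3) (auto simp: R2_def)
qed

section \<open>The laws of renaming and substitution\<close>

lemma ren_eq_subst:
  "renP r P = substP (\<lambda>i. Inl (r i)) P" "renE r E = substE (\<lambda>i. Inl (r i)) E"
proof -
  have [simp]: "up_subst k (\<lambda>i. Inl (r i)) = (\<lambda>i. Inl (up_ren k r i))" for k r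
    by (auto simp: up_subst_def up_ren_def)
  note co = meta_fun_coinduct[where u=up_ren and fP=renP and fE=renE and fG=renG
     and gP="\<lambda>r. substP (\<lambda>i. Inl (r i))" and gE="\<lambda>r. substE (\<lambda>i. Inl (r i))" and gG="\<lambda>r. substG (\<lambda>i. Inl (r i))"]
  show "renP r P = substP (\<lambda>i. Inl (r i)) P" by (rule co(1)) auto
  show "renE r E = substE (\<lambda>i. Inl (r i)) E" by (rule co(2)) auto
qed

lemma subst_ren:
  "substP s (renP r P) = substP (\<lambda>i. s (r i)) P" "substE s (renE r E) = substE (\<lambda>i. s (r i)) E"
proof -
  have [simp]: "(\<lambda>i. up_subst k s (up_ren k r i)) = up_subst k (\<lambda>i. s (r i))" for k s r
    by (auto simp: up_subst_def up_ren_def fun_eq_iff)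
  note co = meta_fun_coinduct[where u="\<lambda>k (s, r). (up_subst k s, up_ren k r)" and
     fP="\<lambda>(s, r) P. substP s (renP r P)" and fE="\<lambda>(s, r) P. substE s (renE r P)" and fG="\<lambda>(s, r) P. substG s (renG r P)"
     and gP="\<lambda>(s, r). substP (\<lambda>i. s (r i))" and gE="\<lambda>(s, r). substE (\<lambda>i. s (r i))" and gG="\<lambda>(s, r). substG (\<lambda>i. s (r i))"
     and a="(s, r)", simplified]
  show "substP s (renP r P) = substP (\<lambda>i. s (r i)) P" by (rule co(1)) (auto split: sum.splits)
  show "substE s (renE r E) = substE (\<lambda>i. s (r i)) E" by (rule co(2)) (auto split: sum.splits)
qed

definition comp_subst :: "msubst \<Rightarrow> msubst \<Rightarrow> msubst" where
  "comp_subst s t i = (case t i of Inl y \<Rightarrow> s y | Inr P \<Rightarrow> Inr (substP s P))"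

definition ren_subst :: "(nat \<Rightarrow> nat) \<Rightarrow> msubst \<Rightarrow> msubst" where
  "ren_subst r t i = (case t i of Inl y \<Rightarrow> Inl (r y) | Inr P \<Rightarrow> Inr (renP r P))"

lemma ren_ren: "renP r (renP q P) = renP (\<lambda>i. r (q i)) P"
  by (simp add: ren_eq_subst(1)[of r] ren_eq_subst(1)[of "\<lambda>i. r (q i)"] subst_ren)

lemma ren_subst:
  "renP r (substP t P) = substP (ren_subst r t) P" "renE r (substE t E) = substE (ren_subst r t) E"
proof -
  have [simp]: "ren_subst (up_ren k r) (up_subst k s) = up_subst k (ren_subst r s)" for k s r
    by (auto simp: up_subst_def up_ren_def ren_subst_def fun_eq_iff ren_ren split: sum.splits)
  note co = meta_fun_coinduct[where u="\<lambda>k (s, r). (up_subst k s, up_ren k r)" and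
     fP="\<lambda>(s, r) P. renP r (substP s P)" and fE="\<lambda>(s, r) P. renE r (substE s P)" and fG="\<lambda>(s, r) P. renG r (substG s P)"
     and gP="\<lambda>(s, r). substP (ren_subst r s)" and gE="\<lambda>(s, r). substE (ren_subst r s)" and gG="\<lambda>(s, r). substG (ren_subst r s)"
     and a="(t, r)", simplified]
  show "renP r (substP t P) = substP (ren_subst r t) P" by (rule co(1)) (auto simp: ren_subst_def split: sum.splits)
  show "renE r (substE t E) = substE (ren_subst r t) E" by (rule co(2)) (auto simp: ren_subst_def split: sum.splits)
qed

text \<open>Lifting shifts the procedures that \<open>t\<close> inserts. Substituting into a shifted
  procedure is \<open>subst_ren\<close>, shifting a substituted one is \<open>ren_subst\<close>; so
  both mixed laws come before composition.\<close>

lemma comp_subst_up: "comp_subst (up_subst k s) (up_subst k t) = up_subst k (comp_subst s t)"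
  by (auto simp: up_subst_def comp_subst_def fun_eq_iff subst_ren ren_subst ren_subst_def split: sum.splits intro!: arg_cong[where f="\<lambda>s. substP s _"])

lemma subst_subst:
  "substP s (substP t P) = substP (comp_subst s t) P" "substE s (substE t E) = substE (comp_subst s t) E"
proof -
  note co = meta_fun_coinduct[where u="\<lambda>k (s, r). (up_subst k s, up_subst k r)" and
     fP="\<lambda>(s, r) P. substP s (substP r P)" and fE="\<lambda>(s, r) P. substE s (substE r P)" and fG="\<lambda>(s, r) P. substG s (substG r P)"
     and gP="\<lambda>(s, r). substP (comp_subst s r)" and gE="\<lambda>(s, r). substE (comp_subst s r)" and gG="\<lambda>(s, r). substG (comp_subst s r)"
     and a="(s, t)", simplified]
  show "substP s (substP t P) = substP (comp_subst s t) P"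
    by (rule co(1)) (auto simp: comp_subst_up, auto simp: comp_subst_def split: sum.splits)
  show "substE s (substE t E) = substE (comp_subst s t) E"
    by (rule co(2)) (auto simp: comp_subst_up, auto simp: comp_subst_def split: sum.splits)
qed

lemma up_subst_Inl [simp]: "up_subst k Inl = Inl"
  by (auto simp: up_subst_def)

lemma subst_Inl [simp]: "substP Inl P = P" "substE Inl E = E"
proof -
  note co = meta_fun_coinduct[where u="\<lambda>_ _. ()" and a="()" and
     fP="\<lambda>_. substP Inl" and fE="\<lambda>_. substE Inl" and fG="\<lambda>_. substG Inl"
     and gP="\<lambda>_ P. P" and gE="\<lambda>_ P. P" and gG="\<lambda>_ P. P"]
  show "substP Inl P = P" by (rule co(1)) auto
  show "substE Inl E = E" by (rule co(2)) auto
qed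

section \<open>Head reduction\<close>

text \<open>The rule reducing below \<open>MExp\<close> never contributes: a reducible expression is
  a \<open>MCase\<close>, and the side condition reserves just that scrutinee for reassociation.
  Hence every step acts on the outermost case, in one of four ways.\<close>

lemma hredE_iff:
  "hredE E E' \<longleftrightarrow>
    (\<exists>\<sigma>s B Qs F. E = MCase (MApp (MLam \<sigma>s B) Qs) F \<and> length Qs = length \<sigma>s \<and>
       E' = MCase (MExp (substE (inst Qs) B)) F) \<or>
    (\<exists>F. E = MCase (MExp MBot) F \<and> E' = MBot) \<or>
    (\<exists>n F. E = MCase (MExp (MNum n)) F \<and> E' = F n) \<or>
    (\<exists>G E0 F. E = MCase (MExp (MCase G E0)) F \<and> E' = MCase G (\<lambda>i. MCase (MExp (E0 i)) F))"
  (is "_ = ?R")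
proof
  have no: "\<not> hredE MBot X" "\<not> hredE (MNum n) X" for n X
    by (rule notI, erule hredE.cases, simp_all)+
  assume "hredE E E'"
  then show ?R
  proof cases
    case (4 G G' F)
    from 4(3) show ?thesis
    proof cases
      case (2 D D')
      then show ?thesis using 4(4) no by (cases D) auto
    qed (use 4 in auto)
  qed auto
next
  assume ?R
  then show "hredE E E'"
    by (auto intro: hredG_hredE.intros)
qed

lemma hredE_simps [simp]:
  "\<not> hredE MBot E'" "\<not> hredE (MNum n) E'" "\<not> hredE (MCase (MVar x Qs) F) E'"
  "hredE (MCase (MExp MBot) F) E' \<longleftrightarrow> E' = MBot"
  "hredE (MCase (MExp (MNum n)) F) E' \<longleftrightarrow> E' = F n"
  "hredE (MCase (MExp (MCase G E0)) F) E' \<longleftrightarrow> E' = MCase G (\<lambda>i. MCase (MExp (E0 i)) F)"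
  "hredE (MCase (MApp (MLam \<sigma>s B) Qs) F) E' \<longleftrightarrow>
     length Qs = length \<sigma>s \<and> E' = MCase (MExp (substE (inst Qs) B)) F"
  by (auto simp: hredE_iff)

lemma is_hnf_iff: "is_hnf H \<longleftrightarrow> H = MBot \<or> (\<exists>n. H = MNum n) \<or> (\<exists>x Qs F. H = MCase (MVar x Qs) F)"
  by (cases H rule: is_hnf.cases) auto

lemma hnf_irreducible: "is_hnf H \<Longrightarrow> \<not> hredE H E"
  by (auto simp: is_hnf_iff)

lemma hredE_det: "hredE E E1 \<Longrightarrow> hredE E E2 \<Longrightarrow> E1 = E2"
  using hred_deterministic(2) by blast

abbreviation hreds where "hreds \<equiv> hredE\<^sup>*\<^sup>*"

text \<open>Reduction is deterministic, so every reduct of \<open>E\<close> lies on the one path to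
  \<open>H\<close>, with an exact count of the steps left. Step counts in this form are the
  induction measure of the later arguments about convergence.\<close>

lemma relpow_hnf:
  assumes "(hredE ^^ k) E H" "is_hnf H" "(hredE ^^ j) E E1"
  shows "j \<le> k \<and> (hredE ^^ (k - j)) E1 H"
  using assms
proof (induction j arbitrary: k E)
  case (Suc j)
  from Suc.prems(3) obtain E2 where E2: "hredE E E2" "(hredE ^^ j) E2 E1"
    by (meson relpowp_Suc_D2)
  with Suc.prems(1,2) hnf_irreducible obtain k' where k: "k = Suc k'"
    by (cases k) auto
  with Suc.prems(1) obtain E3 where E3: "hredE E E3" "(hredE ^^ k') E3 H"
    by (meson relpowp_Suc_D2)
  with E2 Suc.IH[of k' E2] Suc.prems(2) k hredE_det show ?case by (metis Suc_le_mono diff_Suc_Suc)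
qed auto

lemma relpowp_imp_rtranclp: "(hredE ^^ k) E E' \<Longrightarrow> hreds E E'"
  by (auto simp: rtranclp_power)

lemma relpow_step: "hredE E E' \<Longrightarrow> (hredE ^^ k) E' E'' \<Longrightarrow> (hredE ^^ Suc k) E E''"
  by (meson relpowp_Suc_I2)

lemma relpow_add: "(hredE ^^ j) E E' \<Longrightarrow> (hredE ^^ k) E' E'' \<Longrightarrow> (hredE ^^ (j + k)) E E''"
  by (auto simp: relpowp_add)

text \<open>\<open>MBot\<close> is excluded because reaching it and diverging both yield the normal
  form \<open>Bot\<close>; \<open>conv\<close> thus says that the normal form is not
  \<open>Bot\<close>.\<close>

definition is_val :: "mexp \<Rightarrow> bool" where
  "is_val H \<longleftrightarrow> (\<exists>n. H = MNum n) \<or> (\<exists>x Qs F. H = MCase (MVar x Qs) F)"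

lemma val_hnf: "is_val H \<Longrightarrow> is_hnf H"
  by (auto simp: is_val_def)

lemmas relpow_val = relpow_hnf[OF _ val_hnf]

definition conv :: "mexp \<Rightarrow> bool" where
  "conv E \<longleftrightarrow> (\<exists>H. hreds E H \<and> is_val H)"

lemma hnf_unique: "hreds E H \<Longrightarrow> is_hnf H \<Longrightarrow> hreds E H' \<Longrightarrow> is_hnf H' \<Longrightarrow> H = H'"
proof -
  assume a: "hreds E H" "is_hnf H" "hreds E H'" "is_hnf H'"
  then obtain j k where jk: "(hredE ^^ j) E H" "(hredE ^^ k) E H'" by (auto simp: rtranclp_power)
  from relpow_hnf[OF jk(1) a(2) jk(2)] relpow_hnf[OF jk(2) a(4) jk(1)] have "j = k" by auto
  with relpow_hnf[OF jk(1) a(2) jk(2)] show "H = H'" by simp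
qed

lemma hnf_eq: "hreds E H \<Longrightarrow> is_hnf H \<Longrightarrow> hnf E = H"
  unfolding hnf_def by (auto intro!: the_equality hnf_unique)

lemma hnf_not_conv: "\<not> conv E \<Longrightarrow> hnf E = MBot"
proof (cases "\<exists>H. hreds E H \<and> is_hnf H")
  case True
  moreover assume "\<not> conv E"
  ultimately have "hreds E MBot" by (auto simp: conv_def is_val_def is_hnf_iff)
  then show ?thesis by (simp add: hnf_eq)
qed (auto simp: hnf_def)

lemma nfP_simp [simp]: "nfP (MLam \<sigma>s E) = Lam \<sigma>s (nfE E)"
  by (subst nfP.code) simp

lemma nf_simps:
  "hreds E MBot \<Longrightarrow> nfE E = Bot"
  "hreds E (MNum n) \<Longrightarrow> nfE E = Num n"
  "hreds E (MCase (MVar x Qs) F) \<Longrightarrow> nfE E = Case (App x (map nfP Qs)) (\<lambda>i. nfE (F i))"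
  "\<not> conv E \<Longrightarrow> nfE E = Bot"
  by (subst nfE.code, simp add: hnf_eq hnf_not_conv, (subst nfG.code, simp)?)+

lemma nf_hnf [simp]:
  "nfE MBot = Bot" "nfE (MNum n) = Num n"
  "nfE (MCase (MVar x Qs) F) = Case (App x (map nfP Qs)) (\<lambda>i. nfE (F i))"
  by (rule nf_simps, simp)+

lemma conv_cases [consumes 1]:
  assumes "conv E"
  obtains n where "hreds E (MNum n)" | x Qs F where "hreds E (MCase (MVar x Qs) F)"
  using assms unfolding conv_def is_val_def by blast

lemma conv_val: "is_val E \<Longrightarrow> conv E"
  by (auto simp: conv_def)

lemma conv_red: "hreds E E' \<Longrightarrow> conv E \<longleftrightarrow> conv E'"
proof
  assume r: "hreds E E'" and "conv E"
  then obtain H where H: "hreds E H" "is_val H" by (auto simp: conv_def)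
  with r obtain j k where jk: "(hredE ^^ j) E E'" "(hredE ^^ k) E H" by (auto simp: rtranclp_power)
  from relpow_val[OF jk(2) H(2) jk(1)] H(2) show "conv E'"
    by (auto simp: conv_def dest: relpowp_imp_rtranclp)
qed (auto simp: conv_def intro: rtranclp_trans)

lemma nf_red: assumes "hreds E E'" shows "nfE E = nfE E'"
proof (cases "conv E'")
  case True
  then show ?thesis
    by (cases rule: conv_cases) (frule rtranclp_trans[OF assms], simp only: nf_simps)+
next
  case False
  then show ?thesis using conv_red[OF assms] by (simp add: nf_simps)
qed

lemma nf_step: "hredE E E' \<Longrightarrow> nfE E = nfE E'"
  by (rule nf_red) auto

text \<open>\<open>extends K C T\<close>: up to reassociation of nested case expressions, \<open>T\<close> is \<open>C\<close> followed by the continuation \<open>K\<close>.\<close>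

inductive extends :: "(nat \<Rightarrow> mexp) \<Rightarrow> mexp \<Rightarrow> mexp \<Rightarrow> bool" for K where
  extends_base: "extends K C (MCase (MExp C) K)"
| extends_bot: "extends K MBot MBot"
| extends_case: "(\<And>i. extends K (E i) (F i)) \<Longrightarrow> extends K (MCase G E) (MCase G F)"

lemma extends_caseD:
  assumes "extends K (MCase G E) T"
  shows "\<exists>F j. (hredE ^^ j) T (MCase G F) \<and> (\<forall>i. extends K (E i) (F i))"
  using assms
proof cases
  case extends_base
  then have "(hredE ^^ 1) T (MCase G (\<lambda>i. MCase (MExp (E i)) K))" by auto
  then show ?thesis using extends.extends_base by blast
next
  case (extends_case F)
  then have "(hredE ^^ 0) T (MCase G F)" by auto
  then show ?thesis using extends_case by blast
qed

text \<open>\<open>T\<close> may have to reassociate before it can follow \<open>C\<close>, hence a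
  number of steps. The bound \<open>m \<ge> 1\<close> makes step counts drop in
  \<open>extends_conv\<close>.\<close>

lemma extends_hred:
  assumes "extends K C T" "hredE C C'"
  shows "\<exists>T' m. m \<ge> 1 \<and> (hredE ^^ m) T T' \<and> extends K C' T'"
proof -
  from assms(2) obtain G E where C: "C = MCase G E" by (auto simp: hredE_iff)
  with assms extends_caseD obtain F j where F: "(hredE ^^ j) T (MCase G F)" "\<And>i. extends K (E i) (F i)"
    by blast
  have "\<exists>T'. hredE (MCase G F) T' \<and> extends K C' T'"
    using assms(2) F(2) unfolding C hredE_iff[of "MCase G E"]
    by (auto intro!: extends_case extends_bot F(2))
  with F(1) show ?thesis
    by (metis le_add2 relpow_add relpowp_1)
qed

lemma extends_relpow:
  assumes "extends K C T" "(hredE ^^ k) C C'"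
  shows "\<exists>T' m. m \<ge> k \<and> (hredE ^^ m) T T' \<and> extends K C' T'"
  using assms
proof (induction k arbitrary: C T)
  case (Suc k)
  then obtain C1 where C1: "hredE C C1" "(hredE ^^ k) C1 C'" by (meson relpowp_Suc_D2)
  from extends_hred[OF Suc.prems(1) C1(1)] obtain T1 m where 1: "m \<ge> 1" "(hredE ^^ m) T T1" "extends K C1 T1"
    by blast
  from Suc.IH[OF 1(3) C1(2)] obtain T' m' where "m' \<ge> k" "(hredE ^^ m') T1 T'" "extends K C' T'" by blast
  with 1 show ?case by (intro exI[of _ T'] exI[of _ "m + m'"]) (auto intro: relpow_add)
qed (auto intro!: exI[of _ "0 :: nat"])

lemma extends_num:
  assumes "extends K C T" "(hredE ^^ k) C (MNum n)"
  shows "\<exists>m > k. (hredE ^^ m) T (K n)"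
proof -
  from extends_relpow[OF assms] obtain T' m where "m \<ge> k" "(hredE ^^ m) T T'" "extends K (MNum n) T'" by blast
  moreover from this(3) have "hredE T' (K n)" by cases auto
  ultimately show ?thesis by (metis le_imp_less_Suc relpowp_Suc_I)
qed

lemma extends_case_red:
  assumes "extends K C T" "(hredE ^^ k) C (MCase G E)"
  shows "\<exists>m \<ge> k. \<exists>F. (hredE ^^ m) T (MCase G F) \<and> (\<forall>i. extends K (E i) (F i))"
proof -
  from extends_relpow[OF assms] obtain T' m where m: "m \<ge> k" "(hredE ^^ m) T T'" "extends K (MCase G E) T'" by blast
  from extends_caseD[OF this(3)] obtain F j where "(hredE ^^ j) T' (MCase G F)" "\<forall>i. extends K (E i) (F i)" by blast
  with m relpow_add[OF m(2)] show ?thesis by (meson trans_le_add1)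
qed

text \<open>\<open>T\<close> cannot produce a value before \<open>C\<close> does: a step of
  \<open>C\<close> costs at least one step of \<open>T\<close>, and if \<open>C\<close> is stuck
  without being a value, then so is \<open>T\<close> once it has been brought to the same
  scrutinee.\<close>

lemma extends_conv:
  assumes "extends K C T" "(hredE ^^ k) T H" "is_val H"
  shows "\<exists>k' \<le> k. \<exists>H'. (hredE ^^ k') C H' \<and> is_val H'"
  using assms
proof (induction k arbitrary: C T rule: less_induct)
  case (less k)
  show ?case
  proof (cases "is_val C")
    case True
    then show ?thesis by (intro exI[of _ 0]) auto
  next
    case False
    have "C \<noteq> MBot"
    proof
      assume "C = MBot"
      with less.prems(1) have "hreds T MBot" by cases auto
      with less.prems(2,3) show False
        using hnf_unique[of T H MBot] by (auto dest: relpowp_imp_rtranclp val_hnf simp: is_val_def)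
    qed
    with False obtain G E where C: "C = MCase G E" by (cases C) (auto simp: is_val_def)
    show ?thesis
    proof (cases "\<exists>C'. hredE C C'")
      case True
      then obtain C' where C': "hredE C C'" by blast
      from extends_hred[OF less.prems(1) C'] obtain T' m where m: "m \<ge> 1" "(hredE ^^ m) T T'" "extends K C' T'"
        by blast
      from relpow_val[OF less.prems(2,3) m(2)] m(1) have km: "k - m < k" "m \<le> k" "(hredE ^^ (k - m)) T' H" by auto
      from less.IH[OF km(1) m(3) km(3) less.prems(3)] obtain k' H' where "k' \<le> k - m" "(hredE ^^ k') C' H'" "is_val H'"
        by blast
      with C' m(1) km show ?thesis
        using relpow_step[OF C', of k' H'] by (intro exI[of _ "Suc k'"]) (auto simp del: relpowp.simps)
    next
      case stuck: False
      from less.prems(1) obtain F j where F: "(hredE ^^ j) T (MCase G F)"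
        unfolding C using extends_caseD by blast
      from relpow_val[OF less.prems(2,3) F] obtain k' where "(hredE ^^ k') (MCase G F) H" by blast
      moreover have "\<not> hredE (MCase G F) X" for X
        using stuck unfolding C by (auto simp: hredE_iff)
      ultimately have "is_val (MCase G F)" using less.prems(3)
        by (cases k') (auto simp del: relpowp.simps(2) dest: relpowp_Suc_D2)
      then have "is_val C" by (auto simp: C is_val_def)
      then show ?thesis using False by simp
    qed
  qed
qed

text \<open>The strict bound comes from the step that \<open>MCase (MExp C) K\<close> spends on
  inspecting \<open>C\<close>, be it to select a branch or to reassociate.\<close>

lemma extends_conv_case:
  assumes "(hredE ^^ k) (MCase (MExp C) K) H" "is_val H"
  shows "\<exists>k' < k. \<exists>H'. (hredE ^^ k') C H' \<and> is_val H'"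
proof -
  have "\<not> is_val (MCase (MExp C) K)" by (simp add: is_val_def)
  then obtain k0 where k0: "k = Suc k0" using assms by (cases k) auto
  show ?thesis
  proof (cases C)
    case MBot
    then have "hreds (MCase (MExp C) K) MBot" by auto
    with assms show ?thesis
      using hnf_unique[of "MCase (MExp C) K" H MBot] by (auto dest: relpowp_imp_rtranclp val_hnf simp: is_val_def)
  next
    case (MNum n)
    then show ?thesis using k0 by (intro exI[of _ 0]) (auto simp: is_val_def)
  next
    case C: (MCase G E)
    let ?T = "MCase G (\<lambda>i. MCase (MExp (E i)) K)"
    have "(hredE ^^ 1) (MCase (MExp C) K) ?T" by (auto simp: C)
    from relpow_val[OF assms this] k0 have "(hredE ^^ k0) ?T H" by auto
    moreover have "extends K C ?T" unfolding C by (intro extends.intros)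
    ultimately show ?thesis using extends_conv[of K C ?T k0 H] assms(2) k0 by (meson le_imp_less_Suc)
  qed
qed

section \<open>Equality of normal forms is a congruence\<close>

lemma subst_inst:
  "length Qs = k \<Longrightarrow> substE s (substE (inst Qs) B) = substE (inst (map (substP s) Qs)) (substE (up_subst k s) B)"
proof -
  assume k: "length Qs = k"
  have "comp_subst s (inst Qs) = comp_subst (inst (map (substP s) Qs)) (up_subst k s)"
  proof
    fix i
    have 1: "inst (map (substP s) Qs) (y + k) = Inl y" for y by (simp add: inst_def k)
    show "comp_subst s (inst Qs) i = comp_subst (inst (map (substP s) Qs)) (up_subst k s) i"
      by (cases "i < k") (auto simp: comp_subst_def inst_def up_subst_def k rev_map subst_ren 1[unfolded inst_def k]
          split: sum.splits)
  qed
  then show ?thesis by (simp add: subst_subst)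
qed

lemma hredE_subst: "hredE E E' \<Longrightarrow> hredE (substE s E) (substE s E')"
  by (subst (asm) hredE_iff) (auto simp: subst_inst)

lemma relpow_subst: "(hredE ^^ k) E E' \<Longrightarrow> (hredE ^^ k) (substE s E) (substE s E')"
  by (induction k arbitrary: E') (auto intro: hredE_subst)

lemma rtrancl_subst: "hreds E E' \<Longrightarrow> hreds (substE s E) (substE s E')"
  by (induction rule: rtranclp_induct) (auto intro: hredE_subst rtranclp.rtrancl_into_rtrancl)

text \<open>A substitution creates a redex only where a head variable was, and there
  \<open>E\<close> is already a value. Up to that point the two reductions proceed in
  lockstep.\<close>

lemma subst_relpow_hnf:
  assumes "(hredE ^^ k) (substE s E) H" "is_val H"
  shows "\<exists>k' \<le> k. \<exists>H'. (hredE ^^ k') E H' \<and> is_val H'"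
  using assms
proof (induction k arbitrary: E rule: less_induct)
  case (less k)
  show ?case
  proof (cases "is_val E")
    case True
    then show ?thesis by (intro exI[of _ 0]) auto
  next
    case False
    have "E \<noteq> MBot"
    proof
      assume "E = MBot"
      with less.prems show False
        using hnf_unique[of MBot H MBot] by (auto dest: relpowp_imp_rtranclp val_hnf simp: is_val_def)
    qed
    show ?thesis
    proof (cases "\<exists>E'. hredE E E'")
      case True
      then obtain E' where E': "hredE E E'" by blast
      then have "(hredE ^^ 1) (substE s E) (substE s E')" by (auto intro: hredE_subst)
      from relpow_val[OF less.prems this] have k: "1 \<le> k" "(hredE ^^ (k - 1)) (substE s E') H" by auto
      with less.IH[OF _ k(2) less.prems(2)] obtain k' H' where
        "k' \<le> k - 1" "(hredE ^^ k') E' H'" "is_val H'" by auto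
      then show ?thesis
        using relpow_step[OF E', of k' H'] k(1) by (intro exI[of _ "Suc k'"]) (auto simp del: relpowp.simps)
    next
      case stuck: False
      obtain G F where E: "E = MCase G F" using False \<open>E \<noteq> MBot\<close> by (cases E) (auto simp: is_val_def)
      have "\<not> hredE (substE s E) X \<and> \<not> is_val (substE s E)" for X
      proof (cases G)
        case (MApp P Qs)
        obtain \<sigma>s B where "P = MLam \<sigma>s B" by (cases P)
        with MApp show ?thesis using stuck by (simp add: E is_val_def)
      next
        case (MExp D)
        with stuck show ?thesis unfolding E by (cases D) auto
      qed (use False E in \<open>auto simp: is_val_def\<close>)
      with less.prems show ?thesis by (cases k) (auto simp del: relpowp.simps(2) dest: relpowp_Suc_D2)
    qed
  qed
qed

lemma conv_subst: "conv (substE s E) \<Longrightarrow> conv E"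
  unfolding conv_def by (metis subst_relpow_hnf relpowp_imp_rtranclp rtranclp_power)

text \<open>A bisimulation on meta-terms that still contain redexes: \<open>eqvE_case\<close> may
  compare any two reducts, and \<open>eqvG\<close> admits \<open>MExp\<close> and
  \<open>MApp\<close>. This suits substitution, which turns a head variable into a redex. That the
  relation is nevertheless equality of normal forms is \<open>eqvE_iff\<close>.\<close>

coinductive eqvP :: "mproc \<Rightarrow> mproc \<Rightarrow> bool" and eqvE :: "mexp \<Rightarrow> mexp \<Rightarrow> bool" and eqvG :: "mgnd \<Rightarrow> mgnd \<Rightarrow> bool" where
  "eqvE E E' \<Longrightarrow> eqvP (MLam \<sigma>s E) (MLam \<sigma>s E')"
| eqvE_unconv: "\<not> conv E \<Longrightarrow> \<not> conv E' \<Longrightarrow> eqvE E E'"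
| eqvE_num: "hreds E (MNum n) \<Longrightarrow> hreds E' (MNum n) \<Longrightarrow> eqvE E E'"
| eqvE_case: "hreds E (MCase G F) \<Longrightarrow> hreds E' (MCase G' F') \<Longrightarrow> eqvG G G' \<Longrightarrow>
    (\<And>i. eqvE (F i) (F' i)) \<Longrightarrow> eqvE E E'"
| eqvG_exp: "eqvE E E' \<Longrightarrow> eqvG (MExp E) (MExp E')"
| eqvG_var: "list_all2 eqvP Qs Qs' \<Longrightarrow> eqvG (MVar x Qs) (MVar x Qs')"
| eqvG_app: "eqvP P P' \<Longrightarrow> list_all2 eqvP Qs Qs' \<Longrightarrow> eqvG (MApp P Qs) (MApp P' Qs')"

thm eqvP_eqvE_eqvG.coinduct

inductive_cases eqvP_E: "eqvP P P'" and eqvG_E: "eqvG G G'" and eqvE_E: "eqvE E E'"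

lemma eqvP_Lam_iff [simp]: "eqvP (MLam \<sigma>s E) (MLam \<tau>s E') \<longleftrightarrow> \<sigma>s = \<tau>s \<and> eqvE E E'"
  by (auto intro: eqvP_eqvE_eqvG.intros elim: eqvP_E)

abbreviation (input) lam_step where
  "lam_step XB P P' \<equiv> \<exists>\<sigma>s E E'. P = MLam \<sigma>s E \<and> P' = MLam \<sigma>s E' \<and> XB E E'"

abbreviation (input) exp_step where
  "exp_step XB XC E E' \<equiv> (\<not> conv E \<and> \<not> conv E') \<or>
      (\<exists>n. hreds E (MNum n) \<and> hreds E' (MNum n)) \<or>
      (\<exists>G G' F F'. hreds E (MCase G F) \<and> hreds E' (MCase G' F') \<and> XC G G' \<and> (\<forall>i. XB (F i) (F' i)))"

abbreviation (input) gnd_step where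
  "gnd_step XA XB G G' \<equiv> (\<exists>E E'. G = MExp E \<and> G' = MExp E' \<and> XB E E') \<or>
      (\<exists>x Qs Qs'. G = MVar x Qs \<and> G' = MVar x Qs' \<and> list_all2 XA Qs Qs') \<or>
      (\<exists>P P' Qs Qs'. G = MApp P Qs \<and> G' = MApp P' Qs' \<and> (XA P P' \<or> eqvP P P') \<and> list_all2 XA Qs Qs')"

lemma eqv_coinduct:
  assumes P: "\<And>P P'. XA P P' \<Longrightarrow> lam_step XB P P'"
    and E: "\<And>E E'. XB E E' \<Longrightarrow> exp_step XB XC E E'"
    and G: "\<And>G G'. XC G G' \<Longrightarrow> gnd_step XA XB G G'"
  shows "XA P P' \<Longrightarrow> eqvP P P'" "XB E E' \<Longrightarrow> eqvE E E'" "XC G G' \<Longrightarrow> eqvG G G'"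
proof -
  have mono: "list_all2 (\<lambda>P P'. XA P P' \<or> eqvP P P') Qs Qs'" if "list_all2 XA Qs Qs'" for Qs Qs'
    using that by (rule list_all2_mono) simp
  have "(\<forall>P P'. XA P P' \<longrightarrow> eqvP P P') \<and> (\<forall>E E'. XB E E' \<longrightarrow> eqvE E E') \<and> (\<forall>G G'. XC G G' \<longrightarrow> eqvG G G')"
  proof (rule eqvP_eqvE_eqvG.coinduct, goal_cases)
    case (1 P P')
    then show ?case using P[of P P'] by auto
  next
    case (2 E E')
    from E[OF this] show ?case
    proof (elim disjE exE conjE)
      fix G G' F F'
      assume "hreds E (MCase G F)" "hreds E' (MCase G' F')" "XC G G'" "\<forall>i. XB (F i) (F' i)"
      then have "\<exists>D G F D' G' F'. E = D \<and> E' = D' \<and> hreds D (MCase G F) \<and> hreds D' (MCase G' F') \<and>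
        (XC G G' \<or> eqvG G G') \<and> (\<forall>i. XB (F i) (F' i) \<or> eqvE (F i) (F' i))" by blast
      then show ?thesis by simp
    qed auto
  next
    case (3 G G')
    from G[OF this] show ?case
      by (elim disjE exE conjE) (simp_all add: mono)
  qed
  then show "XA P P' \<Longrightarrow> eqvP P P'" "XB E E' \<Longrightarrow> eqvE E E'" "XC G G' \<Longrightarrow> eqvG G G'" by auto
qed

lemma eqv_sym: "eqvP P P' \<Longrightarrow> eqvP P' P" "eqvE E E' \<Longrightarrow> eqvE E' E" "eqvG G G' \<Longrightarrow> eqvG G' G"
proof -
  note co = eqv_coinduct[where XA="\<lambda>P P'. eqvP P' P" and XB="\<lambda>P P'. eqvE P' P" and XC="\<lambda>P P'. eqvG P' P"]
  have 1: "lam_step (\<lambda>E E'. eqvE E' E) P P'" if "eqvP P' P" for P P'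
    using that by (auto elim: eqvP_E)
  have 2: "exp_step (\<lambda>E E'. eqvE E' E) (\<lambda>G G'. eqvG G' G) E E'"
    if "eqvE E' E" for E E'
    using that
  proof cases
    case (eqvE_case G F G' F')
    then show ?thesis by blast
  qed auto
  have 3: "gnd_step (\<lambda>P P'. eqvP P' P) (\<lambda>E E'. eqvE E' E) G G'"
    if "eqvG G' G" for G G'
    using that by cases (auto simp: list_all2_conv_all_nth)
  show "eqvP P P' \<Longrightarrow> eqvP P' P" by (rule co(1)) (erule 1, erule 2, erule 3)
  show "eqvE E E' \<Longrightarrow> eqvE E' E" by (rule co(2)) (erule 1, erule 2, erule 3)
  show "eqvG G G' \<Longrightarrow> eqvG G' G" by (rule co(3)) (erule 1, erule 2, erule 3)
qed

definition eqvS :: "nat + mproc \<Rightarrow> nat + mproc \<Rightarrow> bool" where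
  "eqvS a b \<longleftrightarrow> (case (a, b) of (Inl x, Inl y) \<Rightarrow> x = y | (Inr P, Inr Q) \<Rightarrow> eqvP P Q | _ \<Rightarrow> False)"

lemma eqvS_simps [simp]: "eqvS (Inl x) b \<longleftrightarrow> b = Inl x" "eqvS b (Inl x) \<longleftrightarrow> b = Inl x" "eqvS (Inr P) (Inr Q) \<longleftrightarrow> eqvP P Q"
  by (auto simp: eqvS_def split: sum.splits)

text \<open>\<open>T\<close> is a class of pairs of substitutions stable under lifting. Lifting
  pointwise related substitutions needs closure under renaming, so the argument is instantiated
  twice: for pairs of identical renamings, then in general.\<close>

lemma eqv_subst_aux:
  assumes up: "\<And>s s' k. T s s' \<Longrightarrow> T (up_subst k s) (up_subst k s')"
    and T: "\<And>s s' i. T s s' \<Longrightarrow> eqvS (s i) (s' i)"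
    and s: "T s s'"
  shows "eqvP P P' \<Longrightarrow> eqvP (substP s P) (substP s' P')" "eqvE E E' \<Longrightarrow> eqvE (substE s E) (substE s' E')"
proof -
  define X1 where "X1 P P' \<longleftrightarrow> (\<exists>s s' Q Q'. T s s' \<and> eqvP Q Q' \<and> P = substP s Q \<and> P' = substP s' Q')" for P P'
  define X2 where "X2 P P' \<longleftrightarrow> (\<exists>s s' Q Q'. T s s' \<and> eqvE Q Q' \<and> P = substE s Q \<and> P' = substE s' Q')" for P P'
  define X3 where "X3 P P' \<longleftrightarrow> (\<exists>s s' Q Q'. T s s' \<and> eqvG Q Q' \<and> P = substG s Q \<and> P' = substG s' Q')" for P P'
  have list: "list_all2 X1 (map (substP s) Qs) (map (substP s') Qs')" if "T s s'" "list_all2 eqvP Qs Qs'" for s s' Qs Qs'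
  proof -
    have "X1 (substP s Q) (substP s' Q')" if "eqvP Q Q'" for Q Q'
      using that \<open>T s s'\<close> by (auto simp: X1_def)
    with that show ?thesis by (simp add: list_all2_conv_all_nth)
  qed
  note co = eqv_coinduct[where XA=X1 and XB=X2 and XC=X3]
  have 1: "lam_step X2 P P'" if X: "X1 P P'" for P P'
  proof -
    from X obtain s s' Q Q' where q: "T s s'" "eqvP Q Q'" "P = substP s Q" "P' = substP s' Q'"
      by (auto simp: X1_def)
    from q(2) show ?thesis
      by cases (use q up[OF q(1)] in \<open>auto simp: X2_def\<close>)
  qed
  have 2: "exp_step X2 X3 E E'"
    if X: "X2 E E'" for E E'
  proof -
    from X obtain s s' Q Q' where q: "T s s'" "eqvE Q Q'" "E = substE s Q" "E' = substE s' Q'"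
      by (auto simp: X2_def)
    from q(2) show ?thesis
    proof cases
      case eqvE_unconv
      then have "\<not> conv E \<and> \<not> conv E'" using conv_subst[of s Q] conv_subst[of s' Q'] q(3,4) by blast
      then show ?thesis by simp
    next
      case (eqvE_num n)
      then show ?thesis using q rtrancl_subst[of Q "MNum n" s] rtrancl_subst[of Q' "MNum n" s'] by auto
    next
      case (eqvE_case G F G' F')
      then have "hreds E (MCase (substG s G) (\<lambda>i. substE s (F i)))" "hreds E' (MCase (substG s' G') (\<lambda>i. substE s' (F' i)))"
        using q(3,4) rtrancl_subst[of Q "MCase G F" s] rtrancl_subst[of Q' "MCase G' F'" s'] by auto
      moreover have "X3 (substG s G) (substG s' G')" "\<forall>i. X2 (substE s (F i)) (substE s' (F' i))"
        using eqvE_case(3,4) q(1) unfolding X2_def X3_def by blast+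
      ultimately show ?thesis by blast
    qed
  qed
  have 3: "gnd_step X1 X2 G G'"
    if X: "X3 G G'" for G G'
  proof -
    from X obtain s s' Q Q' where q: "T s s'" "eqvG Q Q'" "G = substG s Q" "G' = substG s' Q'"
      by (auto simp: X3_def)
    from q(2) show ?thesis
    proof cases
      case (eqvG_exp E E')
      then show ?thesis using q by (auto simp: X2_def)
    next
      case (eqvG_var Qs Qs' x)
      then show ?thesis using q(3,4) list[OF q(1) eqvG_var(3)] T[OF q(1), of x] by (auto split: sum.splits)
    next
      case (eqvG_app P P' Qs Qs')
      then show ?thesis using q list[OF q(1) eqvG_app(4)] by (auto simp: X1_def)
    qed
  qed
  show "eqvP P P' \<Longrightarrow> eqvP (substP s P) (substP s' P')"
    by (rule co(1)) (erule 1, erule 2, erule 3, use s in \<open>auto simp: X1_def\<close>)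
  show "eqvE E E' \<Longrightarrow> eqvE (substE s E) (substE s' E')"
    by (rule co(2)) (erule 1, erule 2, erule 3, use s in \<open>auto simp: X2_def\<close>)
qed

lemma eqvP_ren: "eqvP P P' \<Longrightarrow> eqvP (renP r P) (renP r P')"
proof -
  have *: "\<exists>r'. up_subst k (\<lambda>i. Inl (r i)) = (\<lambda>i. Inl (r' i))" for r k
    by (rule exI[of _ "up_ren k r"]) (auto simp: up_subst_def up_ren_def)
  show "eqvP P P' \<Longrightarrow> eqvP (renP r P) (renP r P')"
    unfolding ren_eq_subst
    by (rule eqv_subst_aux(1)[of "\<lambda>s s'. s = s' \<and> (\<exists>r. s = (\<lambda>i. Inl (r i)))"]) (use * in auto)
qed

lemma eqv_subst:
  assumes "\<And>i. eqvS (s i) (s' i)"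
  shows "eqvP P P' \<Longrightarrow> eqvP (substP s P) (substP s' P')" "eqvE E E' \<Longrightarrow> eqvE (substE s E) (substE s' E')"
proof -
  have up: "\<forall>i. eqvS (up_subst k s i) (up_subst k s' i)" if "\<forall>i. eqvS (s i) (s' i)" for k s s'
  proof
    fix i
    show "eqvS (up_subst k s i) (up_subst k s' i)"
      using that[rule_format, of "i - k"] by (auto simp: up_subst_def eqvP_ren split: sum.splits)
  qed
  show "eqvP P P' \<Longrightarrow> eqvP (substP s P) (substP s' P')" "eqvE E E' \<Longrightarrow> eqvE (substE s E) (substE s' E')"
    by (rule eqv_subst_aux[of "\<lambda>s s'. \<forall>i. eqvS (s i) (s' i)"], erule up; use assms in auto)+
qed

lemma eqvE_inst:
  assumes "list_all2 eqvP Qs Qs'" "eqvE B B'"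
  shows "eqvE (substE (inst Qs) B) (substE (inst Qs') B')"
proof (rule eqv_subst(2)[OF _ assms(2)])
  fix i
  have "list_all2 eqvP (rev Qs) (rev Qs')" using assms(1) by simp
  then show "eqvS (inst Qs i) (inst Qs' i)"
    by (auto simp: inst_def list_all2_conv_all_nth)
qed

text \<open>Closure of \<^const>\<open>eqvE\<close> under the reassociations that head reduction performs.\<close>

inductive eqv_assoc :: "mexp \<Rightarrow> mexp \<Rightarrow> bool" where
  eqv_assoc_base: "eqvE T T' \<Longrightarrow> eqv_assoc T T'"
| eqv_assoc_ext: "extends F C T \<Longrightarrow> extends F' C' T' \<Longrightarrow> eqv_assoc C C' \<Longrightarrow> (\<And>i. eqv_assoc (F i) (F' i)) \<Longrightarrow> eqv_assoc T T'"

definition hnf_rel :: "mexp \<Rightarrow> mexp \<Rightarrow> bool" where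
  "hnf_rel H H' \<longleftrightarrow> (\<exists>n. H = MNum n \<and> H' = MNum n) \<or>
     (\<exists>x Qs Qs' F F'. H = MCase (MVar x Qs) F \<and> H' = MCase (MVar x Qs') F' \<and> list_all2 eqvP Qs Qs' \<and> (\<forall>i. eqv_assoc (F i) (F' i)))"

lemma eqv_assoc_sym: "eqv_assoc T T' \<Longrightarrow> eqv_assoc T' T"
  by (induction rule: eqv_assoc.induct) (auto intro: eqv_assoc.intros eqv_sym)

text \<open>If \<open>C\<close> ends in a numeral, the continuation has strictly fewer steps left
  and falls under \<open>IH\<close>. If it ends in a query, so do \<open>T\<close> and
  \<open>T'\<close>, and their branches are again related by \<open>eqv_assoc_ext\<close>.\<close>

lemma hnf_rel_extends:
  assumes IH: "\<And>j S S'. j < k \<Longrightarrow> eqv_assoc S S' \<Longrightarrow> (hredE ^^ j) S H \<Longrightarrow> is_val H \<Longrightarrow> \<exists>H'. hreds S' H' \<and> hnf_rel H H'"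
    and C: "(hredE ^^ j) C V" "hreds C' V'" "hnf_rel V V'"
    and T: "extends F C T" "extends F' C' T'" "\<And>i. eqv_assoc (F i) (F' i)"
    and H: "(hredE ^^ k) T H" "is_val H"
  shows "\<exists>H'. hreds T' H' \<and> hnf_rel H H'"
proof -
  from C(2) obtain j' where j': "(hredE ^^ j') C' V'" by (auto simp: rtranclp_power)
  consider (num) n where "V = MNum n" "V' = MNum n"
    | (query) x Qs Qs' K K' where "V = MCase (MVar x Qs) K" "V' = MCase (MVar x Qs') K'" "list_all2 eqvP Qs Qs'" "\<And>i. eqv_assoc (K i) (K' i)"
    using C(3) unfolding hnf_rel_def by blast
  then show ?thesis
  proof cases
    case num
    from extends_num[OF T(1)] C(1) num obtain m where m: "m > j" "(hredE ^^ m) T (F n)" by blast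
    from extends_num[OF T(2)] j' num obtain m' where m': "(hredE ^^ m') T' (F' n)" by blast
    from relpow_val[OF H m(2)] m(1) have "k - m < k" "(hredE ^^ (k - m)) (F n) H" by auto
    from IH[OF this(1) T(3) this(2) H(2)] m' show ?thesis by (meson relpowp_imp_rtranclp rtranclp_trans)
  next
    case query
    from extends_case_red[OF T(1)] C(1) query obtain m L where
      L: "(hredE ^^ m) T (MCase (MVar x Qs) L)" "\<And>i. extends F (K i) (L i)" by blast
    from extends_case_red[OF T(2)] j' query obtain m' L' where
      L': "(hredE ^^ m') T' (MCase (MVar x Qs') L')" "\<And>i. extends F' (K' i) (L' i)" by blast
    have "H = MCase (MVar x Qs) L"
      using hnf_unique[of T H "MCase (MVar x Qs) L"] H L(1) by (auto dest: relpowp_imp_rtranclp val_hnf)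
    moreover have "eqv_assoc (L i) (L' i)" for i
      by (rule eqv_assoc_ext[OF L(2) L'(2) query(4) T(3)])
    ultimately show ?thesis using L'(1) query(3) by (auto simp: hnf_rel_def dest: relpowp_imp_rtranclp)
  qed
qed

text \<open>Convergence transfers by induction on the number of steps and, for equal numbers, on the
  derivation of \<open>eqv_assoc\<close>. A beta step uses up one step and leaves a related pair by
  \<open>eqvE_inst\<close>; reassociated branches are what \<open>eqv_assoc_ext\<close> keeps track
  of.\<close>

lemma eqv_assoc_hnf:
  assumes "eqv_assoc T T'" "(hredE ^^ k) T H" "is_val H"
  shows "\<exists>H'. hreds T' H' \<and> hnf_rel H H'"
  using assms
proof (induction k arbitrary: T T' H rule: less_induct)
  case (less k)
  note IH = less.IH
  from less.prems show ?case
  proof (induction T T' arbitrary: H rule: eqv_assoc.induct)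
    case (eqv_assoc_ext F C T F' C' T')
    from extends_conv[OF eqv_assoc_ext.hyps(1) eqv_assoc_ext.prems] obtain k' V where V: "k' \<le> k" "(hredE ^^ k') C V" "is_val V"
      by blast
    \<comment> \<open>If \<open>C\<close> takes as many steps as \<open>T\<close>, only the inner
      induction on the derivation applies; otherwise the step count has dropped.\<close>
    have "\<exists>V'. hreds C' V' \<and> hnf_rel V V'"
      using V eqv_assoc_ext.IH(1)[of V] IH[of k' C C' V] eqv_assoc_ext.hyps(3) by (cases "k' = k") auto
    then obtain V' where V': "hreds C' V'" "hnf_rel V V'" by blast
    show ?case
      by (rule hnf_rel_extends[OF _ V(2) V' eqv_assoc_ext.hyps(1,2,4) eqv_assoc_ext.prems]) (rule IH)
  next
    case (eqv_assoc_base T T')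
    from eqv_assoc_base.hyps show ?case
    proof cases
      case eqvE_unconv
      then show ?thesis using eqv_assoc_base.prems by (auto simp: conv_def dest: relpowp_imp_rtranclp)
    next
      case (eqvE_num n)
      then have "H = MNum n" using hnf_unique[of T H "MNum n"] eqv_assoc_base.prems by (auto dest: relpowp_imp_rtranclp val_hnf)
      then show ?thesis using eqvE_num by (auto simp: hnf_rel_def)
    next
      case (eqvE_case G F G' F')
      from eqvE_case(1) obtain j where "(hredE ^^ j) T (MCase G F)" by (auto simp: rtranclp_power)
      from relpow_val[OF eqv_assoc_base.prems this] obtain l where l: "l \<le> k" "(hredE ^^ l) (MCase G F) H"
        using diff_le_self by blast
      have "\<exists>H'. hreds (MCase G' F') H' \<and> hnf_rel H H'"
        using eqvE_case(3)
      proof cases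
        case (eqvG_var Qs Qs' x)
        then have "H = MCase G F" using hnf_unique[of "MCase G F" H "MCase G F"] l(2) eqv_assoc_base.prems(2)
          by (auto dest: relpowp_imp_rtranclp val_hnf)
        then have "hnf_rel H (MCase G' F')" using eqvG_var eqvE_case(4) by (auto simp: hnf_rel_def intro: eqv_assoc.eqv_assoc_base)
        then show ?thesis by blast
      next
        case (eqvG_app P P' Qs Qs')
        from eqvG_app(3) obtain \<sigma>s B B' where B: "P = MLam \<sigma>s B" "P' = MLam \<sigma>s B'" "eqvE B B'"
          by (auto elim: eqvP_E)
        have "\<not> is_val (MCase G F)" by (simp add: eqvG_app is_val_def)
        with l(2) eqv_assoc_base.prems(2) obtain l' where l': "l = Suc l'" by (cases l) auto
        then obtain E where E: "hredE (MCase G F) E" "(hredE ^^ l') E H" using l(2) by (meson relpowp_Suc_D2)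
        then have len: "length Qs = length \<sigma>s" and E': "E = MCase (MExp (substE (inst Qs) B)) F"
          by (auto simp: eqvG_app B)
        have "eqv_assoc E (MCase (MExp (substE (inst Qs') B')) F')"
          unfolding E' using eqvE_inst[OF eqvG_app(4) B(3)] eqvE_case(4)
          by (intro eqv_assoc.eqv_assoc_ext[OF extends_base extends_base] eqv_assoc.eqv_assoc_base)
        from IH[OF _ this E(2) eqv_assoc_base.prems(2)] l l' obtain H' where
          H': "hreds (MCase (MExp (substE (inst Qs') B')) F') H'" "hnf_rel H H'" by auto
        have "length Qs' = length \<sigma>s" using len eqvG_app(4) by (auto dest: list_all2_lengthD)
        then have "hredE (MCase G' F') (MCase (MExp (substE (inst Qs') B')) F')" by (simp add: eqvG_app B)
        with H' show ?thesis by (meson converse_rtranclp_into_rtranclp)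
      next
        case (eqvG_exp D D')
        from extends_conv_case[OF l(2)[unfolded eqvG_exp] eqv_assoc_base.prems(2)] obtain k' V where
          V: "k' < l" "(hredE ^^ k') D V" "is_val V" by blast
        with IH[of k' D D' V] l(1) eqvG_exp(3) obtain V' where V': "hreds D' V'" "hnf_rel V V'"
          by (auto intro: eqv_assoc.eqv_assoc_base)
        show ?thesis unfolding eqvG_exp
        proof (rule hnf_rel_extends[OF _ V(2) V' extends_base extends_base _ l(2)[unfolded eqvG_exp] eqv_assoc_base.prems(2)])
          show "\<exists>H'. hreds S' H' \<and> hnf_rel H H'"
            if "j < l" "eqv_assoc S S'" "(hredE ^^ j) S H" "is_val H" for j S S'
            using IH[of j S S' H] that l(1) by simp
        qed (rule eqv_assoc.eqv_assoc_base, rule eqvE_case(4))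
      qed
      with eqvE_case(2) show ?thesis by (meson rtranclp_trans)
    qed
  qed
qed

lemma eqv_assoc_conv: "eqv_assoc T T' \<Longrightarrow> conv T \<longleftrightarrow> conv T'"
proof -
  have "eqv_assoc T T' \<Longrightarrow> conv T \<Longrightarrow> conv T'" for T T'
    unfolding conv_def hnf_rel_def using eqv_assoc_hnf[of T T']
    by (auto simp: rtranclp_power hnf_rel_def is_val_def) blast+
  then show "eqv_assoc T T' \<Longrightarrow> conv T \<longleftrightarrow> conv T'" using eqv_assoc_sym by blast
qed

section \<open>Agreement of the congruence with equality of normal forms\<close>

abbreviation (input) nlam_step where
  "nlam_step XB p p' \<equiv> \<exists>\<sigma>s e e'. p = Lam \<sigma>s e \<and> p' = Lam \<sigma>s e' \<and> XB e e'"

abbreviation (input) nexp_step where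
  "nexp_step XA XB e e' \<equiv> e = e' \<or> (\<exists>x qs qs' F F'. e = Case (App x qs) F \<and> e' = Case (App x qs') F' \<and>
      list_all2 XA qs qs' \<and> (\<forall>i. XB (F i) (F' i)))"

lemma nsp_coinduct:
  assumes P: "\<And>p p'. XA p p' \<Longrightarrow> nlam_step XB p p'"
    and E: "\<And>e e'. XB e e' \<Longrightarrow> nexp_step XA XB e e'"
  shows "XA p p' \<Longrightarrow> p = p'" "XB e e' \<Longrightarrow> e = e'"
proof -
  let ?R1 = "\<lambda>P P'. XA P P' \<or> P = P'" and ?R2 = "\<lambda>E E'. XB E E' \<or> E = E'"
    and ?R3 = "\<lambda>a a'. (\<exists>x qs qs'. a = App x qs \<and> a' = App x qs' \<and> list_all2 XA qs qs') \<or> a = a'"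
  have mono: "list_all2 ?R1 Qs Qs'" if "list_all2 XA Qs Qs'" for Qs Qs'
    using that by (rule list_all2_mono) simp
  have "(?R1 p p' \<longrightarrow> p = p') \<and> (?R2 e e' \<longrightarrow> e = e') \<and> (?R3 a a' \<longrightarrow> a = a')" for a a'
  proof (rule nsp_proc_nsp_exp_nsp_app.coinduct, goal_cases)
    case (1 P P')
    then show ?case using P[of P P'] by auto
  next
    case (2 E1 E')
    then show ?case using E[of E1 E'] by (auto simp: rel_fun_def)
  next
    case (3 G G')
    then show ?case by (auto simp: list_all2_refl dest!: mono)
  qed
  then show "XA p p' \<Longrightarrow> p = p'" "XB e e' \<Longrightarrow> e = e'"
    by auto
qed

lemma eqv_assoc_nf: "eqv_assoc T T' \<Longrightarrow> nfE T = nfE T'" and eqvP_nf: "eqvP P P' \<Longrightarrow> nfP P = nfP P'"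
proof -
  define X1 where "X1 p p' \<longleftrightarrow> (\<exists>P P'. eqvP P P' \<and> p = nfP P \<and> p' = nfP P')" for p p'
  define X2 where "X2 p p' \<longleftrightarrow> (\<exists>P P'. eqv_assoc P P' \<and> p = nfE P \<and> p' = nfE P')" for p p'
  note co = nsp_coinduct[where XA=X1 and XB=X2]
  have 1: "nlam_step X2 p p'" if "X1 p p'" for p p'
    using that unfolding X1_def X2_def by (auto elim!: eqvP_E) (blast intro: eqv_assoc_base)
  have 2: "nexp_step X1 X2 e e'"
    if X: "X2 e e'" for e e'
  proof -
    from X obtain T T' where T: "eqv_assoc T T'" "e = nfE T" "e' = nfE T'" by (auto simp: X2_def)
    show ?thesis
    proof (cases "conv T")
      case False
      then show ?thesis using eqv_assoc_conv[OF T(1)] T by (simp add: nf_simps)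
    next
      case True
      then obtain k H where k: "(hredE ^^ k) T H" "is_val H" by (auto simp: conv_def rtranclp_power)
      with eqv_assoc_hnf[OF T(1)] obtain H' where H': "hreds T' H'" "hnf_rel H H'" by blast
      have e: "e = nfE H" "e' = nfE H'" using T k(1) H'(1) nf_red relpowp_imp_rtranclp by blast+
      from H'(2) show ?thesis unfolding e hnf_rel_def
      proof (elim disjE exE conjE)
        fix x Qs Qs' F F'
        assume q: "H = MCase (MVar x Qs) F" "H' = MCase (MVar x Qs') F'" "list_all2 eqvP Qs Qs'" "\<forall>i. eqv_assoc (F i) (F' i)"
        then have "list_all2 X1 (map nfP Qs) (map nfP Qs')" "\<forall>i. X2 (nfE (F i)) (nfE (F' i))"
          by (auto simp: X1_def X2_def list.rel_map elim!: list_all2_mono)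
        with q show "nexp_step X1 X2 (nfE H) (nfE H')" by auto
      qed auto
    qed
  qed
  show "eqv_assoc T T' \<Longrightarrow> nfE T = nfE T'" by (rule co(2)) (erule 1, erule 2, auto simp: X2_def)
  show "eqvP P P' \<Longrightarrow> nfP P = nfP P'" by (rule co(1)) (erule 1, erule 2, auto simp: X1_def)
qed

lemma nf_cong_imp: "nfE E = nfE E' \<Longrightarrow> eqvE E E'" "nfP P = nfP P' \<Longrightarrow> eqvP P P'"
proof -
  define X1 where "X1 P P' \<longleftrightarrow> nfP P = nfP P'" for P P'
  define X2 where "X2 P P' \<longleftrightarrow> nfE P = nfE P'" for P P'
  define X3 where "X3 G G' \<longleftrightarrow> (\<exists>x Qs Qs'. G = MVar x Qs \<and> G' = MVar x Qs' \<and> list_all2 X1 Qs Qs')" for G G'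
  note co = eqv_coinduct[where XA=X1 and XB=X2 and XC=X3]
  have 1: "lam_step X2 P P'" if "X1 P P'" for P P'
    using that by (cases P; cases P') (auto simp: X1_def X2_def)
  have 2: "exp_step X2 X3 E E'"
    if X: "X2 E E'" for E E'
  proof -
    have eq: "nfE E = nfE E'" using X by (simp add: X2_def)
    have b: "nfE D = Bot \<longleftrightarrow> \<not> conv D" for D
      by (metis conv_cases nf_simps(2-4) nsp_exp.distinct(1,3))
    show ?thesis
    proof (cases "conv E")
      case False
      then show ?thesis using b[of E] b[of E'] eq by simp
    next
      case True
      then have c': "conv E'" using b[of E] b[of E'] eq by simp
      from True show ?thesis
      proof (cases rule: conv_cases)
        case (1 n)
        then have n: "nfE E' = Num n" using eq by (simp add: nf_simps)
        from c' have "hreds E' (MNum n)"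
          by (cases rule: conv_cases) (use n in \<open>auto simp: nf_simps\<close>)
        with 1 show ?thesis by blast
      next
        case (2 x Qs F)
        then have n: "nfE E' = Case (App x (map nfP Qs)) (\<lambda>i. nfE (F i))" using eq by (simp add: nf_simps)
        from c' obtain Qs' F' where r: "hreds E' (MCase (MVar x Qs') F')" "map nfP Qs' = map nfP Qs"
            "(\<lambda>i. nfE (F' i)) = (\<lambda>i. nfE (F i))"
          by (cases rule: conv_cases) (use n in \<open>auto simp: nf_simps\<close>)
        have "X3 (MVar x Qs) (MVar x Qs')"
        proof -
          have "list_all2 X1 Qs Qs'" using r(2) by (auto simp: X1_def list_all2_conv_all_nth list_eq_iff_nth_eq)
          then show ?thesis by (auto simp: X3_def)
        qed
        moreover have "\<forall>i. X2 (F i) (F' i)" using fun_cong[OF r(3)] by (simp add: X2_def)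
        ultimately show ?thesis using 2 r(1) by blast
      qed
    qed
  qed
  have 3: "gnd_step X1 X2 G G'"
    if "X3 G G'" for G G'
    using that by (auto simp: X3_def)
  show "nfE E = nfE E' \<Longrightarrow> eqvE E E'" by (rule co(2)) (erule 1, erule 2, erule 3, simp add: X2_def)
  show "nfP P = nfP P' \<Longrightarrow> eqvP P P'" by (rule co(1)) (erule 1, erule 2, erule 3, simp add: X1_def)
qed

text \<open>Equality of normal forms inherits closure under substitution from \<open>eqvE\<close>.
  From here on, parts of a meta-term may be normalised at any stage of a computation.\<close>

lemma eqvE_iff: "eqvE E E' \<longleftrightarrow> nfE E = nfE E'" and eqvP_iff: "eqvP P P' \<longleftrightarrow> nfP P = nfP P'"
  using nf_cong_imp eqv_assoc_nf eqv_assoc_base eqvP_nf by blast+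

lemma eqv_refl: "eqvP P P" "eqvE E E"
  by (auto simp: eqvP_iff eqvE_iff)

lemma eqvS_refl: "eqvS a a"
  by (cases a) (auto simp: eqv_refl)

lemma nf_emb [simp]: "nfP (embP p) = p" "nfE (embE e) = e"
proof -
  define X1 where "X1 p p' \<longleftrightarrow> p = nfP (embP p')" for p p'
  define X2 where "X2 e e' \<longleftrightarrow> e = nfE (embE e')" for e e'
  note co = nsp_coinduct[where XA=X1 and XB=X2]
  have 1: "nlam_step X2 p p'" if "X1 p p'" for p p'
    using that by (cases p') (auto simp: X1_def X2_def)
  have 2: "nexp_step X1 X2 e e'"
    if X: "X2 e e'" for e e'
  proof (cases e')
    case (Case a F)
    then show ?thesis using X by (cases a) (auto simp: X1_def X2_def list_all2_conv_all_nth)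
  qed (use X in \<open>auto simp: X2_def\<close>)
  show "nfP (embP p) = p" by (rule co(1)) (erule 1, erule 2, simp add: X1_def)
  show "nfE (embE e) = e" by (rule co(2)) (erule 1, erule 2, simp add: X2_def)
qed

section \<open>Application and substitution on procedures\<close>

definition sbE :: "msubst \<Rightarrow> nsp_exp \<Rightarrow> nsp_exp" where
  "sbE s e = nfE (substE s (embE e))"

definition sbP :: "msubst \<Rightarrow> nsp_proc \<Rightarrow> nsp_proc" where
  "sbP s p = nfP (substP s (embP p))"

lemma sbP_Lam [simp]: "sbP s (Lam \<sigma>s e) = Lam \<sigma>s (sbE (up_subst (length \<sigma>s) s) e)"
  by (simp add: sbP_def sbE_def)

lemma eqvS_nf: "nfP P = nfP Q \<Longrightarrow> eqvS (Inr P) (Inr Q)"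
  by (simp add: eqvP_iff)

lemma nf_subst_cong:
  assumes "\<And>i. eqvS (s i) (s' i)"
  shows "nfE E = nfE E' \<Longrightarrow> nfE (substE s E) = nfE (substE s' E')"
    "nfP P = nfP P' \<Longrightarrow> nfP (substP s P) = nfP (substP s' P')"
  using eqv_subst[OF assms] by (auto simp: eqvE_iff eqvP_iff)

lemma sb_nf [simp]: "sbE s (nfE E) = nfE (substE s E)" "sbP s (nfP P) = nfP (substP s P)"
  unfolding sbE_def sbP_def by (auto intro: nf_subst_cong eqvS_refl)

lemma sb_cong: "(\<And>i. eqvS (s i) (s' i)) \<Longrightarrow> sbE s e = sbE s' e" "(\<And>i. eqvS (s i) (s' i)) \<Longrightarrow> sbP s p = sbP s' p"
  unfolding sbE_def sbP_def by (auto intro: nf_subst_cong)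

lemma sb_sb: "sbE s (sbE t e) = sbE (comp_subst s t) e" "sbP s (sbP t p) = sbP (comp_subst s t) p"
  by (simp_all add: sbE_def[of t] sbP_def[of t] subst_subst) (simp_all add: sbE_def sbP_def)

lemma sb_Inl [simp]: "sbE Inl e = e" "sbP Inl p = p"
  by (simp_all add: sbE_def sbP_def)

lemma eqvS_up: "(\<And>i. eqvS (s i) (s' i)) \<Longrightarrow> eqvS (up_subst k s i) (up_subst k s' i)"
proof -
  assume s: "\<And>i. eqvS (s i) (s' i)"
  show "eqvS (up_subst k s i) (up_subst k s' i)"
    using s[of "i - k"] by (auto simp: up_subst_def eqvP_ren split: sum.splits)
qed

lemma up_up: "up_subst k (up_subst l s) = up_subst (k + l) s"
  by (auto simp: up_subst_def fun_eq_iff ren_ren add_ac split: sum.splits)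

lemma dot_Lam: "Lam (\<sigma> # \<tau>s) e \<cdot> q = Lam \<tau>s (sbE (up_subst (length \<tau>s) (inst [embP q])) e)"
  by (simp add: sbE_def)

declare dot.simps(1) [simp del]

text \<open>Application to all arguments at once, with an expression as result. It avoids chains of
  \<open>dot\<close>, whose intermediate results are again abstractions; \<open>appN_dot\<close>
  relates the two.\<close>

definition appN :: "nsp_proc \<Rightarrow> nsp_proc list \<Rightarrow> nsp_exp" where
  "appN p qs = (case p of Lam \<sigma>s e \<Rightarrow> sbE (inst (map embP qs)) e)"

lemma appN_Lam [simp]: "appN (Lam \<sigma>s e) qs = sbE (inst (map embP qs)) e"
  by (simp add: appN_def)

lemma comp_inst_up:
  "length Qs = k \<Longrightarrow> comp_subst (inst Qs) (up_subst k (inst [Q])) = inst (Q # Qs)"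
proof
  fix i
  assume k: "length Qs = k"
  then have 1: "(\<lambda>j. inst Qs (j + k)) = Inl" by (auto simp: inst_def)
  show "comp_subst (inst Qs) (up_subst k (inst [Q])) i = inst (Q # Qs) i"
    using k by (auto simp: comp_subst_def up_subst_def inst_def nth_append subst_ren 1[unfolded inst_def] split: sum.splits)
qed

lemma appN_dot:
  "length qs = length \<tau>s \<Longrightarrow> appN (Lam (\<sigma> # \<tau>s) e \<cdot> q) qs = appN (Lam (\<sigma> # \<tau>s) e) (q # qs)"
  by (simp add: dot_Lam sb_sb comp_inst_up)

lemma appN_nil [simp]: "appN (Lam [] e) [] = e"
proof -
  have "inst [] = Inl" by (auto simp: inst_def)
  then show ?thesis by simp
qed

definition ext_subst :: "nsp_proc \<Rightarrow> msubst \<Rightarrow> msubst" where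
  "ext_subst q s i = (case i of 0 \<Rightarrow> Inr (embP q) | Suc j \<Rightarrow> s j)"

lemma ext_subst_simps [simp]: "ext_subst q s 0 = Inr (embP q)" "ext_subst q s (Suc i) = s i"
  by (auto simp: ext_subst_def)

text \<open>Beta reduction as extension of an environment: instantiation composed with the lifted
  \<open>s\<close> is \<open>ext_subst q s\<close>. Denotations can thus be evaluated by collecting
  arguments in a substitution.\<close>

lemma lam_dot: "sbP s (lam \<sigma> p) \<cdot> q = sbP (ext_subst q s) p"
proof (cases p)
  case (Lam \<tau>s e)
  have "comp_subst (inst [embP q]) (up_subst 1 s) = ext_subst q s"
  proof
    fix i
    have "(\<lambda>j. inst [embP q] (Suc j)) = Inl" by (auto simp: inst_def)
    then show "comp_subst (inst [embP q]) (up_subst 1 s) i = ext_subst q s i"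
      by (cases i) (auto simp: comp_subst_def up_subst_def inst_def subst_ren split: sum.splits)
  qed
  then have "comp_subst (up_subst k (inst [embP q])) (up_subst (Suc k) s) = up_subst k (ext_subst q s)" for k
    using up_up[of k 1 s] comp_subst_up[of k "inst [embP q]" "up_subst 1 s"] by simp
  then show ?thesis by (simp add: Lam dot_Lam sb_sb)
qed

lemma lam_sb: "sbP s (lam \<sigma> p) = lam \<sigma> (sbP (up_subst 1 s) p)"
  by (cases p) (simp add: up_up)

lemma sb_dot: "sbP s (Lam (\<sigma> # \<tau>s) e \<cdot> q) = sbP s (Lam (\<sigma> # \<tau>s) e) \<cdot> sbP s q"
proof -
  let ?k = "length \<tau>s"
  have "comp_subst s (inst [embP q]) i = comp_subst (inst [substP s (embP q)]) (up_subst 1 s) i" for i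
  proof -
    have "(\<lambda>j. inst [substP s (embP q)] (Suc j)) = Inl" by (auto simp: inst_def)
    then show ?thesis
      by (cases i) (auto simp: comp_subst_def up_subst_def inst_def subst_ren split: sum.splits)
  qed
  then have 1: "comp_subst s (inst [embP q]) = comp_subst (inst [substP s (embP q)]) (up_subst 1 s)" by blast
  have "sbE (comp_subst (up_subst ?k s) (up_subst ?k (inst [embP q]))) e =
    sbE (comp_subst (up_subst ?k (inst [substP s (embP q)])) (up_subst (Suc ?k) s)) e"
    using up_up[of ?k 1 s] comp_subst_up[of ?k "inst [substP s (embP q)]" "up_subst 1 s"]
    by (simp add: comp_subst_up 1)
  also have "\<dots> = sbE (up_subst ?k (inst [substP s (embP q)])) (sbE (up_subst (Suc ?k) s) e)"
    by (simp add: sb_sb)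
  also have "\<dots> = sbE (up_subst ?k (inst [embP (sbP s q)])) (sbE (up_subst (Suc ?k) s) e)"
    by (intro sb_cong eqvS_up) (auto simp: inst_def sbP_def eqvP_iff intro: eqvS_refl)
  finally show ?thesis by (simp add: dot_Lam sb_sb)
qed

text \<open>The monadic bind of possibly infinite query trees: by \<open>bind_simps\<close>, each
  numeral leaf \<open>i\<close> of \<open>e\<close> is replaced by \<open>k i\<close>. As a
  meta-term this is a nested case, normalised by reassociation.\<close>

definition bind :: "nsp_exp \<Rightarrow> (nat \<Rightarrow> nsp_exp) \<Rightarrow> nsp_exp" where
  "bind e k = nfE (MCase (MExp (embE e)) (\<lambda>i. embE (k i)))"

lemma bind_simps [simp]:
  "bind Bot k = Bot" "bind (Num i) k = k i" "bind (Case a F) k = Case a (\<lambda>i. bind (F i) k)"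
proof -
  show "bind Bot k = Bot" "bind (Num i) k = k i"
    by (simp_all add: bind_def nf_step[of _ MBot] nf_step[of _ "embE (k i)"])
  show "bind (Case a F) k = Case a (\<lambda>i. bind (F i) k)"
  proof (cases a)
    case (App x qs)
    have "hredE (MCase (MExp (embE (Case a F))) (\<lambda>i. embE (k i)))
      (MCase (MVar x (map embP qs)) (\<lambda>i. MCase (MExp (embE (F i))) (\<lambda>i. embE (k i))))"
      by (simp add: App)
    then show ?thesis by (simp add: bind_def nf_step App comp_def)
  qed
qed

lemma nf_MCase: "nfE (MCase (MExp E) K) = bind (nfE E) (\<lambda>i. nfE (K i))"
  unfolding bind_def eqvE_iff[symmetric]
  by (rule eqvE_case[OF rtranclp.rtrancl_refl rtranclp.rtrancl_refl])
    (auto intro!: eqvG_exp simp: eqvE_iff)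

lemma bind_Num [simp]: "bind e Num = e"
proof (rule nsp_coinduct(2)[of "(=)" "\<lambda>e' e. e' = bind e Num \<or> e' = e"])
  fix e' e assume "e' = bind e Num \<or> e' = e"
  then show "e' = e \<or> (\<exists>x qs qs' F F'. e' = Case (App x qs) F \<and> e = Case (App x qs') F' \<and>
    list_all2 (=) qs qs' \<and> (\<forall>i. F i = bind (F' i) Num \<or> F i = F' i))"
    by (cases e; cases "un_Case1 e") (auto simp: list.rel_eq)
next
  show "\<exists>\<sigma>s e e'. p = Lam \<sigma>s e \<and> p' = Lam \<sigma>s e' \<and> (e = bind e' Num \<or> e = e')" if "p = p'" for p p'
    using that by (cases p) auto
qed simp

lemma nf_call:
  assumes "length Qs = length \<sigma>s"
  shows "nfE (MCase (MApp (embP (Lam \<sigma>s e)) Qs) K) = bind (appN (Lam \<sigma>s e) (map nfP Qs)) (\<lambda>i. nfE (K i))"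
proof -
  have "nfE (MCase (MApp (embP (Lam \<sigma>s e)) Qs) K) = nfE (MCase (MExp (substE (inst Qs) (embE e))) K)"
    using assms by (intro nf_step) simp
  also have "\<dots> = bind (nfE (substE (inst Qs) (embE e))) (\<lambda>i. nfE (K i))"
    by (rule nf_MCase)
  also have "nfE (substE (inst Qs) (embE e)) = nfE (substE (inst (map embP (map nfP Qs))) (embE e))"
    by (rule nf_subst_cong(1)[OF _ refl]) (auto simp: inst_def rev_map[symmetric] rev_nth eqvP_iff simp del: rev_map)
  finally show ?thesis by (simp add: sbE_def)
qed

section \<open>Eta expansions\<close>

lemma length_etas [simp]: "length (etas k \<sigma>s) = length \<sigma>s"
  by (induction \<sigma>s) (auto simp: etas.simps)

lemma nth_etas: "i < length \<sigma>s \<Longrightarrow> etas k \<sigma>s ! i = eta (\<sigma>s ! i) (k + length \<sigma>s - 1 - i)"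
proof (induction \<sigma>s arbitrary: i)
  case (Cons \<sigma> \<sigma>s)
  then show ?case by (cases i) (auto simp: etas.simps)
qed simp

lemma ren_emb_eta: "renP f (embP (eta \<sigma> x)) = embP (eta \<sigma> (f x))"
proof (induction \<sigma> arbitrary: f x rule: measure_induct_rule[of size])
  case (less \<sigma>)
  have sz: "size (args \<sigma> ! i) < size \<sigma>" if "i < length (args \<sigma>)" for i
    using that
  proof (induction \<sigma> arbitrary: i)
    case (Fun \<sigma> \<tau>)
    then show ?case by (cases i) (simp_all add: less_SucI trans_less_add2)
  qed simp
  let ?k = "length (args \<sigma>)"
  have "map (renP (up_ren ?k f) \<circ> embP) (etas 0 (args \<sigma>)) = map embP (etas 0 (args \<sigma>))"
    by (rule nth_equalityI) (auto simp: nth_etas less[OF sz] up_ren_def)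
  then show ?case
    by (subst (1 2) eta.simps) (simp add: up_ren_def)
qed

lemma subst_emb_eta: "substP s (embP (eta \<sigma> x)) = substP (\<lambda>_. s x) (embP (eta \<sigma> 0))"
  using ren_emb_eta[of "\<lambda>_. x" \<sigma> 0] subst_ren(1)[of s "\<lambda>_. x" "embP (eta \<sigma> 0)"] by simp

text \<open>What becomes of a variable of type \<open>\<sigma>\<close> when \<open>q\<close> is
  substituted for it, variables being read as eta expansions. Terms are raw and mostly only arities
  are tracked, so above ground type the expansion is in general not removed but carried along in the
  calculations.\<close>

definition etaN :: "ty \<Rightarrow> nsp_proc \<Rightarrow> nsp_proc" where
  "etaN \<sigma> q = sbP (\<lambda>_. Inr (embP q)) (eta \<sigma> 0)"

lemma nf_subst_eta:
  "s x = Inr Q \<Longrightarrow> nfP (substP s (embP (eta \<sigma> x))) = etaN \<sigma> (nfP Q)"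
  unfolding etaN_def sbP_def
  by (subst subst_emb_eta) (auto intro!: nf_subst_cong eqvS_nf)

lemma sb_eta: "s x = Inr (embP q) \<Longrightarrow> sbP s (eta \<sigma> x) = etaN \<sigma> q"
  by (simp add: sbP_def nf_subst_eta)

lemma sb_eta_Inl: "s x = Inl y \<Longrightarrow> sbP s (eta \<sigma> x) = eta \<sigma> y"
proof -
  assume x: "s x = Inl y"
  have "substP s (embP (eta \<sigma> x)) = substP (\<lambda>_. Inl y) (embP (eta \<sigma> 0))"
    using x by (subst subst_emb_eta) simp
  also have "\<dots> = embP (eta \<sigma> y)"
    using ren_emb_eta[of "\<lambda>_. y" \<sigma> 0] by (simp add: ren_eq_subst)
  finally show ?thesis by (simp add: sbP_def)
qed

definition etasN :: "ty list \<Rightarrow> nsp_proc list \<Rightarrow> nsp_proc list" where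
  "etasN \<sigma>s qs = map2 etaN \<sigma>s qs"

lemma length_etasN [simp]: "length \<sigma>s = length qs \<Longrightarrow> length (etasN \<sigma>s qs) = length qs"
  by (simp add: etasN_def)

lemma etasN_simps [simp]: "etasN [] [] = []" "etasN (\<sigma> # \<sigma>s) (q # qs) = etaN \<sigma> q # etasN \<sigma>s qs"
  by (simp_all add: etasN_def)

lemma sb_etas:
  assumes "length qs = length \<sigma>s" "\<And>i. i < length \<sigma>s \<Longrightarrow> s (k + length \<sigma>s - 1 - i) = Inr (embP (qs ! i))"
  shows "map (sbP s) (etas k \<sigma>s) = etasN \<sigma>s qs"
  by (rule nth_equalityI) (use assms in \<open>simp_all add: etasN_def nth_etas sb_eta\<close>)

text \<open>The part of typing that evaluation relies on: the outermost block binds exactly the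
  argument types of \<open>\<sigma>\<close>, so that beta steps with saturated argument lists
  fire.\<close>

definition has_arity :: "ty \<Rightarrow> nsp_proc \<Rightarrow> bool" where
  "has_arity \<sigma> p \<longleftrightarrow> (\<exists>e. p = Lam (args \<sigma>) e)"

definition close_subst :: "nsp_proc list \<Rightarrow> msubst \<Rightarrow> msubst" where
  "close_subst qs s i = (if i < length qs then Inr (embP (rev qs ! i)) else s (i - length qs))"

lemma comp_inst_up_subst: "length qs = k \<Longrightarrow> comp_subst (inst (map embP qs)) (up_subst k s) = close_subst qs s"
proof
  fix i
  assume k: "length qs = k"
  then have 1: "(\<lambda>j. inst (map embP qs) (j + k)) = Inl" by (auto simp: inst_def)
  then show "comp_subst (inst (map embP qs)) (up_subst k s) i = close_subst qs s i"
    using k by (auto simp: comp_subst_def up_subst_def inst_def close_subst_def subst_ren 1[unfolded inst_def]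
        rev_map split: sum.splits)
qed

lemma close_subst_simps [simp]: "close_subst [] s = s" "close_subst qs (ext_subst q s) = close_subst (q # qs) s"
  by (auto simp: close_subst_def ext_subst_def fun_eq_iff nth_append split: nat.splits)
    (rule arg_cong[where f=s], simp)

lemma inst_eq_close: "inst (map embP qs) = close_subst qs Inl"
  by (auto simp: inst_def close_subst_def rev_map)

lemma appN_sb: "length qs = length \<sigma>s \<Longrightarrow> appN (sbP s (Lam \<sigma>s e)) qs = sbE (close_subst qs s) e"
  by (simp add: sb_sb comp_inst_up_subst)

lemma sbE_simps [simp]: "sbE s Bot = Bot" "sbE s (Num n) = Num n"
  by (simp_all add: sbE_def)

lemma sbE_var: "s x = Inl y \<Longrightarrow> sbE s (Case (App x ps) F) = Case (App y (map (sbP s) ps)) (\<lambda>i. sbE s (F i))"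
  by (simp add: sbE_def sbP_def comp_def)

lemma sbE_call:
  "s x = Inr (embP q) \<Longrightarrow> has_arity \<sigma> q \<Longrightarrow> length ps = length (args \<sigma>) \<Longrightarrow>
   sbE s (Case (App x ps) F) = bind (appN q (map (sbP s) ps)) (\<lambda>i. sbE s (F i))"
proof -
  assume a: "s x = Inr (embP q)" "has_arity \<sigma> q" "length ps = length (args \<sigma>)"
  then obtain e where e: "q = Lam (args \<sigma>) e" by (auto simp: has_arity_def)
  have "sbE s (Case (App x ps) F) =
      nfE (MCase (MApp (embP (Lam (args \<sigma>) e)) (map (substP s) (map embP ps))) (\<lambda>i. substE s (embE (F i))))"
    using a by (simp add: sbE_def e)
  also have "\<dots> = bind (appN q (map (sbP s) ps)) (\<lambda>i. sbE s (F i))"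
    using a by (subst nf_call) (simp_all add: e sbE_def sbP_def comp_def)
  finally show ?thesis .
qed

lemma has_arity_sb: "has_arity \<sigma> p \<Longrightarrow> has_arity \<sigma> (sbP s p)"
  by (auto simp: has_arity_def)

lemma has_arity_eta: "has_arity \<sigma> (eta \<sigma> x)"
  by (subst eta.simps) (simp add: has_arity_def)

lemma has_arity_etaN: "has_arity \<sigma> (etaN \<sigma> q)"
  unfolding etaN_def by (intro has_arity_sb has_arity_eta)

lemma has_arity_num [simp]: "has_arity TN (num n)"
  by (simp add: has_arity_def)

lemma has_arity_dot: "has_arity (\<sigma> \<Rrightarrow> \<tau>) p \<Longrightarrow> has_arity \<tau> (p \<cdot> q)"
  by (auto simp: has_arity_def dot_Lam)

lemma appN_dot': "has_arity (\<sigma> \<Rrightarrow> \<tau>) p \<Longrightarrow> length qs = length (args \<tau>) \<Longrightarrow> appN (p \<cdot> q) qs = appN p (q # qs)"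
  unfolding has_arity_def by (auto simp: appN_dot simp del: appN_Lam)

lemma appN_etaN:
  assumes "has_arity \<sigma> q" "length ys = length (args \<sigma>)"
  shows "appN (etaN \<sigma> q) ys = appN q (etasN (args \<sigma>) ys)"
proof -
  let ?s = "close_subst ys (\<lambda>_. Inr (embP q))"
  have "?s (length (args \<sigma>)) = Inr (embP q)" using assms by (simp add: close_subst_def)
  moreover have "map (sbP ?s) (etas 0 (args \<sigma>)) = etasN (args \<sigma>) ys"
    by (rule sb_etas) (use assms in \<open>auto simp: close_subst_def rev_nth\<close>)
  ultimately show ?thesis
    unfolding etaN_def by (subst eta.simps) (use assms in \<open>simp add: appN_sb sbE_call del: sbP_Lam\<close>)
qed

lemma etaN_TN: "has_arity TN q \<Longrightarrow> etaN TN q = q"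
proof -
  assume q: "has_arity TN q"
  then obtain e where e: "q = Lam [] e" by (auto simp: has_arity_def)
  obtain e' where e': "etaN TN q = Lam [] e'" using has_arity_etaN[of TN q] by (auto simp: has_arity_def)
  from appN_etaN[OF q, of "[]"] show ?thesis unfolding e' by (simp add: e del: appN_Lam)
qed

lemma etaN_num [simp]: "etaN TN (num n) = num n"
  by (rule etaN_TN) simp

lemma appN_eta:
  assumes "length ys = length (args \<sigma>)"
  shows "appN (eta \<sigma> x) ys = Case (App x (etasN (args \<sigma>) ys)) Num"
proof -
  let ?s = "close_subst ys Inl"
  have "?s (x + length (args \<sigma>)) = Inl x" using assms by (simp add: close_subst_def)
  moreover have "map (sbP ?s) (etas 0 (args \<sigma>)) = etasN (args \<sigma>) ys"
    by (rule sb_etas) (use assms in \<open>auto simp: close_subst_def rev_nth\<close>)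
  ultimately show ?thesis
    by (subst eta.simps) (use assms in \<open>simp add: inst_eq_close sbE_var\<close>)
qed

section \<open>Constants\<close>

lemma appN_Succ: "has_arity TN n \<Longrightarrow> appN (sbP s (pcf_den Succ)) [n] = bind (appN n []) (\<lambda>i. Num (Suc i))"
  by (simp add: appN_sb sbE_call[where \<sigma>=TN] close_subst_def del: sbP_Lam)

lemma appN_Pre: "has_arity TN n \<Longrightarrow> appN (sbP s (pcf_den Pre)) [n] = bind (appN n []) (\<lambda>i. Num (i - 1))"
  by (simp add: appN_sb sbE_call[where \<sigma>=TN] close_subst_def del: sbP_Lam)
    (intro arg_cong[where f="bind _"] ext, auto split: nat.split)

lemma appN_Ifzero: "has_arity TN n \<Longrightarrow> has_arity TN x \<Longrightarrow> has_arity TN y \<Longrightarrow>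
  appN (sbP s (pcf_den Ifzero)) [n, x, y] = bind (appN n []) (\<lambda>i. if i = 0 then appN x [] else appN y [])"
  by (simp add: appN_sb sbE_call[where \<sigma>=TN] close_subst_def del: sbP_Lam)
    (intro arg_cong[where f="bind _"] ext, auto simp: sbE_call[where \<sigma>=TN] close_subst_def split: nat.split)

lemma args_funs: "args (funs \<sigma>s \<tau>) = \<sigma>s @ args \<tau>"
  by (induction \<sigma>s) auto

text \<open>The argument \<open>n\<close> is evaluated first and \<open>f\<close> sees a numeral;
  the other arguments reach \<open>f\<close> through one eta expansion each. The reducibility of the
  recursors depends on this conversion into numerals.\<close>

lemma appN_Byval:
  assumes "has_arity TN n" "has_arity (funs \<sigma>s (TN \<Rrightarrow> \<tau>)) f" "length xs = length \<sigma>s" "length ys = length (args \<tau>)"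
  shows "appN (sbP s (pcf_den (Byval \<sigma>s \<tau>))) (f # xs @ n # ys) =
    bind (appN n []) (\<lambda>i. appN f (etasN \<sigma>s xs @ num i # etasN (args \<tau>) ys))"
proof -
  let ?qs = "f # xs @ n # ys" and ?r = "length (args \<tau>)"
  let ?s = "close_subst ?qs s"
  have 1: "?s ?r = Inr (embP n)" "?s (Suc (?r + length xs)) = Inr (embP f)" using assms(3,4)
    by (auto simp: close_subst_def nth_append)
  have 2: "map (sbP ?s) (etas 0 (args \<tau>)) = etasN (args \<tau>) ys"
    by (rule sb_etas) (use assms in \<open>auto simp: close_subst_def rev_nth nth_append\<close>)
  have 3: "map (sbP ?s) (etas (Suc ?r) \<sigma>s) = etasN \<sigma>s xs"
    by (rule sb_etas) (use assms in \<open>auto simp: close_subst_def rev_nth nth_append\<close>)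
  have 4: "sbE ?s (Case (App (Suc (?r + length xs)) (etas (Suc ?r) \<sigma>s @ num i # etas 0 (args \<tau>))) Num) =
     appN f (etasN \<sigma>s xs @ num i # etasN (args \<tau>) ys)" for i
    by (subst sbE_call[where s="?s", OF 1(2) assms(2)]) (simp_all add: args_funs 2 3 del: appN_Lam)
  show ?thesis
    using assms 4
    by (simp add: appN_sb Let_def sbE_call[where s="?s", OF 1(1) assms(1)] del: sbP_Lam)
qed

lemma ren_emb_etas_up: "map (renP (up_ren (length \<sigma>s) f) \<circ> embP) (etas 0 \<sigma>s) = map embP (etas 0 \<sigma>s)"
  by (rule nth_equalityI) (auto simp: nth_etas ren_emb_eta up_ren_def)

text \<open>\<open>yproc\<close> is infinite, so the induction on types behind
  \<open>ren_emb_eta\<close> is replaced by coinduction. Renaming and index are both generalised,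
  because each unfolding lifts the one and shifts the other.\<close>

lemma ren_emb_yproc: "renP f (embP (yproc \<sigma> k)) = embP (yproc \<sigma> (f k))"
proof -
  let ?r = "length (args \<sigma>)"
  define Q where "Q k = embP (yproc \<sigma> k)" for k
  define A where "A k = MVar k (Q k # map embP (etas 0 (args \<sigma>)))" for k
  have Q: "Q k = MLam (args \<sigma>) (MCase (A (k + ?r)) MNum)" for k
    unfolding Q_def A_def by (subst yproc_unfold) (simp add: Let_def)
  define R1 where "R1 P P' \<longleftrightarrow> (\<exists>f k. P = renP f (Q k) \<and> P' = Q (f k)) \<or> P = P'" for P P'
  define R2 where "R2 E E' \<longleftrightarrow> (\<exists>f k. E = MCase (renG (up_ren ?r f) (A (k + ?r))) MNum \<and> E' = MCase (A (f k + ?r)) MNum) \<or> E = E'" for E E'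
  define R3 where "R3 G G' \<longleftrightarrow> (\<exists>f k. G = renG (up_ren ?r f) (A (k + ?r)) \<and> G' = A (f k + ?r))" for G G'
  have "R1 (renP f (Q k)) (Q (f k))" by (auto simp: R1_def)
  then have "renP f (Q k) = Q (f k)"
  proof (rule meta_coinduct(1)[of R1 R2 R3, rotated -1])
    fix P P' assume "R1 P P'"
    then show "\<exists>\<sigma>s E E'. P = MLam \<sigma>s E \<and> P' = MLam \<sigma>s E' \<and> R2 E E'"
      by (cases P) (auto simp: R1_def R2_def Q)
  next
    fix E E' assume "R2 E E'"
    then show "E = E' \<or> (\<exists>G G' F F'. E = MCase G F \<and> E' = MCase G' F' \<and> R3 G G' \<and> (\<forall>i. R2 (F i) (F' i)))"
      unfolding R2_def
    proof (elim disjE exE conjE)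
      fix f k assume E: "E = MCase (renG (up_ren ?r f) (A (k + ?r))) MNum" "E' = MCase (A (f k + ?r)) MNum"
      have "R3 (renG (up_ren ?r f) (A (k + ?r))) (A (f k + ?r))" unfolding R3_def by blast
      moreover have "R2 D D" for D by (simp add: R2_def)
      ultimately have "\<exists>G G' F F'. E = MCase G F \<and> E' = MCase G' F' \<and> R3 G G' \<and> (\<forall>i. R2 (F i) (F' i))"
        unfolding E by simp
      then show "E = E' \<or> (\<exists>G G' F F'. E = MCase G F \<and> E' = MCase G' F' \<and> R3 G G' \<and>
        (\<forall>i. (\<exists>f k. F i = MCase (renG (up_ren ?r f) (A (k + ?r))) MNum \<and> F' i = MCase (A (f k + ?r)) MNum) \<or> F i = F' i))"
        unfolding R2_def by (rule disjI2)
    qed simp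
  next
    fix G G' assume "R3 G G'"
    then obtain f k where G: "G = renG (up_ren ?r f) (A (k + ?r))" "G' = A (f k + ?r)" by (auto simp: R3_def)
    have 1: "up_ren ?r f (k + ?r) = f k + ?r" by (simp add: up_ren_def)
    have "R1 (renP (up_ren ?r f) (Q (k + ?r))) (Q (f k + ?r))" unfolding R1_def 1[symmetric] by blast
    moreover have "list_all2 R1 xs xs" for xs by (simp add: list_all2_refl R1_def)
    ultimately have "list_all2 R1 (renP (up_ren ?r f) (Q (k + ?r)) # map (renP (up_ren ?r f) \<circ> embP) (etas 0 (args \<sigma>)))
        (Q (f k + ?r) # map embP (etas 0 (args \<sigma>)))" by (simp add: ren_emb_etas_up)
    then show "(\<exists>E E'. G = MExp E \<and> G' = MExp E' \<and> R2 E E') \<or>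
      (\<exists>x Qs Qs'. G = MVar x Qs \<and> G' = MVar x Qs' \<and> list_all2 R1 Qs Qs') \<or>
      (\<exists>P P' Qs Qs'. G = MApp P Qs \<and> G' = MApp P' Qs' \<and> (R1 P P' \<or> P = P') \<and> list_all2 R1 Qs Qs')"
      unfolding G A_def by (simp add: 1 comp_def)
  qed
  then show ?thesis by (simp add: Q_def)
qed

text \<open>The infinite unfolding of \<open>yproc\<close> cut off by \<open>Bot\<close> after
  \<open>m\<close> rounds; these terms supply the approximants for tail recursion.\<close>

primrec yapx :: "nat \<Rightarrow> ty \<Rightarrow> nat \<Rightarrow> nsp_proc" where
  "yapx 0 \<sigma> k = Lam (args \<sigma>) Bot"
| "yapx (Suc m) \<sigma> k = (let r = length (args \<sigma>) in
     Lam (args \<sigma>) (Case (App (k + r) (yapx m \<sigma> (k + r) # etas 0 (args \<sigma>))) Num))"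

lemma ren_emb_yapx: "renP f (embP (yapx m \<sigma> k)) = embP (yapx m \<sigma> (f k))"
  by (induction m arbitrary: f k) (simp_all add: Let_def ren_emb_etas_up up_ren_def)

definition fixp :: "ty \<Rightarrow> nsp_proc \<Rightarrow> nsp_proc" where
  "fixp \<sigma> h = sbP (\<lambda>_. Inr (embP h)) (yproc \<sigma> 0)"

definition fixn :: "nat \<Rightarrow> ty \<Rightarrow> nsp_proc \<Rightarrow> nsp_proc" where
  "fixn m \<sigma> h = sbP (\<lambda>_. Inr (embP h)) (yapx m \<sigma> 0)"

lemma sb_yproc: "s k = Inr (embP h) \<Longrightarrow> sbP s (yproc \<sigma> k) = fixp \<sigma> h"
  using ren_emb_yproc[of "\<lambda>_. k" \<sigma> 0] subst_ren(1)[of s "\<lambda>_. k" "embP (yproc \<sigma> 0)"]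
  by (simp add: fixp_def sbP_def)

lemma sb_yapx: "s k = Inr (embP h) \<Longrightarrow> sbP s (yapx m \<sigma> k) = fixn m \<sigma> h"
  using ren_emb_yapx[of "\<lambda>_. k" m \<sigma> 0] subst_ren(1)[of s "\<lambda>_. k" "embP (yapx m \<sigma> 0)"]
  by (simp add: fixn_def sbP_def)

lemma dot_Y: "sbP s (pcf_den (Y \<sigma>)) \<cdot> h = fixp \<sigma> h"
  by (simp add: lam_dot sb_yproc)

lemma has_arity_fix: "has_arity \<sigma> (fixp \<sigma> h)" "has_arity \<sigma> (fixn m \<sigma> h)"
proof -
  have "has_arity \<sigma> (yproc \<sigma> 0)" by (subst yproc_unfold) (simp add: has_arity_def Let_def)
  moreover have "has_arity \<sigma> (yapx m \<sigma> 0)" by (cases m) (simp_all add: has_arity_def Let_def)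
  ultimately show "has_arity \<sigma> (fixp \<sigma> h)" "has_arity \<sigma> (fixn m \<sigma> h)"
    unfolding fixp_def fixn_def by (auto intro: has_arity_sb)
qed

text \<open>The inner copy \<open>w\<close> is left open, so that the infinite fixed point and its
  approximants share the calculation.\<close>

lemma appN_unfold_aux:
  assumes "has_arity (\<sigma> \<Rrightarrow> \<sigma>) h" "length ys = length (args \<sigma>)" "sbP (close_subst ys (\<lambda>_. Inr (embP h))) w = w'"
  shows "appN (sbP (\<lambda>_. Inr (embP h)) (Lam (args \<sigma>) (Case (App (length (args \<sigma>)) (w # etas 0 (args \<sigma>))) Num))) ys =
    appN h (w' # etasN (args \<sigma>) ys)"
proof -
  let ?s = "close_subst ys (\<lambda>_. Inr (embP h))"
  have 1: "?s (length (args \<sigma>)) = Inr (embP h)" using assms by (simp add: close_subst_def)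
  have "map (sbP ?s) (etas 0 (args \<sigma>)) = etasN (args \<sigma>) ys"
    by (rule sb_etas) (use assms in \<open>auto simp: close_subst_def rev_nth\<close>)
  with 1 show ?thesis
    using assms by (simp add: appN_sb sbE_call[where s="?s", OF 1 assms(1)] del: sbP_Lam)
qed

lemma appN_fixp:
  assumes "has_arity (\<sigma> \<Rrightarrow> \<sigma>) h" "length ys = length (args \<sigma>)"
  shows "appN (fixp \<sigma> h) ys = appN h (fixp \<sigma> h # etasN (args \<sigma>) ys)"
proof -
  have "yproc \<sigma> 0 = Lam (args \<sigma>) (Case (App (length (args \<sigma>)) (yproc \<sigma> (length (args \<sigma>)) # etas 0 (args \<sigma>))) Num)"
    by (subst yproc_unfold) (simp add: Let_def)
  then have "appN (fixp \<sigma> h) ys = appN (sbP (\<lambda>_. Inr (embP h)) (Lam (args \<sigma>)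
      (Case (App (length (args \<sigma>)) (yproc \<sigma> (length (args \<sigma>)) # etas 0 (args \<sigma>))) Num))) ys"
    by (simp add: fixp_def del: sbP_Lam appN_Lam)
  also have "\<dots> = appN h (fixp \<sigma> h # etasN (args \<sigma>) ys)"
    by (rule appN_unfold_aux) (use assms in \<open>simp_all add: sb_yproc close_subst_def\<close>)
  finally show ?thesis .
qed

lemma appN_fixn:
  assumes "has_arity (\<sigma> \<Rrightarrow> \<sigma>) h" "length ys = length (args \<sigma>)"
  shows "appN (fixn 0 \<sigma> h) ys = Bot"
    "appN (fixn (Suc m) \<sigma> h) ys = appN h (fixn m \<sigma> h # etasN (args \<sigma>) ys)"
proof -
  show "appN (fixn 0 \<sigma> h) ys = Bot" by (simp add: fixn_def)
  show "appN (fixn (Suc m) \<sigma> h) ys = appN h (fixn m \<sigma> h # etasN (args \<sigma>) ys)"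
    unfolding fixn_def[of "Suc m"] yapx.simps Let_def add_0
    by (rule appN_unfold_aux) (use assms in \<open>simp_all add: sb_yapx close_subst_def\<close>)
qed

section \<open>Continuity of the fixed point operator\<close>

text \<open>
  Agreement of two meta-terms in their outermost \<open>n\<close> layers. A head reduction step inspects only
  boundedly many layers, so a procedure can be replaced by a deep enough approximant.
\<close>

fun agreeP :: "nat \<Rightarrow> mproc \<Rightarrow> mproc \<Rightarrow> bool" and agreeE :: "nat \<Rightarrow> mexp \<Rightarrow> mexp \<Rightarrow> bool"
  and agreeG :: "nat \<Rightarrow> mgnd \<Rightarrow> mgnd \<Rightarrow> bool" where
  "agreeP 0 _ _ = True"
| "agreeP (Suc n) (MLam \<sigma>s E) (MLam \<tau>s E') = (\<sigma>s = \<tau>s \<and> agreeE n E E')"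
| "agreeE 0 _ _ = True"
| "agreeE (Suc n) MBot MBot = True"
| "agreeE (Suc n) (MNum i) (MNum j) = (i = j)"
| "agreeE (Suc n) (MCase G F) (MCase G' F') = (agreeG n G G' \<and> (\<forall>i. agreeE n (F i) (F' i)))"
| "agreeE (Suc n) _ _ = False"
| "agreeG 0 _ _ = True"
| "agreeG (Suc n) (MExp E) (MExp E') = agreeE n E E'"
| "agreeG (Suc n) (MVar x Qs) (MVar y Qs') = (x = y \<and> list_all2 (agreeP n) Qs Qs')"
| "agreeG (Suc n) (MApp P Qs) (MApp P' Qs') = (agreeP n P P' \<and> list_all2 (agreeP n) Qs Qs')"
| "agreeG (Suc n) _ _ = False"

lemma agree_refl [simp]: "agreeP n P P" "agreeE n E E" "agreeG n G G"
proof -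
  have "(\<forall>P. agreeP n P P) \<and> (\<forall>E. agreeE n E E) \<and> (\<forall>G. agreeG n G G)"
  proof (induction n)
    case (Suc n)
    have l: "list_all2 (agreeP n) Qs Qs" for Qs by (simp add: list_all2_refl Suc)
    have "agreeP (Suc n) P P" for P using Suc by (cases P) simp
    moreover have "agreeE (Suc n) E E" for E using Suc by (cases E) simp_all
    moreover have "agreeG (Suc n) G G" for G using Suc l by (cases G) simp_all
    ultimately show ?case by blast
  qed simp
  then show "agreeP n P P" "agreeE n E E" "agreeG n G G" by auto
qed

lemma agree_Suc: "(\<forall>P P'. agreeP (Suc n) P P' \<longrightarrow> agreeP n P P') \<and> (\<forall>E E'. agreeE (Suc n) E E' \<longrightarrow> agreeE n E E') \<and>
  (\<forall>G G'. agreeG (Suc n) G G' \<longrightarrow> agreeG n G G')"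
proof (induction n)
  case (Suc n)
  then have l: "list_all2 (agreeP (Suc n)) Qs Qs' \<Longrightarrow> list_all2 (agreeP n) Qs Qs'" for Qs Qs'
    by (simp add: list_all2_conv_all_nth)
  have "agreeP (Suc n) P P'" if "agreeP (Suc (Suc n)) P P'" for P P'
    using that Suc by (cases P; cases P') auto
  moreover have "agreeE (Suc n) E E'" if "agreeE (Suc (Suc n)) E E'" for E E'
    using that Suc by (cases E; cases E') auto
  moreover have "agreeG (Suc n) E E'" if "agreeG (Suc (Suc n)) E E'" for E E'
    using that Suc by (cases E; cases E') (auto intro: l)
  ultimately show ?case by blast
qed simp

lemma agree_mono: assumes "m \<le> n" shows "agreeP n P P' \<Longrightarrow> agreeP m P P'" "agreeE n E E' \<Longrightarrow> agreeE m E E'" "agreeG n G G' \<Longrightarrow> agreeG m G G'"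
proof -
  have "(agreeP n P P' \<longrightarrow> agreeP m P P') \<and> (agreeE n E E' \<longrightarrow> agreeE m E E') \<and> (agreeG n G G' \<longrightarrow> agreeG m G G')"
    using assms by (induction n rule: dec_induct) (use agree_Suc in blast)+
  then show "agreeP n P P' \<Longrightarrow> agreeP m P P'" "agreeE n E E' \<Longrightarrow> agreeE m E E'" "agreeG n G G' \<Longrightarrow> agreeG m G G'" by auto
qed

lemma agree_list_mono: "m \<le> n \<Longrightarrow> list_all2 (agreeP n) Qs Qs' \<Longrightarrow> list_all2 (agreeP m) Qs Qs'"
  using agree_mono(1)[of m n] by (simp add: list_all2_conv_all_nth)

definition agreeS :: "nat \<Rightarrow> nat + mproc \<Rightarrow> nat + mproc \<Rightarrow> bool" where
  "agreeS n a b \<longleftrightarrow> (case (a, b) of (Inl x, Inl y) \<Rightarrow> x = y | (Inr P, Inr Q) \<Rightarrow> agreeP n P Q | _ \<Rightarrow> False)"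

lemma agreeS_simps [simp]: "agreeS n (Inl x) b \<longleftrightarrow> b = Inl x" "agreeS n b (Inl x) \<longleftrightarrow> b = Inl x" "agreeS n (Inr P) (Inr Q) \<longleftrightarrow> agreeP n P Q"
  by (auto simp: agreeS_def split: sum.splits)

lemma agreeS_refl [simp]: "agreeS n a a"
  by (cases a) auto

lemma agreeS_mono: "m \<le> n \<Longrightarrow> agreeS n a b \<Longrightarrow> agreeS m a b"
  using agree_mono(1)[of m n] by (auto simp: agreeS_def split: sum.splits)

lemma agree_subst_aux:
  assumes up: "\<And>s s' k n. T n s s' \<Longrightarrow> T n (up_subst k s) (up_subst k s')"
    and T: "\<And>s s' i n. T n s s' \<Longrightarrow> agreeS n (s i) (s' i)"
    and down: "\<And>n s s'. T (Suc n) s s' \<Longrightarrow> T n s s'"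
  shows "(\<forall>s s' P P'. T n s s' \<longrightarrow> agreeP n P P' \<longrightarrow> agreeP n (substP s P) (substP s' P')) \<and>
    (\<forall>s s' E E'. T n s s' \<longrightarrow> agreeE n E E' \<longrightarrow> agreeE n (substE s E) (substE s' E')) \<and>
    (\<forall>s s' G G'. T n s s' \<longrightarrow> agreeG n G G' \<longrightarrow> agreeG n (substG s G) (substG s' G'))"
proof (induction n)
  case (Suc n)
  have l: "list_all2 (agreeP n) (map (substP s) Qs) (map (substP s') Qs')" if "list_all2 (agreeP n) Qs Qs'" "T (Suc n) s s'" for s s' Qs Qs'
    using that Suc down by (auto simp: list_all2_conv_all_nth)
  have "agreeP (Suc n) (substP s P) (substP s' P')" if "T (Suc n) s s'" "agreeP (Suc n) P P'" for s s' P P'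
    using that Suc up down by (cases P; cases P') auto
  moreover have "agreeE (Suc n) (substE s E) (substE s' E')" if "T (Suc n) s s'" "agreeE (Suc n) E E'" for s s' E E'
    using that Suc down by (cases E; cases E') auto
  moreover have "agreeG (Suc n) (substG s G) (substG s' G')" if t: "T (Suc n) s s'" "agreeG (Suc n) G G'" for s s' G G'
  proof (cases G)
    case (MExp E)
    with t Suc down show ?thesis by (cases G') auto
  next
    case (MApp P Qs)
    with t Suc down l show ?thesis by (cases G') auto
  next
    case (MVar x Qs)
    then obtain Qs' where "G' = MVar x Qs'" "list_all2 (agreeP n) Qs Qs'" using t by (cases G') auto
    with MVar t T[OF t(1), of x] l[of Qs Qs' s s'] show ?thesis
      by (auto split: sum.splits intro: agree_mono(1)[of n "Suc n"])
  qed
  ultimately show ?case by blast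
qed simp

lemma agree_ren: "agreeP n P P' \<Longrightarrow> agreeP n (renP r P) (renP r P')"
proof -
  have *: "\<exists>r'. up_subst k (\<lambda>i. Inl (r i)) = (\<lambda>i. Inl (r' i))" for r k
    by (rule exI[of _ "up_ren k r"]) (auto simp: up_subst_def up_ren_def)
  show "agreeP n P P' \<Longrightarrow> agreeP n (renP r P) (renP r P')"
    unfolding ren_eq_subst
  proof -
    assume eq: "agreeP n P P'"
    let ?T = "\<lambda>_ s s'. s = s' \<and> (\<exists>r. s = (\<lambda>i. Inl (r i)))"
    have "\<forall>s s' P P'. ?T n s s' \<longrightarrow> agreeP n P P' \<longrightarrow> agreeP n (substP s P) (substP s' P')"
      by (rule agree_subst_aux[of ?T n, THEN conjunct1]) (use * in auto)
    with eq show "agreeP n (substP (\<lambda>i. Inl (r i)) P) (substP (\<lambda>i. Inl (r i)) P')" by blast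
  qed
qed

lemma agree_subst:
  assumes "\<And>i. agreeS n (s i) (s' i)"
  shows "agreeP n P P' \<Longrightarrow> agreeP n (substP s P) (substP s' P')" "agreeE n E E' \<Longrightarrow> agreeE n (substE s E) (substE s' E')"
proof -
  have up: "\<forall>i. agreeS n (up_subst k s i) (up_subst k s' i)" if "\<forall>i. agreeS n (s i) (s' i)" for k s s' n
  proof
    fix i
    show "agreeS n (up_subst k s i) (up_subst k s' i)"
      using that[rule_format, of "i - k"] by (auto simp: up_subst_def agree_ren split: sum.splits)
  qed
  have "(\<forall>s s' P P'. (\<forall>i. agreeS n (s i) (s' i)) \<longrightarrow> agreeP n P P' \<longrightarrow> agreeP n (substP s P) (substP s' P')) \<and>
    (\<forall>s s' E E'. (\<forall>i. agreeS n (s i) (s' i)) \<longrightarrow> agreeE n E E' \<longrightarrow> agreeE n (substE s E) (substE s' E')) \<and>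
    (\<forall>s s' G G'. (\<forall>i. agreeS n (s i) (s' i)) \<longrightarrow> agreeG n G G' \<longrightarrow> agreeG n (substG s G) (substG s' G'))"
    by (rule agree_subst_aux) (use up agreeS_mono[OF le_SucI[OF order_refl]] in blast)+
  with assms show "agreeP n P P' \<Longrightarrow> agreeP n (substP s P) (substP s' P')" "agreeE n E E' \<Longrightarrow> agreeE n (substE s E) (substE s' E')"
    by blast+
qed

lemma agree_inst:
  assumes "list_all2 (agreeP n) Qs Qs'" "agreeE n B B'"
  shows "agreeE n (substE (inst Qs) B) (substE (inst Qs') B')"
proof (rule agree_subst(2)[OF _ assms(2)])
  fix i
  have "list_all2 (agreeP n) (rev Qs) (rev Qs')" using assms(1) by simp
  then show "agreeS n (inst Qs i) (inst Qs' i)"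
    by (auto simp: inst_def list_all2_conv_all_nth)
qed

text \<open>A redex pattern is three constructors deep (\<open>MCase\<close>, then
  \<open>MApp\<close> and \<open>MLam\<close>, or \<open>MExp\<close> and \<open>MCase\<close>), and
  substitution preserves agreement, so four layers per step suffice.\<close>

lemma agree_hred:
  assumes "agreeE (n + 4) E E'" "hredE E D"
  shows "\<exists>D'. hredE E' D' \<and> agreeE n D D'"
proof -
  have n: "n + 4 = Suc (Suc (Suc (Suc n)))" by simp
  from assms(2) consider (beta) \<sigma>s B Qs F where "E = MCase (MApp (MLam \<sigma>s B) Qs) F" "length Qs = length \<sigma>s"
       "D = MCase (MExp (substE (inst Qs) B)) F"
    | (bot) F where "E = MCase (MExp MBot) F" "D = MBot"
    | (num) m F where "E = MCase (MExp (MNum m)) F" "D = F m"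
    | (assoc) G E0 F where "E = MCase (MExp (MCase G E0)) F" "D = MCase G (\<lambda>i. MCase (MExp (E0 i)) F)"
    unfolding hredE_iff by blast
  then show ?thesis
  proof cases
    case beta
    with assms(1)[unfolded n] obtain P' Qs' F' where e: "E' = MCase (MApp P' Qs') F'" "agreeP (Suc (Suc n)) (MLam \<sigma>s B) P'"
      "list_all2 (agreeP (Suc (Suc n))) Qs Qs'" "\<And>i. agreeE (Suc (Suc (Suc n))) (F i) (F' i)"
      by (cases E'; cases "un_MCase1 E'") auto
    then obtain B' where B': "P' = MLam \<sigma>s B'" "agreeE (Suc n) B B'" by (cases P') auto
    have "agreeE n (substE (inst Qs) B) (substE (inst Qs') B')"
      by (rule agree_inst[OF agree_list_mono[OF _ e(3)] agree_mono(2)[OF _ B'(2)]]) simp_all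
    then have "agreeE (Suc (Suc n)) D (MCase (MExp (substE (inst Qs') B')) F')"
      unfolding beta(3) using agree_mono(2)[OF _ e(4)] by simp
    then have "agreeE n D (MCase (MExp (substE (inst Qs') B')) F')" by (rule agree_mono(2)[rotated]) simp
    moreover have "length Qs' = length \<sigma>s" using beta(2) e(3) by (auto dest: list_all2_lengthD)
    ultimately show ?thesis using e(1) B'(1) by auto
  next
    case bot
    with assms(1)[unfolded n] obtain D' F' where "E' = MCase (MExp D') F'" "agreeE (Suc (Suc n)) MBot D'"
      by (cases E'; cases "un_MCase1 E'") auto
    then have "E' = MCase (MExp MBot) F'" by (cases D') auto
    with bot show ?thesis by auto
  next
    case num
    with assms(1)[unfolded n] obtain D' F' where e: "E' = MCase (MExp D') F'" "agreeE (Suc (Suc n)) (MNum m) D'"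
       "\<And>i. agreeE (Suc (Suc (Suc n))) (F i) (F' i)"
      by (cases E'; cases "un_MCase1 E'") auto
    then have "E' = MCase (MExp (MNum m)) F'" by (cases D') auto
    with num agree_mono(2)[OF _ e(3), of n m] show ?thesis by auto
  next
    case assoc
    with assms(1)[unfolded n] obtain D' F' where e: "E' = MCase (MExp D') F'" "agreeE (Suc (Suc n)) (MCase G E0) D'"
       "\<And>i. agreeE (Suc (Suc (Suc n))) (F i) (F' i)"
      by (cases E'; cases "un_MCase1 E'") auto
    then obtain G' E0' where D': "D' = MCase G' E0'" "agreeG (Suc n) G G'" "\<And>i. agreeE (Suc n) (E0 i) (E0' i)" by (cases D') auto
    have "agreeE n (MCase (MExp (E0 i)) F) (MCase (MExp (E0' i)) F')" for i
    proof (rule agree_mono(2))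
      show "agreeE (Suc (Suc n)) (MCase (MExp (E0 i)) F) (MCase (MExp (E0' i)) F')"
        using agree_mono(2)[OF _ D'(3)[of i], of n] agree_mono(2)[OF _ e(3)] by simp
    qed simp
    then have "agreeE (Suc n) D (MCase G' (\<lambda>i. MCase (MExp (E0' i)) F'))"
      unfolding assoc(2) using agree_mono(3)[OF _ D'(2), of n] by simp
    then have "agreeE n D (MCase G' (\<lambda>i. MCase (MExp (E0' i)) F'))" by (rule agree_mono(2)[rotated]) simp
    then show ?thesis using e(1) D'(1) by auto
  qed
qed

text \<open>Four layers for each of the \<open>k\<close> steps, and two more to see that the result
  is a numeral or a case on a variable.\<close>

lemma agree_conv:
  assumes "agreeE (4 * k + 2) E E'" "(hredE ^^ k) E H" "is_val H"
  shows "conv E'"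
  using assms
proof (induction k arbitrary: E E')
  case 0
  then have "agreeE (Suc (Suc 0)) H E'" by (simp add: numeral_2_eq_2)
  with 0(3) have "is_val E'" unfolding is_val_def
    by (cases E'; cases "un_MCase1 E'") auto
  then show ?case by (rule conv_val)
next
  case (Suc k)
  then obtain D where D: "hredE E D" "(hredE ^^ k) D H" by (meson relpowp_Suc_D2)
  from agree_hred[of "4 * k + 2" E E' D] Suc.prems(1) D(1) obtain D' where "hredE E' D'" "agreeE (4 * k + 2) D D'"
    by (auto simp: algebra_simps)
  with Suc.IH[OF this(2) D(2) Suc.prems(3)] conv_red[of E' D'] show ?case by blast
qed

lemma agree_yapx: "agreeP m (embP (yproc \<sigma> k)) (embP (yapx m \<sigma> k))"
proof (induction m arbitrary: k)
  case (Suc m)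
  have "agreeE m (MCase (MVar (k + length (args \<sigma>)) (embP (yproc \<sigma> (k + length (args \<sigma>))) # map embP (etas 0 (args \<sigma>)))) MNum)
     (MCase (MVar (k + length (args \<sigma>)) (embP (yapx m \<sigma> (k + length (args \<sigma>))) # map embP (etas 0 (args \<sigma>)))) MNum)"
  proof (cases m)
    case (Suc l)
    show ?thesis
    proof (cases l)
      case l: (Suc j)
      have "agreeP j (embP (yproc \<sigma> (k + length (args \<sigma>)))) (embP (yapx m \<sigma> (k + length (args \<sigma>))))"
        by (rule agree_mono(1)[OF _ Suc.IH]) (simp add: Suc l)
      then show ?thesis by (simp add: Suc l list_all2_refl)
    qed (simp add: Suc)
  qed simp
  then show ?case by (subst yproc_unfold) (simp add: Let_def)
qed simp

text \<open>A convergent computation takes finitely many steps and therefore inspects only finitely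
  many layers of the infinite procedure.\<close>

lemma fixp_continuous:
  assumes "appN (fixp \<sigma> h) ys \<noteq> Bot" "length ys = length (args \<sigma>)"
  shows "\<exists>m. appN (fixn m \<sigma> h) ys \<noteq> Bot"
proof -
  define f where "f w = MCase (MApp (substP (\<lambda>_. Inr (embP h)) (embP w)) (map embP ys)) MNum" for w
  have f: "nfE (f w) = appN (sbP (\<lambda>_. Inr (embP h)) w) ys" if w: "has_arity \<sigma> w" for w
  proof -
    from w obtain e where e: "w = Lam (args \<sigma>) e" by (auto simp: has_arity_def)
    let ?w = "substP (\<lambda>_. Inr (embP h)) (embP w)"
    have "nfE (f w) = nfE (MCase (MApp (embP (nfP ?w)) (map embP ys)) MNum)"
      unfolding f_def eqvE_iff[symmetric]
      by (rule eqvE_case[OF rtranclp.rtrancl_refl rtranclp.rtrancl_refl])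
        (auto intro!: eqvG_app simp: eqvE_iff eqvP_iff list_all2_refl)
    also have "\<dots> = appN (nfP ?w) ys"
      using nf_call[of "map embP ys" "args \<sigma>" _ MNum] assms(2) by (simp add: e comp_def)
    finally show ?thesis by (simp add: sbP_def)
  qed
  have b: "nfE D = Bot \<longleftrightarrow> \<not> conv D" for D
    by (metis conv_cases nf_simps(2-4) nsp_exp.distinct(1,3))
  have ar: "has_arity \<sigma> (yproc \<sigma> 0)" "has_arity \<sigma> (yapx m \<sigma> 0)" for m
    by (subst yproc_unfold, simp add: has_arity_def Let_def) (cases m, simp_all add: has_arity_def Let_def)
  from assms(1) have "conv (f (yproc \<sigma> 0))" unfolding fixp_def f[OF ar(1), symmetric] b by blast
  then obtain k H where k: "(hredE ^^ k) (f (yproc \<sigma> 0)) H" "is_val H" by (auto simp: conv_def rtranclp_power)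
  \<comment> \<open>In \<open>f\<close> the procedure sits below \<open>MCase\<close> and
    \<open>MApp\<close>; agreement in \<open>4 * k\<close> layers of it is agreement in
    \<open>4 * k + 2\<close> layers of the whole.\<close>
  let ?m = "4 * k"
  have "agreeE (?m + 2) (f (yproc \<sigma> 0)) (f (yapx ?m \<sigma> 0))"
    using agree_subst(1)[OF agreeS_refl agree_yapx[of ?m \<sigma> 0]] by (simp add: f_def list_all2_refl numeral_2_eq_2)
  from agree_conv[OF this k] have "appN (fixn ?m \<sigma> h) ys \<noteq> Bot"
    unfolding fixn_def f[OF ar(2), symmetric] b by blast
  then show ?thesis by blast
qed

section \<open>Typing of programs\<close>

text \<open>Typing as a computable function, so that the side conditions of evaluating concrete
  programs are settled by rewriting.\<close>

fun ty_of :: "('c \<Rightarrow> ty) \<Rightarrow> ty list \<Rightarrow> 'c tm \<Rightarrow> ty option" where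
  "ty_of ct \<Gamma> (Var x) = (if x < length \<Gamma> then Some (\<Gamma> ! x) else None)"
| "ty_of ct \<Gamma> (Abs \<sigma> M) = map_option (Fun \<sigma>) (ty_of ct (\<sigma> # \<Gamma>) M)"
| "ty_of ct \<Gamma> (M $$ L) = (case ty_of ct \<Gamma> M of Some (\<sigma> \<Rrightarrow> \<tau>) \<Rightarrow>
     if ty_of ct \<Gamma> L = Some \<sigma> then Some \<tau> else None | _ \<Rightarrow> None)"
| "ty_of ct \<Gamma> (Con c) = Some (ct c)"

lemma wt_iff: "wt ct \<Gamma> M \<tau> \<longleftrightarrow> ty_of ct \<Gamma> M = Some \<tau>"
proof
  assume "wt ct \<Gamma> M \<tau>"
  then show "ty_of ct \<Gamma> M = Some \<tau>" by induction auto
next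
  assume "ty_of ct \<Gamma> M = Some \<tau>"
  then show "wt ct \<Gamma> M \<tau>"
  proof (induction M arbitrary: \<Gamma> \<tau>)
    case (Ap M L)
    then obtain \<sigma> where "ty_of ct \<Gamma> M = Some (\<sigma> \<Rrightarrow> \<tau>)" "ty_of ct \<Gamma> L = Some \<sigma>"
      by (auto split: if_splits option.splits ty.splits)
    with Ap.IH show ?case by (blast intro: wt.intros(3))
  qed (auto intro: wt.intros split: if_splits)
qed

lemma ty_of_foldr_Abs: "ty_of ct \<Gamma> (foldr Abs \<tau>s M) = map_option (funs \<tau>s) (ty_of ct (rev \<tau>s @ \<Gamma>) M)"
  by (induction \<tau>s arbitrary: \<Gamma>) (auto simp: option.map_comp comp_def option.map_id[unfolded id_def] id_def)

lemma ty_of_foldl_Ap: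
  "ty_of ct \<Gamma> M = Some (funs \<tau>s \<tau>) \<Longrightarrow> list_all2 (\<lambda>L \<tau>. ty_of ct \<Gamma> L = Some \<tau>) Ls \<tau>s \<Longrightarrow>
   ty_of ct \<Gamma> (foldl Ap M Ls) = Some \<tau>"
  by (induction Ls arbitrary: M \<tau>s) (auto simp: list_all2_Cons1)

lemma funs_args [simp]: "funs (args \<sigma>) TN = \<sigma>"
  by (induction \<sigma>) auto

lemma ty_of_zs:
  "list_all2 (\<lambda>L \<tau>. ty_of ct (rev \<tau>s @ \<Gamma>) L = Some \<tau>) (map Var (rev [0..<length \<tau>s])) \<tau>s"
  by (auto simp: list_all2_conv_all_nth rev_nth nth_append)

definition ifz :: "ty \<Rightarrow> pcf tm" where
  "ifz \<sigma> = ifzero_at \<sigma>"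

lemma ty_of_ifz [simp]: "ty_of pcf_ty \<Gamma> (ifz \<sigma>) = Some (TN \<Rrightarrow> \<sigma> \<Rrightarrow> \<sigma> \<Rrightarrow> \<sigma>)"
proof -
  let ?\<tau>s = "args \<sigma>" let ?zs = "map Var (rev [0..<length ?\<tau>s])"
  let ?\<Gamma> = "rev ?\<tau>s @ \<sigma> # \<sigma> # TN # \<Gamma>"
  have "ty_of pcf_ty ?\<Gamma> (foldl Ap (Var (length ?\<tau>s + 1)) ?zs) = Some TN" 
    "ty_of pcf_ty ?\<Gamma> (foldl Ap (Var (length ?\<tau>s)) ?zs) = Some TN"
    by (rule ty_of_foldl_Ap[OF _ ty_of_zs], simp add: nth_append)+
  then show ?thesis by (simp add: ifz_def Let_def ty_of_foldr_Abs nth_append)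
qed

lemma prog_ifz:
  "prog (Rec \<sigma>) =
    byval_plus \<sigma> $$ (Con (Y (rec_ty \<sigma>)) $$
      Abs (rec_ty \<sigma>) (Abs \<sigma> (Abs (\<sigma> \<Rrightarrow> TN \<Rrightarrow> \<sigma>) (Abs TN
        (ifz \<sigma> $$ Var 0 $$ Var 2 $$
          (Con (Byval [] \<sigma>) $$
            Abs TN (Var 2 $$ (byval_plus \<sigma> $$ Var 4 $$ Var 3 $$ Var 2 $$ Var 0) $$ Var 0) $$
            (Con Pre $$ Var 0)))))))"
  "prog (While \<sigma>) =
    Abs (\<sigma> \<Rrightarrow> TN) (Abs \<sigma> (Abs (\<sigma> \<Rrightarrow> \<sigma>)
      (Con (Y (\<sigma> \<Rrightarrow> \<sigma>)) $$
        Abs (\<sigma> \<Rrightarrow> \<sigma>) (Abs \<sigma>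
          (ifz \<sigma> $$ (Var 4 $$ Var 0) $$ (Var 1 $$ (Var 2 $$ Var 0)) $$ Var 0)) $$
        Var 1)))"
  by (simp_all add: ifz_def)

lemma ty_of_prog: "ty_of pcf_ty \<Gamma> (prog c) = Some (const_ty c)"
  by (cases c) (simp_all add: prog_ifz del: prog.simps(2,4))

lemma ty_of_translate: "ty_of const_ty \<Gamma> M = Some \<tau> \<Longrightarrow> ty_of pcf_ty \<Gamma> (translate M) = Some \<tau>"
  by (induction M arbitrary: \<Gamma> \<tau>) (auto simp: ty_of_prog split: if_splits option.splits ty.splits)

lemma has_arity_pcf_den: "has_arity (pcf_ty c) (pcf_den c)"
proof (cases c)
  case (Y \<sigma>)
  have "yproc \<sigma> 0 = Lam (args \<sigma>) (yexp \<sigma> (length (args \<sigma>)))" by (subst yproc.code) simp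
  with Y show ?thesis by (simp add: has_arity_def)
qed (auto simp: has_arity_def args_funs Let_def)

lemma has_arity_lam: "has_arity \<tau> p \<Longrightarrow> has_arity (\<sigma> \<Rrightarrow> \<tau>) (lam \<sigma> p)"
  by (auto simp: has_arity_def)

lemma has_arity_den: "ty_of pcf_ty \<Gamma> M = Some \<tau> \<Longrightarrow> has_arity \<tau> (den \<Gamma> M)"
  by (induction M arbitrary: \<Gamma> \<tau>)
    (auto intro: has_arity_eta has_arity_lam has_arity_dot has_arity_pcf_den split: if_splits option.splits ty.splits)

text \<open>Denotation in an environment: application and abstraction turn into \<open>dot\<close>
  and \<open>ext_subst\<close>, as in a semantics with valuations.\<close>

definition ev :: "msubst \<Rightarrow> ty list \<Rightarrow> pcf tm \<Rightarrow> nsp_proc" where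
  "ev s \<Gamma> M = sbP s (den \<Gamma> M)"

lemma has_arity_ev: "ty_of pcf_ty \<Gamma> M = Some \<tau> \<Longrightarrow> has_arity \<tau> (ev s \<Gamma> M)"
  unfolding ev_def by (intro has_arity_sb has_arity_den)

lemma ev_Ap:
  "ty_of pcf_ty \<Gamma> M = Some (\<sigma> \<Rrightarrow> \<tau>) \<Longrightarrow> ev s \<Gamma> (M $$ L) = ev s \<Gamma> M \<cdot> ev s \<Gamma> L"
  using has_arity_den[of \<Gamma> M] unfolding has_arity_def ev_def by (auto simp: sb_dot simp del: sbP_Lam)

lemma appN_ev_Ap:
  "ty_of pcf_ty \<Gamma> M = Some (\<sigma> \<Rrightarrow> \<tau>) \<Longrightarrow> length qs = length (args \<tau>) \<Longrightarrow>
   appN (ev s \<Gamma> (M $$ L)) qs = appN (ev s \<Gamma> M) (ev s \<Gamma> L # qs)"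
  by (simp add: ev_Ap appN_dot'[OF has_arity_ev])

lemma ev_Abs_dot: "ev s \<Gamma> (Abs \<sigma> M) \<cdot> q = ev (ext_subst q s) (\<sigma> # \<Gamma>) M"
  by (simp add: ev_def lam_dot)

lemma appN_ev_Abs:
  "ty_of pcf_ty (\<sigma> # \<Gamma>) M = Some \<tau> \<Longrightarrow> length qs = length (args \<tau>) \<Longrightarrow>
   appN (ev s \<Gamma> (Abs \<sigma> M)) (q # qs) = appN (ev (ext_subst q s) (\<sigma> # \<Gamma>) M) qs"
  by (subst appN_dot'[symmetric, OF has_arity_ev]) (auto simp: ev_Abs_dot)

lemma ev_Var: "s x = Inr (embP q) \<Longrightarrow> ev s \<Gamma> (Var x) = etaN (\<Gamma> ! x) q"
  by (simp add: ev_def sb_eta)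

lemma appN_ev_Var:
  "s x = Inr (embP q) \<Longrightarrow> has_arity (\<Gamma> ! x) q \<Longrightarrow> length qs = length (args (\<Gamma> ! x)) \<Longrightarrow>
   appN (ev s \<Gamma> (Var x)) qs = appN q (etasN (args (\<Gamma> ! x)) qs)"
  by (simp add: ev_Var appN_etaN)

lemma appN_ev_foldr_Abs:
  "ty_of pcf_ty (rev \<tau>s @ \<Gamma>) M = Some \<tau> \<Longrightarrow> length qs = length \<tau>s \<Longrightarrow> length ps = length (args \<tau>) \<Longrightarrow>
   appN (ev s \<Gamma> (foldr Abs \<tau>s M)) (qs @ ps) = appN (ev (close_subst qs s) (rev \<tau>s @ \<Gamma>) M) ps"
proof (induction \<tau>s arbitrary: \<Gamma> qs s)
  case (Cons \<sigma> \<tau>s)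
  then obtain q qs' where q: "qs = q # qs'" by (cases qs) auto
  have "ty_of pcf_ty (\<sigma> # \<Gamma>) (foldr Abs \<tau>s M) = Some (funs \<tau>s \<tau>)"
    using Cons.prems(1) by (simp add: ty_of_foldr_Abs)
  then show ?case
    using Cons.IH[of "\<sigma> # \<Gamma>" qs' "ext_subst q s"] Cons.prems
    by (simp add: q appN_ev_Abs args_funs del: appN_Lam)
qed simp

lemma appN_ev_foldl_Ap:
  "ty_of pcf_ty \<Gamma> M = Some (funs \<tau>s \<tau>) \<Longrightarrow> list_all2 (\<lambda>L \<tau>. ty_of pcf_ty \<Gamma> L = Some \<tau>) Ls \<tau>s \<Longrightarrow> length ps = length (args \<tau>) \<Longrightarrow>
   appN (ev s \<Gamma> (foldl Ap M Ls)) ps = appN (ev s \<Gamma> M) (map (ev s \<Gamma>) Ls @ ps)"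
proof (induction Ls arbitrary: M \<tau>s)
  case (Cons L Ls)
  then obtain \<sigma> \<tau>s' where t: "\<tau>s = \<sigma> # \<tau>s'" "ty_of pcf_ty \<Gamma> L = Some \<sigma>" "list_all2 (\<lambda>L \<tau>. ty_of pcf_ty \<Gamma> L = Some \<tau>) Ls \<tau>s'"
    by (auto simp: list_all2_Cons1)
  with Cons.prems have "ty_of pcf_ty \<Gamma> (M $$ L) = Some (funs \<tau>s' \<tau>)" by simp
  with Cons t show ?case by (simp add: appN_ev_Ap args_funs list_all2_lengthD)
qed simp

text \<open>Each of the \<open>zs\<close> is expanded twice: once as the denotation of its variable,
  once when the eta expansion of \<open>x\<close> or \<open>y\<close> is applied to it.\<close>

lemma appN_ev_ifz:
  assumes "has_arity TN n" "has_arity \<sigma> x" "has_arity \<sigma> y" "length zs = length (args \<sigma>)"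
  shows "appN (ev s \<Gamma> (ifz \<sigma>)) (n # x # y # zs) =
    bind (appN n []) (\<lambda>i. appN (if i = 0 then x else y) (etasN (args \<sigma>) (etasN (args \<sigma>) zs)))"
proof -
  let ?\<tau>s = "args \<sigma>" let ?r = "length ?\<tau>s" let ?zs = "map Var (rev [0..<?r]) :: pcf tm list"
  let ?\<Gamma> = "rev ?\<tau>s @ \<sigma> # \<sigma> # TN # \<Gamma>"
  let ?s = "close_subst (n # x # y # zs) s"
  let ?X = "foldl Ap (Var (?r + 1)) ?zs" and ?Y = "foldl Ap (Var ?r) ?zs"
  have ty: "ty_of pcf_ty ?\<Gamma> ?X = Some TN" "ty_of pcf_ty ?\<Gamma> ?Y = Some TN"
    by (rule ty_of_foldl_Ap[OF _ ty_of_zs], simp add: nth_append)+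
  have s: "?s (?r + 2) = Inr (embP n)" "?s (?r + 1) = Inr (embP x)" "?s ?r = Inr (embP y)"
    using assms(4) by (auto simp: close_subst_def nth_append)
  have g: "?\<Gamma> ! (?r + 2) = TN" "?\<Gamma> ! (?r + 1) = \<sigma>" "?\<Gamma> ! ?r = \<sigma>"
    by (auto simp: nth_append)
  have zs: "map (ev ?s ?\<Gamma>) ?zs = etasN ?\<tau>s zs"
  proof (rule nth_equalityI)
    fix i assume "i < length (map (ev ?s ?\<Gamma>) ?zs)"
    then have i: "i < ?r" by simp
    then have "?s (?r - Suc i) = Inr (embP (zs ! i))" "?\<Gamma> ! (?r - Suc i) = ?\<tau>s ! i"
      using assms(4) by (auto simp: close_subst_def rev_nth nth_append)
    then show "map (ev ?s ?\<Gamma>) ?zs ! i = etasN ?\<tau>s zs ! i"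
      using i assms(4) by (simp add: rev_nth ev_Var etasN_def)
  qed (use assms(4) in simp)
  have X: "appN (ev ?s ?\<Gamma> ?X) [] = appN x (etasN ?\<tau>s (etasN ?\<tau>s zs))"
    by (subst appN_ev_foldl_Ap[where \<tau>=TN, OF _ ty_of_zs]) (use s(2) g(2) assms zs in \<open>simp_all add: nth_append appN_ev_Var\<close>)
  have Y: "appN (ev ?s ?\<Gamma> ?Y) [] = appN y (etasN ?\<tau>s (etasN ?\<tau>s zs))"
    by (subst appN_ev_foldl_Ap[where \<tau>=TN, OF _ ty_of_zs]) (use s(3) g(3) assms zs in \<open>simp_all add: nth_append appN_ev_Var\<close>)
  have n: "ev ?s ?\<Gamma> (Var (?r + 2)) = n" "ty_of pcf_ty ?\<Gamma> (Var (?r + 2)) = Some TN"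
    using s(1) g(1) ev_Var[of ?s "?r + 2" n ?\<Gamma>] assms(1) by (simp_all add: etaN_TN)
  have "appN (ev s \<Gamma> (ifz \<sigma>)) (n # x # y # zs) =
    appN (ev ?s ?\<Gamma> (Con Ifzero $$ Var (?r + 2) $$ ?X $$ ?Y)) []"
  proof -
    let ?B = "Con Ifzero $$ Var (?r + 2) $$ ?X $$ ?Y"
    have B: "ty_of pcf_ty ?\<Gamma> ?B = Some TN" using ty n(2) by (simp del: ty_of.simps(1))
    then have "ty_of pcf_ty (\<sigma> # \<sigma> # TN # \<Gamma>) (foldr Abs ?\<tau>s ?B) = Some \<sigma>"
      by (simp add: ty_of_foldr_Abs)
    then show ?thesis
      using appN_ev_foldr_Abs[OF B, where qs=zs and ps="[]"] assms(4)
      by (simp add: ifz_def Let_def appN_ev_Abs del: appN_Lam)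
  qed
  also have "\<dots> = appN (ev ?s ?\<Gamma> (Con Ifzero)) [n, ev ?s ?\<Gamma> ?X, ev ?s ?\<Gamma> ?Y]"
    using ty n by (simp add: appN_ev_Ap del: appN_Lam ty_of.simps(1))
  also have "\<dots> = bind (appN n []) (\<lambda>i. if i = 0 then appN (ev ?s ?\<Gamma> ?X) [] else appN (ev ?s ?\<Gamma> ?Y) [])"
    by (subst ev_def, subst den.simps, rule appN_Ifzero) (use assms(1) ty in \<open>auto intro: has_arity_ev\<close>)
  finally show ?thesis unfolding X Y by (simp add: if_distrib[where f="\<lambda>p. appN p _"] cong: if_cong)
qed

section \<open>Hereditarily left-well-founded procedures\<close>

text \<open>The applications on the spine of an expression, found by passing through branches and
  never into arguments. The index counts the case distinctions passed and serves as induction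
  measure.\<close>

inductive reach :: "nat \<Rightarrow> nsp_exp \<Rightarrow> nat \<Rightarrow> nsp_proc list \<Rightarrow> bool" where
  reach_head: "reach 0 (Case (App x qs) F) x qs"
| reach_branch: "reach k (F i) x qs \<Longrightarrow> reach (Suc k) (Case a F) x qs"

lemma reach_simps [simp]: "\<not> reach k Bot x qs" "\<not> reach k (Num n) x qs"
  by (auto elim: reach.cases)

lemma reach_Case: "reach k (Case a F) x qs \<longleftrightarrow> (k = 0 \<and> a = App x qs) \<or> (\<exists>l i. k = Suc l \<and> reach l (F i) x qs)"
  by (cases a) (auto elim: reach.cases intro: reach.intros)

text \<open>
  For terms over first- and second-order variables, well-foundedness of the application tree may be
  tested with the arguments of type \<open>TN \<Rrightarrow> TN\<close> applied to numerals. The variables are not mentioned,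
  as every application is required to have a single argument.
\<close>

inductive good :: "nsp_exp \<Rightarrow> bool" where
  goodI: "(\<And>k x qs. reach k e x qs \<Longrightarrow> \<exists>q. qs = [q] \<and> (\<forall>n. good (appN q [num n]))) \<Longrightarrow> good e"

definition good_args :: "nsp_proc list \<Rightarrow> bool" where
  "good_args qs \<longleftrightarrow> (\<exists>q. qs = [q] \<and> (\<forall>n. good (appN q [num n])))"

lemma good_iff: "good e \<longleftrightarrow> (\<forall>k x qs. reach k e x qs \<longrightarrow> good_args qs)"
  unfolding good_args_def by (subst good.simps) auto

lemma good_simps [simp]: "good Bot" "good (Num n)"
  by (auto simp: good_iff)

lemma good_Case: "good (Case (App x qs) F) \<longleftrightarrow> good_args qs \<and> (\<forall>i. good (F i))"
proof
  assume g: "good (Case (App x qs) F)"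
  have "good (F i)" for i unfolding good_iff[of "F i"]
  proof (intro allI impI)
    fix k y ps assume "reach k (F i) y ps"
    then have "reach (Suc k) (Case (App x qs) F) y ps" by (rule reach_branch)
    then show "good_args ps" using g by (simp add: good_iff)
  qed
  moreover have "good_args qs" using g reach_head[of x qs F] by (simp add: good_iff)
  ultimately show "good_args qs \<and> (\<forall>i. good (F i))" by blast
qed (unfold good_iff, auto simp: reach_Case)

text \<open>Grafting continuations onto \<open>e\<close> can only push their applications deeper;
  the bound \<open>l \<le> k\<close> is what an induction on depth uses.\<close>

lemma reach_bind: "reach k (bind e K) x qs \<Longrightarrow> (\<exists>l. reach l e x qs) \<or> (\<exists>i l. l \<le> k \<and> reach l (K i) x qs)"
proof (induction k arbitrary: e rule: less_induct)
  case (less k)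
  show ?case
  proof (cases e)
    case (Case a F)
    with less.prems have "(k = 0 \<and> a = App x qs) \<or> (\<exists>l i. k = Suc l \<and> reach l (bind (F i) K) x qs)"
      by (simp add: reach_Case)
    then show ?thesis
    proof (elim disjE exE conjE)
      fix l i assume l: "k = Suc l" "reach l (bind (F i) K) x qs"
      from less.IH[OF _ l(2)] l(1) show ?thesis by (auto simp: Case reach_Case intro: le_SucI)
    qed (auto simp: Case reach_Case)
  qed (use less.prems in auto)
qed

lemma good_bind: "good e \<Longrightarrow> (\<And>i. good (K i)) \<Longrightarrow> good (bind e K)"
  unfolding good_iff[of "bind e K"] using reach_bind[of _ e K] good_iff by metis

text \<open>
  The free variables always stand for functionals of type 2, so no quantification over larger contexts
  is needed.
\<close>

primrec RED :: "ty \<Rightarrow> nsp_proc \<Rightarrow> bool" where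
  "RED TN p \<longleftrightarrow> has_arity TN p \<and> good (appN p [])"
| "RED (\<sigma> \<Rrightarrow> \<tau>) p \<longleftrightarrow> has_arity (\<sigma> \<Rrightarrow> \<tau>) p \<and> (\<forall>q. RED \<sigma> q \<longrightarrow> RED \<tau> (p \<cdot> q))"

lemma RED_iff: "RED \<sigma> p \<longleftrightarrow> has_arity \<sigma> p \<and> (\<forall>qs. list_all2 RED (args \<sigma>) qs \<longrightarrow> good (appN p qs))"
proof (induction \<sigma> arbitrary: p)
  case (Fun \<sigma> \<tau>)
  have "RED (\<sigma> \<Rrightarrow> \<tau>) p \<longleftrightarrow> has_arity (\<sigma> \<Rrightarrow> \<tau>) p \<and> (\<forall>q. RED \<sigma> q \<longrightarrow> (\<forall>qs. list_all2 RED (args \<tau>) qs \<longrightarrow> good (appN p (q # qs))))"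
    using Fun by (auto simp: has_arity_dot appN_dot' list_all2_lengthD simp del: appN_Lam)
  then show ?case by (auto simp: list_all2_Cons1)
qed auto

lemma RED_arity: "RED \<sigma> p \<Longrightarrow> has_arity \<sigma> p"
  by (simp add: RED_iff)

lemma RED_good: "RED \<sigma> p \<Longrightarrow> list_all2 RED (args \<sigma>) qs \<Longrightarrow> good (appN p qs)"
  by (simp add: RED_iff)

lemma RED_num [simp]: "RED TN (num n)"
  by simp

lemma size_args: "\<sigma> \<in> set (args \<tau>) \<Longrightarrow> size \<sigma> < size \<tau>"
  by (induction \<tau>) auto

lemma RED_etaN: "RED \<sigma> q \<Longrightarrow> RED \<sigma> (etaN \<sigma> q)"
proof (induction \<sigma> arbitrary: q rule: measure_induct_rule[of size])
  case (less \<sigma>)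
  have "good (appN (etaN \<sigma> q) qs)" if qs: "list_all2 RED (args \<sigma>) qs" for qs
  proof -
    have "list_all2 RED (args \<sigma>) (etasN (args \<sigma>) qs)"
      using qs less.IH[OF size_args] by (auto simp: list_all2_conv_all_nth etasN_def)
    then have "good (appN q (etasN (args \<sigma>) qs))" by (rule RED_good[OF less.prems])
    then show ?thesis using appN_etaN[OF RED_arity[OF less.prems], of qs] qs by (simp add: list_all2_lengthD)
  qed
  then show ?case by (simp add: RED_iff has_arity_etaN)
qed

lemma RED_etasN: "list_all2 RED \<sigma>s qs \<Longrightarrow> list_all2 RED \<sigma>s (etasN \<sigma>s qs)"
  by (auto simp: list_all2_conv_all_nth etasN_def RED_etaN)

lemma RED_dot: "RED (\<sigma> \<Rrightarrow> \<tau>) p \<Longrightarrow> RED \<sigma> q \<Longrightarrow> RED \<tau> (p \<cdot> q)"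
  by simp

text \<open>Tail recursion: the approximants \<open>en\<close> only serve to show that \<open>e\<close> is the least solution of its equation.\<close>

lemma good_tail:
  fixes e :: "nat \<Rightarrow> nsp_exp" and en :: "nat \<Rightarrow> nat \<Rightarrow> nsp_exp"
  assumes e: "\<And>n. e n = bind (a n) (\<lambda>i. if B i then e (Suc n) else g n i)"
    and en: "\<And>n. en 0 n = Bot" "\<And>m n. en (Suc m) n = bind (a n) (\<lambda>i. if B i then en m (Suc n) else g n i)"
    and least: "\<And>n. e n \<noteq> Bot \<Longrightarrow> \<exists>m. en m n \<noteq> Bot"
    and good: "\<And>n. good (a n)" "\<And>n i. good (g n i)"
  shows "good (e n)"
proof -
  have "reach k (e n) x qs \<Longrightarrow> good_args qs" for k x qs
  proof (induction k arbitrary: n rule: less_induct)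
    case (less k)
    then obtain m where "en m n \<noteq> Bot" using least by (metis reach_simps(1))
    with less.prems show ?case
    \<comment> \<open>If \<open>a n\<close> is a numeral, the recursive call lies at the same depth
      \<open>k\<close>, and it is the index \<open>m\<close> of a nontrivial approximant that
      decreases. If \<open>a n\<close> is a case, the call lies at smaller remaining depth and the
      outer induction applies.\<close>
    proof (induction m arbitrary: n)
      case (Suc m)
      show ?case
      proof (cases "a n")
        case Bot
        then show ?thesis using Suc.prems(1) e[of n] by simp
      next
        case (Num i)
        then show ?thesis using Suc.prems Suc.IH e[of n] en(2)[of m n] good(2)[of n i]
          by (auto split: if_splits simp: good_iff)
      next
        case (Case b F)
        with Suc.prems(1) e[of n] consider "b = App x qs" | l i where "k = Suc l" "reach l (bind (F i) (\<lambda>i. if B i then e (Suc n) else g n i)) x qs"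
          by (auto simp: reach_Case)
        then show ?thesis
        proof cases
          case 1
          with good(1)[of n] Case show ?thesis by (simp add: good_Case)
        next
          case (2 l i)
          from reach_bind[OF 2(2)] show ?thesis
          proof (elim disjE exE conjE)
            fix l' assume "reach l' (F i) x qs"
            then have "reach (Suc l') (a n) x qs" by (auto simp: Case reach_Case)
            then show ?thesis using good(1)[of n] by (auto simp: good_iff)
          next
            fix j l' assume l': "l' \<le> l" "reach l' (if B j then e (Suc n) else g n j) x qs"
            then show ?thesis using less.IH[of l' "Suc n"] 2(1) good(2)[of n j]
              by (auto split: if_splits simp: good_iff)
          qed
        qed
      qed
    qed (simp add: en)
  qed
  then show ?thesis by (simp add: good_iff)
qed

definition RED_subst :: "ty list \<Rightarrow> msubst \<Rightarrow> bool" where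
  "RED_subst \<Gamma> s \<longleftrightarrow> (\<forall>i < length \<Gamma>. \<exists>q. s i = Inr (embP q) \<and> RED (\<Gamma> ! i) q)"

lemma RED_subst_ext: "RED_subst \<Gamma> s \<Longrightarrow> RED \<sigma> q \<Longrightarrow> RED_subst (\<sigma> # \<Gamma>) (ext_subst q s)"
  by (auto simp: RED_subst_def less_Suc_eq_0_disj)

section \<open>Reducibility of the constants\<close>

lemma RED_Numeral: "RED TN (sbP s (pcf_den (Numeral n)))"
  by simp

lemma RED_I: "has_arity \<sigma> p \<Longrightarrow> (\<And>qs. list_all2 RED (args \<sigma>) qs \<Longrightarrow> good (appN p qs)) \<Longrightarrow> RED \<sigma> p"
  by (simp add: RED_iff)

lemma RED_val: "RED TN q \<Longrightarrow> good (appN q [])"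
  by simp

lemma has_arity_pcf: "has_arity (pcf_ty c) (sbP s (pcf_den c))"
  by (intro has_arity_sb has_arity_pcf_den)

lemma RED_Succ: "RED (TN \<Rrightarrow> TN) (sbP s (pcf_den Succ))"
proof (rule RED_I)
  fix qs assume "list_all2 RED (args (TN \<Rrightarrow> TN)) qs"
  then obtain n where n: "qs = [n]" "RED TN n" by (auto simp: list_all2_Cons1 simp del: RED.simps)
  show "good (appN (sbP s (pcf_den Succ)) qs)"
    unfolding n(1) appN_Succ[OF RED_arity[OF n(2)]] by (intro good_bind RED_val n good_simps)
qed (use has_arity_pcf[of Succ] in simp)

lemma RED_Pre: "RED (TN \<Rrightarrow> TN) (sbP s (pcf_den Pre))"
proof (rule RED_I)
  fix qs assume "list_all2 RED (args (TN \<Rrightarrow> TN)) qs"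
  then obtain n where n: "qs = [n]" "RED TN n" by (auto simp: list_all2_Cons1 simp del: RED.simps)
  show "good (appN (sbP s (pcf_den Pre)) qs)"
    unfolding n(1) appN_Pre[OF RED_arity[OF n(2)]] by (intro good_bind RED_val n good_simps)
qed (use has_arity_pcf[of Pre] in simp)

lemma RED_Ifzero: "RED (TN \<Rrightarrow> TN \<Rrightarrow> TN \<Rrightarrow> TN) (sbP s (pcf_den Ifzero))"
proof (rule RED_I)
  fix qs assume "list_all2 RED (args (TN \<Rrightarrow> TN \<Rrightarrow> TN \<Rrightarrow> TN)) qs"
  then obtain n x y where n: "qs = [n, x, y]" "RED TN n" "RED TN x" "RED TN y"
    by (auto simp: list_all2_Cons1 simp del: RED.simps)
  have "good (if i = (0 :: nat) then appN x [] else appN y [])" for i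
    using n RED_val by simp
  then show "good (appN (sbP s (pcf_den Ifzero)) qs)"
    unfolding n(1) appN_Ifzero[OF n(2-4)[THEN RED_arity]] by (intro good_bind RED_val n)
qed (use has_arity_pcf[of Ifzero] in simp)

lemma ev_Con: "ev s \<Gamma> (Con c) = sbP s (pcf_den c)"
  by (simp add: ev_def)

lemma ev_Y: "ev s \<Gamma> (Con (Y \<sigma>) $$ H) = fixp \<sigma> (ev s \<Gamma> H)"
  by (simp add: ev_Ap ev_Con dot_Y del: pcf_den.simps)

text \<open>The loop calls itself in tail position, so \<open>good_tail\<close> applies: its stage
  \<open>n\<close> is the fixed point applied to the state after \<open>n\<close> rounds.
  Reducibility of \<open>c\<close> and \<open>f\<close> keeps tests good and states
  reducible.\<close>

lemma RED_While: "RED (const_ty (While \<sigma>)) (ev s \<Gamma> (prog (While \<sigma>)))"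
proof (rule RED_I)
  show "has_arity (const_ty (While \<sigma>)) (ev s \<Gamma> (prog (While \<sigma>)))"
    by (rule has_arity_ev[OF ty_of_prog])
  fix qs assume "list_all2 RED (args (const_ty (While \<sigma>))) qs"
  then obtain c x f zs where qs: "qs = c # x # f # zs"
    and RED: "RED (\<sigma> \<Rrightarrow> TN) c" "RED \<sigma> x" "RED (\<sigma> \<Rrightarrow> \<sigma>) f" "list_all2 RED (args \<sigma>) zs"
    by (auto simp: list_all2_Cons1 simp del: RED.simps)
  define as where "as = args \<sigma>"
  define s1 where "s1 = ext_subst f (ext_subst x (ext_subst c s))"
  define \<Gamma>1 where "\<Gamma>1 = (\<sigma> \<Rrightarrow> \<sigma>) # \<sigma> # (\<sigma> \<Rrightarrow> TN) # \<Gamma>"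
  define body where "body = ifz \<sigma> $$ (Var 4 $$ Var 0) $$ (Var 1 $$ (Var 2 $$ Var 0)) $$ Var 0"
  define Ht where "Ht = Abs (\<sigma> \<Rrightarrow> \<sigma>) (Abs \<sigma> body)"
  define h where "h = ev s1 \<Gamma>1 Ht"
  let ?\<Gamma>3 = "\<sigma> # (\<sigma> \<Rrightarrow> \<sigma>) # \<Gamma>1"
  have tb: "ty_of pcf_ty ?\<Gamma>3 body = Some \<sigma>"
    by (simp add: body_def \<Gamma>1_def)
  then have tH: "ty_of pcf_ty \<Gamma>1 Ht = Some ((\<sigma> \<Rrightarrow> \<sigma>) \<Rrightarrow> \<sigma> \<Rrightarrow> \<sigma>)" by (simp add: Ht_def)
  have h: "has_arity ((\<sigma> \<Rrightarrow> \<sigma>) \<Rrightarrow> \<sigma> \<Rrightarrow> \<sigma>) h" unfolding h_def by (rule has_arity_ev[OF tH])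
  have start: "appN (ev s \<Gamma> (prog (While \<sigma>))) qs = appN (fixp (\<sigma> \<Rrightarrow> \<sigma>) h) (etaN \<sigma> x # zs)"
  proof -
    let ?T = "Con (Y (\<sigma> \<Rrightarrow> \<sigma>)) $$ Ht $$ Var 1"
    have tT: "ty_of pcf_ty \<Gamma>1 ?T = Some \<sigma>" using tH by (simp add: \<Gamma>1_def)
    have len: "length zs = length (args \<sigma>)" using RED(4) by (simp add: list_all2_lengthD)
    have "appN (ev s \<Gamma> (prog (While \<sigma>))) qs = appN (ev s1 \<Gamma>1 ?T) zs"
      unfolding prog_ifz qs s1_def \<Gamma>1_def Ht_def body_def
      using tT[unfolded \<Gamma>1_def Ht_def body_def] len by (simp add: appN_ev_Abs del: appN_Lam)
    also have "\<dots> = appN (ev s1 \<Gamma>1 (Con (Y (\<sigma> \<Rrightarrow> \<sigma>)) $$ Ht)) (ev s1 \<Gamma>1 (Var 1) # zs)"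
      using tH len by (intro appN_ev_Ap) simp_all
    also have "ev s1 \<Gamma>1 (Var 1) = etaN \<sigma> x" by (subst ev_Var) (simp_all add: s1_def \<Gamma>1_def)
    finally show ?thesis by (simp add: ev_Y h_def del: appN_Lam)
  qed
  have step: "appN h (w # x' # zs') = bind (appN (etaN (\<sigma> \<Rrightarrow> TN) c \<cdot> etaN \<sigma> x') []) (\<lambda>i.
      if i = 0 then appN w (etaN \<sigma> (etaN (\<sigma> \<Rrightarrow> \<sigma>) f \<cdot> etaN \<sigma> x') # etasN as (etasN as (etasN as zs')))
      else appN (etaN \<sigma> x') (etasN as (etasN as zs')))"
    if w: "has_arity (\<sigma> \<Rrightarrow> \<sigma>) w" and x': "has_arity \<sigma> x'" and len: "length zs' = length as" for w x' zs'
  proof -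
    define s3 where "s3 = ext_subst x' (ext_subst w s1)"
    have s3: "s3 0 = Inr (embP x')" "s3 1 = Inr (embP w)" "s3 2 = Inr (embP f)" "s3 4 = Inr (embP c)"
      by (simp_all add: s3_def s1_def numeral_eq_Suc)
    have \<Gamma>3: "?\<Gamma>3 ! 0 = \<sigma>" "?\<Gamma>3 ! 1 = (\<sigma> \<Rrightarrow> \<sigma>)" "?\<Gamma>3 ! 2 = (\<sigma> \<Rrightarrow> \<sigma>)" "?\<Gamma>3 ! 4 = (\<sigma> \<Rrightarrow> TN)" "length ?\<Gamma>3 > 4"
      by (simp_all add: \<Gamma>1_def numeral_eq_Suc)
    have ty: "ty_of pcf_ty ?\<Gamma>3 (Var 0) = Some \<sigma>" "ty_of pcf_ty ?\<Gamma>3 (Var 1) = Some (\<sigma> \<Rrightarrow> \<sigma>)"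
      "ty_of pcf_ty ?\<Gamma>3 (Var 2) = Some (\<sigma> \<Rrightarrow> \<sigma>)" "ty_of pcf_ty ?\<Gamma>3 (Var 4) = Some (\<sigma> \<Rrightarrow> TN)"
      by (simp_all add: \<Gamma>1_def numeral_eq_Suc)
    have x0: "ev s3 ?\<Gamma>3 (Var 0) = etaN \<sigma> x'" using ev_Var[of s3 0 x' ?\<Gamma>3] s3 \<Gamma>3 by simp
    have N: "ev s3 ?\<Gamma>3 (Var 4 $$ Var 0) = etaN (\<sigma> \<Rrightarrow> TN) c \<cdot> etaN \<sigma> x'"
      using ev_Ap[OF ty(4)] ev_Var[of s3 4 c ?\<Gamma>3] s3 \<Gamma>3 x0 by simp
    have F: "ev s3 ?\<Gamma>3 (Var 2 $$ Var 0) = etaN (\<sigma> \<Rrightarrow> \<sigma>) f \<cdot> etaN \<sigma> x'"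
      using ev_Ap[OF ty(3)] ev_Var[of s3 2 f ?\<Gamma>3] s3 \<Gamma>3 x0 by simp
    let ?T = "Var 1 $$ (Var 2 $$ Var 0)"
    have tyT: "ty_of pcf_ty ?\<Gamma>3 ?T = Some \<sigma>" "ty_of pcf_ty ?\<Gamma>3 (Var 4 $$ Var 0) = Some TN" using ty by (simp_all del: ty_of.simps(1))
    have T: "appN (ev s3 ?\<Gamma>3 ?T) ys = appN w (etaN \<sigma> (etaN (\<sigma> \<Rrightarrow> \<sigma>) f \<cdot> etaN \<sigma> x') # etasN as ys)"
      if "length ys = length as" for ys
    proof -
      have "appN (ev s3 ?\<Gamma>3 ?T) ys = appN (ev s3 ?\<Gamma>3 (Var 1)) ((etaN (\<sigma> \<Rrightarrow> \<sigma>) f \<cdot> etaN \<sigma> x') # ys)"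
        using appN_ev_Ap[OF ty(2), of ys s3 "Var 2 $$ Var 0"] that by (simp add: as_def F)
      also have "\<dots> = appN w (etasN (args (?\<Gamma>3 ! 1)) ((etaN (\<sigma> \<Rrightarrow> \<sigma>) f \<cdot> etaN \<sigma> x') # ys))"
        by (rule appN_ev_Var[where s=s3 and x=1, OF s3(2)]) (use \<Gamma>3 w that as_def in simp_all)
      finally show ?thesis using \<Gamma>3 by (simp add: as_def)
    qed
    have "appN h (w # x' # zs') = appN (ev s3 ?\<Gamma>3 body) zs'"
      using tb len unfolding h_def Ht_def s3_def as_def
      by (simp add: appN_ev_Abs del: appN_Lam)
    also have "\<dots> = appN (ev s3 ?\<Gamma>3 (ifz \<sigma>)) (ev s3 ?\<Gamma>3 (Var 4 $$ Var 0) # ev s3 ?\<Gamma>3 ?T # ev s3 ?\<Gamma>3 (Var 0) # zs')"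
      using tyT ty(1) len unfolding body_def as_def by (simp add: appN_ev_Ap del: appN_Lam ty_of.simps(1))
    also have "\<dots> = bind (appN (ev s3 ?\<Gamma>3 (Var 4 $$ Var 0)) [])
        (\<lambda>i. appN (if i = 0 then ev s3 ?\<Gamma>3 ?T else ev s3 ?\<Gamma>3 (Var 0)) (etasN as (etasN as zs')))"
      unfolding as_def by (rule appN_ev_ifz) (use tyT ty(1) len as_def in \<open>auto intro: has_arity_ev\<close>)
    finally show ?thesis unfolding N x0 using T[of "etasN as (etasN as zs')"] len
      by (simp add: if_distrib[where f="\<lambda>p. appN p _"] cong: if_cong)
  qed
  \<comment> \<open>The trailing arguments gain four expansions per round: one from unfolding the
    fixed point, two from \<open>ifz\<close>, one from the variable that stands for the
    loop.\<close>
  define next_st where "next_st = (\<lambda>(y, ys). (etaN \<sigma> (etaN (\<sigma> \<Rrightarrow> \<sigma>) f \<cdot> etaN \<sigma> (etaN \<sigma> y)), etasN as (etasN as (etasN as (etasN as ys)))))"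
  define st where "st n = (next_st ^^ n) (etaN \<sigma> x, zs)" for n
  have RED_st: "RED \<sigma> (fst (st n)) \<and> list_all2 RED as (snd (st n))" for n
  proof (induction n)
    case 0
    then show ?case using RED by (simp add: st_def RED_etaN as_def)
  next
    case (Suc n)
    then have "RED \<sigma> (etaN \<sigma> (etaN (\<sigma> \<Rrightarrow> \<sigma>) f \<cdot> etaN \<sigma> (etaN \<sigma> (fst (st n)))))"
      by (intro RED_etaN RED_dot[of \<sigma>] RED) simp
    with Suc show ?case by (auto simp: st_def next_st_def split_beta intro!: RED_etasN)
  qed
  note len = RED_st[THEN conjunct2, THEN list_all2_lengthD, symmetric]
  note ar = RED_st[THEN conjunct1, THEN RED_arity]
  have "good (appN (fixp (\<sigma> \<Rrightarrow> \<sigma>) h) (fst (st 0) # snd (st 0)))"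
  proof (rule good_tail[where e="\<lambda>n. appN (fixp (\<sigma> \<Rrightarrow> \<sigma>) h) (fst (st n) # snd (st n))"
        and en="\<lambda>m n. appN (fixn m (\<sigma> \<Rrightarrow> \<sigma>) h) (fst (st n) # snd (st n))" and B="\<lambda>i. i = 0"
        and a="\<lambda>n. appN (etaN (\<sigma> \<Rrightarrow> TN) c \<cdot> etaN \<sigma> (etaN \<sigma> (fst (st n)))) []"
        and g="\<lambda>n i. appN (etaN \<sigma> (etaN \<sigma> (fst (st n)))) (etasN as (etasN as (etasN as (snd (st n)))))"], goal_cases)
    case (1 n)
    show ?case using len[of n] ar[of n]
      by (subst appN_fixp[OF h]) (simp_all add: as_def step[unfolded as_def] has_arity_fix has_arity_etaN
          st_def next_st_def split_beta del: appN_Lam cong: if_cong)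
  next
    case (2 n)
    show ?case using len[of n] by (subst appN_fixn(1)[OF h]) (simp_all add: as_def)
  next
    case (3 m n)
    show ?case using len[of n] ar[of n]
      by (subst appN_fixn(2)[OF h]) (simp_all add: as_def step[unfolded as_def] has_arity_fix has_arity_etaN
          st_def next_st_def split_beta del: appN_Lam cong: if_cong)
  next
    case (4 n)
    then show ?case using len[of n] by (intro fixp_continuous) (simp_all add: as_def)
  next
    case (5 n)
    show ?case by (intro RED_val RED_dot[of \<sigma>] RED_etaN RED) (use RED_st in simp)
  next
    case (6 n i)
    show ?case unfolding as_def
      by (intro RED_good[of \<sigma>] RED_etaN RED_etasN) (use RED_st as_def in simp_all)
  qed
  then show "good (appN (ev s \<Gamma> (prog (While \<sigma>))) qs)"
    unfolding start by (simp add: st_def)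
qed

text \<open>The recursive call is an argument of \<open>f\<close>, not a tail call, so each round
  adds nesting. The induction is on the numeral: \<open>byval\<close> turns the recursion argument
  into \<open>num i\<close>, and the call made there is at the predecessor.\<close>

lemma RED_Rec: "RED (const_ty (Rec \<sigma>)) (ev s \<Gamma> (prog (Rec \<sigma>)))"
proof (rule RED_I)
  show "has_arity (const_ty (Rec \<sigma>)) (ev s \<Gamma> (prog (Rec \<sigma>)))"
    by (rule has_arity_ev[OF ty_of_prog])
  define as where "as = args \<sigma>"
  define \<phi> where "\<phi> = (\<sigma> \<Rrightarrow> TN \<Rrightarrow> \<sigma>)"
  define \<rho> where "\<rho> = rec_ty \<sigma>"
  have args: "args \<phi> = \<sigma> # TN # as" "args \<rho> = \<sigma> # \<phi> # TN # as"
    by (simp_all add: \<rho>_def \<phi>_def as_def)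
  define D where "D = byval_plus \<sigma> $$ Var 4 $$ Var 3 $$ Var 2 $$ Var 0"
  define B where "B = Var 2 $$ D $$ Var 0"
  define R where "R = Con (Byval [] \<sigma>) $$ Abs TN B $$ (Con Pre $$ Var 0)"
  define body where "body = ifz \<sigma> $$ Var 0 $$ Var 2 $$ R"
  define Ht where "Ht = Abs \<rho> (Abs \<sigma> (Abs \<phi> (Abs TN body)))"
  define h where "h = ev s \<Gamma> Ht"
  let ?\<Gamma>4 = "TN # \<phi> # \<sigma> # \<rho> # \<Gamma>" let ?\<Gamma>5 = "TN # ?\<Gamma>4"
  have \<rho>: "\<rho> = (\<sigma> \<Rrightarrow> \<phi> \<Rrightarrow> TN \<Rrightarrow> \<sigma>)" by (simp add: \<rho>_def \<phi>_def)
  have tD: "ty_of pcf_ty ?\<Gamma>5 D = Some \<sigma>" by (simp add: D_def \<rho> \<phi>_def)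
  then have tB: "ty_of pcf_ty ?\<Gamma>5 B = Some \<sigma>" by (simp add: B_def \<phi>_def)
  then have tR: "ty_of pcf_ty ?\<Gamma>4 R = Some \<sigma>" by (simp add: R_def)
  then have tb: "ty_of pcf_ty ?\<Gamma>4 body = Some \<sigma>" by (simp add: body_def)
  then have tH: "ty_of pcf_ty \<Gamma> Ht = Some (\<rho> \<Rrightarrow> \<rho>)" by (simp add: Ht_def \<rho>)
  have h: "has_arity (\<rho> \<Rrightarrow> \<rho>) h" unfolding h_def by (rule has_arity_ev[OF tH])
  have main: "good (appN (fixp \<rho> h) (x # f # num i # zs))"
    if "RED \<sigma> x" "RED \<phi> f" "list_all2 RED as zs" for i x f zs
    using that
  proof (induction i arbitrary: x f zs rule: less_induct)
    fix i x f zs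
    assume IH: "\<And>j x f zs. j < i \<Longrightarrow> RED \<sigma> x \<Longrightarrow> RED \<phi> f \<Longrightarrow> list_all2 RED as zs \<Longrightarrow>
      good (appN (fixp \<rho> h) (x # f # num j # zs))"
      and x0: "RED \<sigma> x" and f0: "RED \<phi> f" and zs0: "list_all2 RED as zs"
    let ?w = "fixp \<rho> h"
    define x' where "x' = etaN \<sigma> x" define f' where "f' = etaN \<phi> f" define zs' where "zs' = etasN as zs"
    have x: "RED \<sigma> x'" and f: "RED \<phi> f'" and zs: "list_all2 RED as zs'"
      using x0 f0 zs0 unfolding x'_def f'_def zs'_def by (auto intro: RED_etaN RED_etasN simp del: RED.simps)
    define s4 where "s4 = ext_subst (num i) (ext_subst f' (ext_subst x' (ext_subst ?w s)))"
    have s4: "s4 0 = Inr (embP (num i))" "s4 2 = Inr (embP x')"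
      by (simp_all add: s4_def numeral_eq_Suc)
    have len: "length zs = length as" "length zs' = length as" using zs0 zs by (auto dest: list_all2_lengthD)
    define zs2 where "zs2 = etasN as (etasN as zs')"
    have zs2: "list_all2 RED as zs2" unfolding zs2_def by (intro RED_etasN zs)
    have "appN ?w (x # f # num i # zs) = appN h (?w # x' # f' # num i # zs')"
      by (subst appN_fixp[OF h]) (simp_all add: args x'_def f'_def zs'_def len del: appN_Lam)
    also have "\<dots> = appN (ev s4 ?\<Gamma>4 body) zs'"
      unfolding h_def Ht_def s4_def
      using tb len by (simp add: appN_ev_Abs as_def del: appN_Lam embP.simps emb_simps)
    also have "\<dots> = appN (ev s4 ?\<Gamma>4 (ifz \<sigma>)) (ev s4 ?\<Gamma>4 (Var 0) # ev s4 ?\<Gamma>4 (Var 2) # ev s4 ?\<Gamma>4 R # zs')"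
      using tR len unfolding body_def as_def by (simp add: appN_ev_Ap del: appN_Lam)
    also have "\<dots> = bind (appN (ev s4 ?\<Gamma>4 (Var 0)) []) (\<lambda>k. appN (if k = 0 then ev s4 ?\<Gamma>4 (Var 2) else ev s4 ?\<Gamma>4 R) zs2)"
      unfolding zs2_def as_def by (rule appN_ev_ifz) (use tR len as_def in \<open>auto intro: has_arity_ev\<close>)
    also have "ev s4 ?\<Gamma>4 (Var 0) = num i" by (subst ev_Var[where s=s4 and x=0, OF s4(1)]) simp
    also have "ev s4 ?\<Gamma>4 (Var 2) = etaN \<sigma> x'" by (subst ev_Var[where s=s4 and x=2, OF s4(2)]) simp
    finally have eq: "appN ?w (x # f # num i # zs) = appN (if i = 0 then etaN \<sigma> x' else ev s4 ?\<Gamma>4 R) zs2"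
      by simp
    show "good (appN ?w (x # f # num i # zs))"
    proof (cases i)
      case 0
      show ?thesis unfolding eq using zs2 x
        by (simp add: 0 as_def RED_good[OF RED_etaN] del: appN_Lam)
    next
      case (Suc j)
      then have lt: "j < i" by simp
      define s5 where "s5 = ext_subst (num j) s4"
      have s5: "s5 0 = Inr (embP (num j))" "s5 2 = Inr (embP f')" "s5 3 = Inr (embP x')" "s5 4 = Inr (embP ?w)"
        by (simp_all add: s5_def s4_def numeral_eq_Suc)
      define zs3 where "zs3 = etasN as zs2"
      have zs3: "list_all2 RED as zs3" unfolding zs3_def by (intro RED_etasN zs2)
      have len2: "length zs2 = length as" "length zs3 = length as" using zs2 zs3 by (auto dest: list_all2_lengthD)
      have v: "ev s5 ?\<Gamma>5 (Var 0) = num j" "ev s5 ?\<Gamma>5 (Var 2) = etaN \<phi> f'" "ev s5 ?\<Gamma>5 (Var 3) = etaN \<sigma> x'"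
        "ev s5 ?\<Gamma>5 (Var 4) = etaN \<rho> ?w"
        by (subst ev_Var, rule s5, simp)+
      have P: "appN (ev s4 ?\<Gamma>4 (Con Pre $$ Var 0)) [] = Num j"
      proof -
        have "appN (ev s4 ?\<Gamma>4 (Con Pre $$ Var 0)) [] = appN (sbP s4 (pcf_den Pre)) [num i]"
          using ev_Var[where s=s4 and x=0, OF s4(1), of ?\<Gamma>4] by (simp add: appN_ev_Ap ev_Con del: appN_Lam pcf_den.simps)
        then show ?thesis by (simp add: appN_Pre Suc del: appN_Lam pcf_den.simps)
      qed
      have "appN (ev s4 ?\<Gamma>4 R) zs2 = appN (sbP s4 (pcf_den (Byval [] \<sigma>))) (ev s4 ?\<Gamma>4 (Abs TN B) # [] @ ev s4 ?\<Gamma>4 (Con Pre $$ Var 0) # zs2)"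
        unfolding R_def using tB len2 by (simp add: appN_ev_Ap ev_Con as_def del: appN_Lam pcf_den.simps)
      also have "\<dots> = bind (appN (ev s4 ?\<Gamma>4 (Con Pre $$ Var 0)) []) (\<lambda>k. appN (ev s4 ?\<Gamma>4 (Abs TN B)) (etasN [] [] @ num k # etasN (args \<sigma>) zs2))"
        by (rule appN_Byval) (use tB len2 as_def in \<open>auto intro!: has_arity_ev\<close>)
      also have "\<dots> = appN (ev s5 ?\<Gamma>5 B) zs3"
        using tB len2 unfolding P by (simp add: appN_ev_Abs s5_def zs3_def as_def del: appN_Lam)
      also have "\<dots> = appN (ev s5 ?\<Gamma>5 (Var 2)) (ev s5 ?\<Gamma>5 D # ev s5 ?\<Gamma>5 (Var 0) # zs3)"
        using tD len2 unfolding B_def by (simp add: appN_ev_Ap \<phi>_def as_def del: appN_Lam)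
      finally have R: "appN (ev s4 ?\<Gamma>4 R) zs2 = appN (etaN \<phi> f') (ev s5 ?\<Gamma>5 D # num j # zs3)"
        unfolding v .
      \<comment> \<open>The recursive call as an object handed to \<open>f\<close>; applied to any
        reducible \<open>ys\<close> it is good by the induction hypothesis at
        \<open>j\<close>.\<close>
      have "RED \<sigma> (ev s5 ?\<Gamma>5 D)"
      proof (rule RED_I)
        show "has_arity \<sigma> (ev s5 ?\<Gamma>5 D)" by (rule has_arity_ev[OF tD])
        fix ys assume "list_all2 RED (args \<sigma>) ys"
        then have ys: "list_all2 RED as ys" "length ys = length as" by (auto simp: as_def dest: list_all2_lengthD)
        have "appN (ev s5 ?\<Gamma>5 D) ys = appN (sbP s5 (pcf_den (Byval [\<sigma>, \<phi>] \<sigma>))) (ev s5 ?\<Gamma>5 (Var 4) # [ev s5 ?\<Gamma>5 (Var 3), ev s5 ?\<Gamma>5 (Var 2)] @ ev s5 ?\<Gamma>5 (Var 0) # ys)"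
          unfolding D_def using ys by (simp add: appN_ev_Ap ev_Con as_def \<rho> \<phi>_def del: appN_Lam pcf_den.simps)
        also have "\<dots> = bind (appN (ev s5 ?\<Gamma>5 (Var 0)) []) (\<lambda>k. appN (ev s5 ?\<Gamma>5 (Var 4)) (etasN [\<sigma>, \<phi>] [ev s5 ?\<Gamma>5 (Var 3), ev s5 ?\<Gamma>5 (Var 2)] @ num k # etasN (args \<sigma>) ys))"
          by (rule appN_Byval) (use ys as_def \<rho> in \<open>auto intro!: has_arity_ev\<close>)
        also have "\<dots> = appN (etaN \<rho> ?w) (etaN \<sigma> (etaN \<sigma> x') # etaN \<phi> (etaN \<phi> f') # num j # etasN as ys)"
          unfolding v by (simp add: as_def)
        also have "\<dots> = appN ?w (etaN \<sigma> (etaN \<sigma> (etaN \<sigma> x')) # etaN \<phi> (etaN \<phi> (etaN \<phi> f')) # num j # etasN as (etasN as ys))"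
          by (subst appN_etaN) (simp_all add: args ys has_arity_fix del: appN_Lam)
        also have "good \<dots>" by (intro IH[OF lt] RED_etaN RED_etasN x f ys)
        finally show "good (appN (ev s5 ?\<Gamma>5 D) ys)" .
      qed
      with zs3 f have "good (appN (etaN \<phi> f') (ev s5 ?\<Gamma>5 D # num j # zs3))"
        by (intro RED_good[OF RED_etaN[OF f]]) (simp add: args del: RED.simps)
      then show ?thesis unfolding eq R[symmetric] by (simp add: Suc del: appN_Lam)
    qed
  qed
  fix qs assume "list_all2 RED (args (const_ty (Rec \<sigma>))) qs"
  then obtain x f n zs where qs: "qs = x # f # n # zs"
    and RED: "RED \<sigma> x" "RED \<phi> f" "RED TN n" "list_all2 RED as zs"
    by (auto simp: list_all2_Cons1 as_def \<phi>_def simp del: RED.simps)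
  have len: "length zs = length as" using RED(4) by (rule list_all2_lengthD[symmetric])
  have tY: "ty_of pcf_ty \<Gamma> (Con (Y \<rho>) $$ Ht) = Some \<rho>" using tH by simp
  have P: "prog (Rec \<sigma>) = Con (Byval [\<sigma>, \<phi>] \<sigma>) $$ (Con (Y \<rho>) $$ Ht)"
    unfolding prog_ifz Ht_def body_def R_def B_def D_def \<rho>_def \<phi>_def ..
  have "appN (ev s \<Gamma> (prog (Rec \<sigma>))) qs = appN (sbP s (pcf_den (Byval [\<sigma>, \<phi>] \<sigma>))) (fixp \<rho> h # [x, f] @ n # zs)"
    unfolding P using tH len by (simp add: qs appN_ev_Ap ev_Con ev_Y h_def as_def \<rho> del: appN_Lam pcf_den.simps)
  also have "\<dots> = bind (appN n []) (\<lambda>k. appN (fixp \<rho> h) (etasN [\<sigma>, \<phi>] [x, f] @ num k # etasN (args \<sigma>) zs))"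
    by (rule appN_Byval) (use RED len as_def \<rho> has_arity_fix[of \<rho>] in \<open>auto intro: RED_arity simp del: RED.simps\<close>)
  also have "good \<dots>"
    by (intro good_bind RED_val RED) (use RED in \<open>simp add: as_def[symmetric] main RED_etaN RED_etasN del: appN_Lam RED.simps\<close>)
  finally show "good (appN (ev s \<Gamma> (prog (Rec \<sigma>))) qs)" .
qed

text \<open>Minimisation tail-calls itself with the counter raised by one; stage \<open>n\<close> of
  \<open>good_tail\<close> searches from \<open>j + n\<close>. The function changes only by eta
  expansions, four per round, which \<open>F\<close> records.\<close>

lemma RED_Min: "RED (const_ty Min) (ev s \<Gamma> (prog Min))"
proof (rule RED_I)
  show "has_arity (const_ty Min) (ev s \<Gamma> (prog Min))"
    by (rule has_arity_ev[OF ty_of_prog])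
  fix qs assume "list_all2 RED (args (const_ty Min)) qs"
  then obtain f n where qs: "qs = [f, n]" and RED: "RED (TN \<Rrightarrow> TN) f" "RED TN n"
    by (auto simp: list_all2_Cons1 simp del: RED.simps)
  let ?\<phi> = "TN \<Rrightarrow> TN"
  let ?\<Gamma>3 = "TN # ?\<phi> # min_ty # \<Gamma>"
  define L where "L = Con (Byval [?\<phi>] TN) $$ Var 2 $$ Var 1 $$ (Con Succ $$ Var 0)"
  define body where "body = Con Ifzero $$ (Var 1 $$ Var 0) $$ Var 0 $$ L"
  define Ht where "Ht = Abs min_ty (Abs ?\<phi> (Abs TN body))"
  define h where "h = ev s \<Gamma> Ht"
  have tL: "ty_of pcf_ty ?\<Gamma>3 L = Some TN" by (simp add: L_def)
  then have tb: "ty_of pcf_ty ?\<Gamma>3 body = Some TN" by (simp add: body_def)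
  then have tH: "ty_of pcf_ty \<Gamma> Ht = Some (min_ty \<Rrightarrow> min_ty)" by (simp add: Ht_def)
  have h: "has_arity (min_ty \<Rrightarrow> min_ty) h" unfolding h_def by (rule has_arity_ev[OF tH])
  have step: "appN h [w, f', num j] = bind (appN (etaN ?\<phi> f' \<cdot> num j) []) (\<lambda>i.
      if i \<noteq> 0 then appN w [etaN ?\<phi> (etaN ?\<phi> (etaN ?\<phi> f')), num (Suc j)] else Num j)"
    if w: "has_arity min_ty w" and f': "has_arity ?\<phi> f'" for w f' j
  proof -
    define s3 where "s3 = ext_subst (num j) (ext_subst f' (ext_subst w s))"
    have s3: "s3 0 = Inr (embP (num j))" "s3 1 = Inr (embP f')" "s3 2 = Inr (embP w)"
      by (simp_all add: s3_def numeral_eq_Suc)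
    have v: "ev s3 ?\<Gamma>3 (Var 0) = num j" "ev s3 ?\<Gamma>3 (Var 1) = etaN ?\<phi> f'" "ev s3 ?\<Gamma>3 (Var 2) = etaN min_ty w"
      by (subst ev_Var, rule s3, simp)+
    have N: "ev s3 ?\<Gamma>3 (Var 1 $$ Var 0) = etaN ?\<phi> f' \<cdot> num j"
      using v by (subst ev_Ap[of _ _ TN TN]) simp_all
    have tN: "ty_of pcf_ty ?\<Gamma>3 (Var 1 $$ Var 0) = Some TN" by simp
    have S: "appN (ev s3 ?\<Gamma>3 (Con Succ $$ Var 0)) [] = Num (Suc j)"
    proof -
      have "appN (ev s3 ?\<Gamma>3 (Con Succ $$ Var 0)) [] = appN (sbP s3 (pcf_den Succ)) [num j]"
        using v(1) by (simp add: appN_ev_Ap ev_Con del: appN_Lam pcf_den.simps)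
      then show ?thesis by (simp add: appN_Succ del: appN_Lam pcf_den.simps)
    qed
    have "appN (ev s3 ?\<Gamma>3 L) [] = appN (sbP s3 (pcf_den (Byval [?\<phi>] TN))) (ev s3 ?\<Gamma>3 (Var 2) # [ev s3 ?\<Gamma>3 (Var 1)] @ ev s3 ?\<Gamma>3 (Con Succ $$ Var 0) # [])"
      unfolding L_def by (simp add: appN_ev_Ap ev_Con del: appN_Lam pcf_den.simps)
    also have "\<dots> = bind (appN (ev s3 ?\<Gamma>3 (Con Succ $$ Var 0)) []) (\<lambda>k. appN (ev s3 ?\<Gamma>3 (Var 2)) (etasN [?\<phi>] [ev s3 ?\<Gamma>3 (Var 1)] @ num k # etasN (args TN) []))"
      by (rule appN_Byval) (auto intro!: has_arity_ev)
    also have "\<dots> = appN (etaN min_ty w) [etaN ?\<phi> (etaN ?\<phi> f'), num (Suc j)]"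
      unfolding S v by simp
    also have "\<dots> = appN w [etaN ?\<phi> (etaN ?\<phi> (etaN ?\<phi> f')), num (Suc j)]"
      by (subst appN_etaN[OF w]) simp_all
    finally have L: "appN (ev s3 ?\<Gamma>3 L) [] = \<dots>" .
    have "appN h [w, f', num j] = appN (ev s3 ?\<Gamma>3 body) []"
      unfolding h_def Ht_def s3_def using tb by (simp add: appN_ev_Abs del: appN_Lam emb_simps)
    also have "\<dots> = appN (sbP s3 (pcf_den Ifzero)) [ev s3 ?\<Gamma>3 (Var 1 $$ Var 0), ev s3 ?\<Gamma>3 (Var 0), ev s3 ?\<Gamma>3 L]"
      unfolding body_def using tL by (simp add: appN_ev_Ap ev_Con del: appN_Lam pcf_den.simps)
    also have "\<dots> = bind (appN (ev s3 ?\<Gamma>3 (Var 1 $$ Var 0)) []) (\<lambda>i. if i = 0 then appN (ev s3 ?\<Gamma>3 (Var 0)) [] else appN (ev s3 ?\<Gamma>3 L) [])"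
      by (rule appN_Ifzero) (use tL tN in \<open>auto intro: has_arity_ev\<close>)
    finally show ?thesis unfolding N v(1) L by (simp add: if_distrib cong: if_cong) (rule arg_cong[where f="bind _"], auto)
  qed
  define F where "F n = ((\<lambda>f. etaN ?\<phi> (etaN ?\<phi> (etaN ?\<phi> (etaN ?\<phi> f)))) ^^ n) (etaN ?\<phi> f)" for n
  have F: "RED ?\<phi> (F n)" for n
    by (induction n) (auto simp: F_def intro!: RED_etaN RED simp del: RED.simps)
  have FS: "F (Suc n) = etaN ?\<phi> (etaN ?\<phi> (etaN ?\<phi> (etaN ?\<phi> (F n))))" for n
    by (simp add: F_def)
  have main: "good (appN (fixp min_ty h) [F 0, num j])" for j
  proof -
    have "good (appN (fixp min_ty h) [F 0, num (j + 0)])"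
    proof (rule good_tail[where e="\<lambda>n. appN (fixp min_ty h) [F n, num (j + n)]"
          and en="\<lambda>m n. appN (fixn m min_ty h) [F n, num (j + n)]" and B="\<lambda>i. i \<noteq> 0"
          and a="\<lambda>n. appN (etaN ?\<phi> (etaN ?\<phi> (F n)) \<cdot> num (j + n)) []" and g="\<lambda>n i. Num (j + n)"], goal_cases)
      case (1 n)
      show ?case by (subst appN_fixp[OF h]) (simp_all add: step has_arity_fix has_arity_etaN FS del: appN_Lam cong: if_cong)
    next
      case (2 n)
      show ?case by (subst appN_fixn(1)[OF h]) simp_all
    next
      case (3 m n)
      show ?case by (subst appN_fixn(2)[OF h]) (simp_all add: step has_arity_fix has_arity_etaN FS del: appN_Lam cong: if_cong)
    next
      case (4 n)
      then show ?case by (intro fixp_continuous) simp_all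
    next
      case (5 n)
      show ?case by (intro RED_val RED_dot[of TN] RED_etaN F RED_num)
    qed simp
    then show ?thesis by simp
  qed
  have P: "prog Min = Con (Byval [?\<phi>] TN) $$ (Con (Y min_ty) $$ Ht)"
    by (simp add: Ht_def body_def L_def)
  have "appN (ev s \<Gamma> (prog Min)) qs = appN (sbP s (pcf_den (Byval [?\<phi>] TN))) (fixp min_ty h # [f] @ n # [])"
    unfolding P using tH by (simp add: qs appN_ev_Ap ev_Con ev_Y h_def del: appN_Lam pcf_den.simps)
  also have "\<dots> = bind (appN n []) (\<lambda>k. appN (fixp min_ty h) (etasN [?\<phi>] [f] @ num k # etasN (args TN) []))"
    by (rule appN_Byval) (use RED has_arity_fix[of min_ty] in \<open>auto intro: RED_arity simp del: RED.simps\<close>)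
  also have "good \<dots>"
    by (intro good_bind RED_val RED) (use main in \<open>simp add: F_def del: appN_Lam\<close>)
  finally show "good (appN (ev s \<Gamma> (prog Min)) qs)" .
qed

text \<open>The fundamental lemma of the reducibility method. The bound on the constants keeps a
  free-standing \<open>Y\<close> out; fixed points enter only through the programs for
  \<open>Rec\<close>, \<open>Min\<close> and \<open>While\<close>.\<close>

lemma RED_den:
  assumes "ty_of const_ty \<Gamma> M = Some \<tau>" "set_tm M \<subseteq> lang_Tmin \<union> lang_W" "RED_subst \<Gamma> s"
  shows "RED \<tau> (ev s \<Gamma> (translate M))"
  using assms
proof (induction M arbitrary: \<Gamma> \<tau> s)
  case (Var x)
  then show ?case by (auto simp: RED_subst_def ev_Var RED_etaN split: if_splits)
next
  case (Abs \<sigma> M)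
  then obtain \<tau>' where t: "\<tau> = (\<sigma> \<Rrightarrow> \<tau>')" "ty_of const_ty (\<sigma> # \<Gamma>) M = Some \<tau>'" by auto
  then have "has_arity \<tau> (ev s \<Gamma> (translate (Abs \<sigma> M)))"
    using ty_of_translate[of \<Gamma> "Abs \<sigma> M"] has_arity_ev Abs.prems(1) by blast
  then show ?case using Abs.IH[OF t(2) _ RED_subst_ext[OF Abs.prems(3)]] Abs.prems(2)
    by (simp add: t(1) ev_Abs_dot)
next
  case (Ap M L)
  then obtain \<sigma> where t: "ty_of const_ty \<Gamma> M = Some (\<sigma> \<Rrightarrow> \<tau>)" "ty_of const_ty \<Gamma> L = Some \<sigma>"
    by (auto split: if_splits option.splits ty.splits)
  have "RED (\<sigma> \<Rrightarrow> \<tau>) (ev s \<Gamma> (translate M))" "RED \<sigma> (ev s \<Gamma> (translate L))"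
    using Ap.IH(1)[OF t(1) _ Ap.prems(3)] Ap.IH(2)[OF t(2) _ Ap.prems(3)] Ap.prems(2) by (auto simp del: RED.simps)
  then show ?case using ev_Ap[OF ty_of_translate[OF t(1)]] by simp
next
  case (Con c)
  have pcf: "ev s \<Gamma> (prog (PCF d)) = sbP s (pcf_den d)" for d by (simp add: ev_def)
  from Con.prems show ?case
    using RED_Numeral RED_Succ RED_Pre RED_Ifzero RED_While RED_Rec RED_Min
    by (auto simp: lang_Tmin_def lang_W_def lang_B_def pcf simp del: prog.simps RED.simps pcf_den.simps)
qed

section \<open>Decision trees\<close>

text \<open>\<open>Ask n d\<close> queries the argument at \<open>n\<close>; \<open>RetV\<close> and \<open>IfV\<close> refer to the most recent answer.\<close>

datatype dt = Ret nat | RetV | IfV nat dt dt | Ask nat dt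

text \<open>\<open>g\<close> is the index of the type-1 variable that is asked, \<open>v\<close> the
  latest answer. Comparisons are resolved while the tree is built, so only queries leave a
  \<open>Case\<close>.\<close>

primrec dt_exp :: "dt \<Rightarrow> nat \<Rightarrow> nat \<Rightarrow> nsp_exp" where
  "dt_exp (Ret n) g v = Num n"
| "dt_exp RetV g v = Num v"
| "dt_exp (IfV c A B) g v = (if v = c then dt_exp A g v else dt_exp B g v)"
| "dt_exp (Ask n d) g v = Case (App g [num n]) (\<lambda>w. dt_exp d g w)"

definition dt_proc :: "dt \<Rightarrow> nsp_proc" where
  "dt_proc d = Lam [TN \<Rrightarrow> TN] (dt_exp d 0 0)"

text \<open>Compares \<open>M\<close> with the numeral \<open>c\<close> by taking predecessors.
  Testing for zero before each of them tells 0 from 1, which \<open>Pre\<close> would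
  confuse.\<close>

primrec eq_tm :: "nat \<Rightarrow> const tm \<Rightarrow> const tm \<Rightarrow> const tm \<Rightarrow> const tm" where
  "eq_tm 0 M A B = Con (PCF Ifzero) $$ M $$ A $$ B"
| "eq_tm (Suc c) M A B = Con (PCF Ifzero) $$ M $$ B $$ eq_tm c (Con (PCF Pre) $$ M) A B"

text \<open>\<open>byval\<close> binds the answer to a query as a numeral, so that it can be
  compared repeatedly without asking again. \<open>k\<close> is the index of the functional below
  the answers bound so far.\<close>

primrec dt_tm :: "dt \<Rightarrow> nat \<Rightarrow> const tm" where
  "dt_tm (Ret n) k = Con (PCF (Numeral n))"
| "dt_tm RetV k = Var 0"
| "dt_tm (IfV c A B) k = eq_tm c (Var 0) (dt_tm A k) (dt_tm B k)"
| "dt_tm (Ask n d) k = Con (PCF (Byval [] TN)) $$ Abs TN (dt_tm d (Suc k)) $$ (Var k $$ Con (PCF (Numeral n)))"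

lemma ty_of_eq_tm:
  "ty_of const_ty \<Gamma> M = Some TN \<Longrightarrow> ty_of const_ty \<Gamma> A = Some TN \<Longrightarrow> ty_of const_ty \<Gamma> B = Some TN \<Longrightarrow>
   ty_of const_ty \<Gamma> (eq_tm c M A B) = Some TN"
  by (induction c arbitrary: M) auto

lemma ty_of_dt_tm:
  "k < length \<Gamma> \<Longrightarrow> \<Gamma> ! k = (TN \<Rrightarrow> TN) \<Longrightarrow> (\<exists>n d'. d = Ask n d') \<or> \<Gamma> ! 0 = TN \<Longrightarrow>
   ty_of const_ty \<Gamma> (dt_tm d k) = Some TN"
proof (induction d arbitrary: k \<Gamma>)
  case (IfV c A B)
  then show ?case by (cases \<Gamma>) (auto intro!: ty_of_eq_tm)
next
  case RetV
  then show ?case by (cases \<Gamma>) auto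
qed auto

lemma set_eq_tm: "set_tm M \<subseteq> lang_T0str \<Longrightarrow> set_tm A \<subseteq> lang_T0str \<Longrightarrow> set_tm B \<subseteq> lang_T0str \<Longrightarrow>
   set_tm (eq_tm c M A B) \<subseteq> lang_T0str"
  by (induction c arbitrary: M) (auto simp: lang_T0str_def lang_B_def)

lemma set_dt_tm: "set_tm (dt_tm d k) \<subseteq> lang_T0str"
proof (induction d arbitrary: k)
  case (IfV c A B)
  then show ?case unfolding dt_tm.simps by (intro set_eq_tm) auto
qed (auto simp: lang_T0str_def lang_B_def)

lemma appN_ev_eq_tm:
  assumes "ty_of const_ty \<Gamma> M = Some TN" "ty_of const_ty \<Gamma> A = Some TN" "ty_of const_ty \<Gamma> B = Some TN"
    "appN (ev s \<Gamma> (translate M)) [] = Num v"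
  shows "appN (ev s \<Gamma> (translate (eq_tm c M A B))) [] =
    (if v = c then appN (ev s \<Gamma> (translate A)) [] else appN (ev s \<Gamma> (translate B)) [])"
  using assms(1,4)
proof (induction c arbitrary: M v)
  case 0
  have "appN (ev s \<Gamma> (translate (eq_tm 0 M A B))) [] = appN (sbP s (pcf_den Ifzero)) [ev s \<Gamma> (translate M), ev s \<Gamma> (translate A), ev s \<Gamma> (translate B)]"
    using ty_of_translate[OF 0(1)] ty_of_translate[OF assms(2)] ty_of_translate[OF assms(3)]
    by (simp add: appN_ev_Ap ev_Con del: appN_Lam pcf_den.simps)
  also have "\<dots> = bind (appN (ev s \<Gamma> (translate M)) []) (\<lambda>i. if i = 0 then appN (ev s \<Gamma> (translate A)) [] else appN (ev s \<Gamma> (translate B)) [])"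
    using ty_of_translate[OF 0(1)] ty_of_translate[OF assms(2)] ty_of_translate[OF assms(3)]
    by (intro appN_Ifzero has_arity_ev)
  finally show ?case by (simp add: 0)
next
  case (Suc c)
  let ?P = "Con (PCF Pre) $$ M"
  have tP: "ty_of const_ty \<Gamma> ?P = Some TN" using Suc.prems(1) by simp
  have tE: "ty_of const_ty \<Gamma> (eq_tm c ?P A B) = Some TN" by (intro ty_of_eq_tm tP assms)
  have P: "appN (ev s \<Gamma> (translate ?P)) [] = Num (v - 1)"
    using ty_of_translate[OF Suc.prems(1)] Suc.prems(2)
    by (simp add: appN_ev_Ap ev_Con appN_Pre has_arity_ev del: appN_Lam pcf_den.simps)
  have "appN (ev s \<Gamma> (translate (eq_tm (Suc c) M A B))) [] = appN (sbP s (pcf_den Ifzero)) [ev s \<Gamma> (translate M), ev s \<Gamma> (translate B), ev s \<Gamma> (translate (eq_tm c ?P A B))]"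
    using ty_of_translate[OF Suc.prems(1)] ty_of_translate[OF assms(3)] ty_of_translate[OF tE]
    by (simp add: appN_ev_Ap ev_Con del: appN_Lam pcf_den.simps)
  also have "\<dots> = bind (appN (ev s \<Gamma> (translate M)) []) (\<lambda>i. if i = 0 then appN (ev s \<Gamma> (translate B)) [] else appN (ev s \<Gamma> (translate (eq_tm c ?P A B))) [])"
    using ty_of_translate[OF Suc.prems(1)] ty_of_translate[OF assms(3)] ty_of_translate[OF tE]
    by (intro appN_Ifzero has_arity_ev)
  finally show ?case using Suc.IH[OF tP P] by (auto simp: Suc.prems(2) simp del: appN_Lam)
qed

lemma appN_ev_dt_tm:
  "k < length \<Gamma> \<Longrightarrow> \<Gamma> ! k = (TN \<Rrightarrow> TN) \<Longrightarrow> s k = Inl g \<Longrightarrow>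
   (\<exists>n d'. d = Ask n d') \<or> (\<Gamma> ! 0 = TN \<and> s 0 = Inr (embP (num v))) \<Longrightarrow>
   appN (ev s \<Gamma> (translate (dt_tm d k))) [] = dt_exp d g v"
proof (induction d arbitrary: k \<Gamma> s v)
  case (Ret n)
  then show ?case by (simp add: ev_Con del: appN_Lam)
next
  case RetV
  then have "ev s \<Gamma> (Var 0) = num v" using ev_Var[where s=s and x=0 and q="num v" and \<Gamma>=\<Gamma>] by simp
  then show ?case by simp
next
  case (IfV c A B)
  then have "ev s \<Gamma> (Var 0) = num v" using ev_Var[where s=s and x=0 and q="num v" and \<Gamma>=\<Gamma>] by simp
  moreover have "ty_of const_ty \<Gamma> (Var 0) = Some TN" using IfV.prems by (cases \<Gamma>) auto
  moreover have "ty_of const_ty \<Gamma> (dt_tm A k) = Some TN" "ty_of const_ty \<Gamma> (dt_tm B k) = Some TN"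
    using IfV.prems by (auto intro!: ty_of_dt_tm)
  ultimately have "appN (ev s \<Gamma> (translate (eq_tm c (Var 0) (dt_tm A k) (dt_tm B k)))) [] =
    (if v = c then appN (ev s \<Gamma> (translate (dt_tm A k))) [] else appN (ev s \<Gamma> (translate (dt_tm B k))) [])"
    by (intro appN_ev_eq_tm) simp_all
  then show ?case using IfV by (simp del: appN_Lam)
next
  case (Ask n d)
  let ?M = "translate (dt_tm d (Suc k))" let ?L = "Var k $$ Con (Numeral n)"
  have tM: "ty_of pcf_ty (TN # \<Gamma>) ?M = Some TN"
    using Ask.prems by (intro ty_of_translate ty_of_dt_tm) auto
  have tL: "ty_of pcf_ty \<Gamma> ?L = Some TN" using Ask.prems by simp
  have "appN (ev s \<Gamma> ?L) [] = appN (ev s \<Gamma> (Var k)) [num n]"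
    using Ask.prems by (simp add: appN_ev_Ap ev_Con del: appN_Lam)
  also have "ev s \<Gamma> (Var k) = eta (TN \<Rrightarrow> TN) g"
    using Ask.prems by (simp add: ev_def sb_eta_Inl)
  also have "appN (eta (TN \<Rrightarrow> TN) g) [num n] = Case (App g [num n]) Num"
    by (subst appN_eta) simp_all
  finally have L: "appN (ev s \<Gamma> ?L) [] = Case (App g [num n]) Num" .
  have M: "appN (ev s \<Gamma> (Abs TN ?M)) [num i] = dt_exp d g i" for i
    using Ask.prems tM by (subst appN_ev_Abs) (auto intro!: Ask.IH)
  have "appN (ev s \<Gamma> (translate (dt_tm (Ask n d) k))) [] = appN (sbP s (pcf_den (Byval [] TN))) (ev s \<Gamma> (Abs TN ?M) # [] @ ev s \<Gamma> ?L # [])"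
    using tM tL by (simp add: appN_ev_Ap ev_Con del: appN_Lam pcf_den.simps)
  also have "\<dots> = bind (appN (ev s \<Gamma> ?L) []) (\<lambda>i. appN (ev s \<Gamma> (Abs TN ?M)) (etasN [] [] @ num i # etasN (args TN) []))"
    by (rule appN_Byval) (use tM tL in \<open>auto intro!: has_arity_ev\<close>)
  finally show ?case unfolding L using M by (simp del: appN_Lam)
qed

text \<open>Needed to invoke the recursion equations for the adversary's trees. The query at the
  root gives \<open>RetV\<close> and \<open>IfV\<close> an answer to refer to.\<close>

lemma definable_dt_proc: "definable lang_T0str (pure_ty 2) (dt_proc (Ask n d))"
proof -
  let ?B = "dt_tm (Ask n d) 0" let ?M = "Abs (TN \<Rrightarrow> TN) ?B"
  have t: "ty_of const_ty [TN \<Rrightarrow> TN] ?B = Some TN" by (rule ty_of_dt_tm) auto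
  have "has_arity TN (ev Inl [TN \<Rrightarrow> TN] (translate ?B))"
    by (intro has_arity_ev ty_of_translate t)
  then obtain e where e: "ev Inl [TN \<Rrightarrow> TN] (translate ?B) = Lam [] e" by (auto simp: has_arity_def)
  moreover have "appN (ev Inl [TN \<Rrightarrow> TN] (translate ?B)) [] = dt_exp (Ask n d) 0 0"
    by (rule appN_ev_dt_tm) auto
  ultimately have "den [TN \<Rrightarrow> TN] (translate ?B) = Lam [] (dt_exp (Ask n d) 0 0)"
    by (simp add: ev_def del: appN_Lam)
  then have "dt_proc (Ask n d) = den [] (translate ?M)" by (simp add: dt_proc_def)
  moreover have "wt const_ty [] ?M (pure_ty 2)" using t by (simp add: wt_iff numeral_2_eq_2 del: dt_tm.simps)
  moreover have "set_tm ?M \<subseteq> lang_T0str" using set_dt_tm[of "Ask n d" 0] by simp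
  ultimately show ?thesis unfolding definable_def by blast
qed

text \<open>Relational in the answers, since a call may diverge; monotonicity in \<open>R\<close>
  admits it in the inductive definition of \<open>run\<close>.\<close>

primrec dt_run :: "dt \<Rightarrow> nat \<Rightarrow> (nat \<Rightarrow> nat \<Rightarrow> bool) \<Rightarrow> nat \<Rightarrow> bool" where
  "dt_run (Ret n) v R i \<longleftrightarrow> i = n"
| "dt_run RetV v R i \<longleftrightarrow> i = v"
| "dt_run (IfV c A B) v R i \<longleftrightarrow> (if v = c then dt_run A v R i else dt_run B v R i)"
| "dt_run (Ask n d) v R i \<longleftrightarrow> (\<exists>w. R n w \<and> dt_run d w R i)"

lemma dt_run_mono [mono]: "(\<And>n w. R n w \<longrightarrow> R' n w) \<Longrightarrow> dt_run d v R i \<longrightarrow> dt_run d v R' i"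
  by (induction d arbitrary: v) auto

lemma dt_app:
  assumes "has_arity (TN \<Rrightarrow> TN) p" "dt_run d v (\<lambda>n w. p \<cdot> num n = num w) i"
  shows "sbE (inst [embP p]) (dt_exp d 0 v) = Num i"
  using assms(2)
proof (induction d arbitrary: v)
  case (Ask n d)
  then obtain w where w: "p \<cdot> num n = num w" "sbE (inst [embP p]) (dt_exp d 0 w) = Num i" by auto
  have "appN p [num n] = appN (p \<cdot> num n) []" using assms(1) by (subst appN_dot') auto
  then have p: "appN p [num n] = Num w" by (simp add: w(1) del: appN_Lam)
  have "inst [embP p] 0 = Inr (embP p)" by (simp add: inst_def)
  then have "sbE (inst [embP p]) (Case (App 0 [num n]) (dt_exp d 0)) = bind (appN p (map (sbP (inst [embP p])) [num n])) (\<lambda>i. sbE (inst [embP p]) (dt_exp d 0 i))"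
    using assms(1) by (rule sbE_call) simp
  then show ?case by (simp add: p w(2) del: appN_Lam)
qed auto

lemma up_subst_0: "up_subst 0 s = s"
  by (auto simp: up_subst_def fun_eq_iff ren_eq_subst split: sum.splits)

lemma dt_proc_dot:
  "has_arity (TN \<Rrightarrow> TN) p \<Longrightarrow> dt_run d 0 (\<lambda>n w. p \<cdot> num n = num w) i \<Longrightarrow> dt_proc d \<cdot> p = num i"
  unfolding dt_proc_def by (subst dot_Lam) (simp add: dt_app up_subst_0)

section \<open>Running a procedure against decision trees\<close>

inductive run :: "(nat \<Rightarrow> dt) \<Rightarrow> nsp_exp \<Rightarrow> nat \<Rightarrow> bool" for D where
  run_Num: "run D (Num v) v"
| run_Case: "dt_run (D x) 0 (\<lambda>n w. run D (appN q [num n]) w) i \<Longrightarrow> run D (K i) v \<Longrightarrow> run D (Case (App x [q]) K) v"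

text \<open>The run splits at the moment at which \<open>C\<close> becomes a numeral; a query of
  \<open>C\<close> would survive in the head normal form of the whole.\<close>

lemma relpow_MCase_MNum:
  assumes "(hredE ^^ k) (MCase (MExp C) K) (MNum i)"
  shows "\<exists>j k1 k2. k1 + k2 < k \<and> (hredE ^^ k1) C (MNum j) \<and> (hredE ^^ k2) (K j) (MNum i)"
proof -
  have v: "is_val (MNum i)" by (simp add: is_val_def)
  from extends_conv_case[OF assms v] obtain k' H where H: "k' < k" "(hredE ^^ k') C H" "is_val H" by blast
  from H(3) consider j where "H = MNum j" | x Qs F where "H = MCase (MVar x Qs) F" by (auto simp: is_val_def)
  then show ?thesis
  proof cases
    case (1 j)
    from extends_num[OF extends_base, of k' C j K] H(2) 1 obtain m where m: "m > k'" "(hredE ^^ m) (MCase (MExp C) K) (K j)"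
      by blast
    from relpow_val[OF assms v m(2)] m show ?thesis
      using H 1 by (intro exI[of _ j] exI[of _ k'] exI[of _ "k - m"]) auto
  next
    case (2 x Qs F)
    from extends_case_red[OF extends_base, of k' C "MVar x Qs" F K] H(2) 2 obtain m L where
      "(hredE ^^ m) (MCase (MExp C) K) (MCase (MVar x Qs) L)" by blast
    then show ?thesis using hnf_unique[of "MCase (MExp C) K" "MNum i" "MCase (MVar x Qs) L"] assms
      by (auto dest: relpowp_imp_rtranclp)
  qed
qed

lemma num_relpow: "(hredE ^^ k) (MNum i) (MNum j) \<Longrightarrow> i = j"
  by (cases k) (auto simp del: relpowp.simps(2) dest: relpowp_Suc_D2)

text \<open>\<open>E\<close> is brought to head normal form before substituting; its head variable
  \<open>x\<close> then starts the tree \<open>D x\<close>, and every answer and the continuation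
  are computed in fewer steps. The inner induction follows the tree.\<close>

lemma run_complete:
  assumes "(hredE ^^ k) (substE (\<lambda>x. Inr (embP (dt_proc (D x)))) E) (MNum v)"
  shows "run D (nfE E) v"
  using assms
proof (induction k arbitrary: E v rule: less_induct)
  case (less k)
  let ?s = "\<lambda>x. Inr (embP (dt_proc (D x))) :: nat + mproc"
  have val: "is_val (MNum v)" by (simp add: is_val_def)
  from subst_relpow_hnf[OF less.prems val] obtain k' H where H: "k' \<le> k" "(hredE ^^ k') E H" "is_val H" by blast
  have H': "(hredE ^^ (k - k')) (substE ?s H) (MNum v)"
    using relpow_val[OF less.prems val relpow_subst[OF H(2)]] by simp
  have E: "nfE E = nfE H" by (rule nf_red[OF relpowp_imp_rtranclp[OF H(2)]])
  from H(3) consider n where "H = MNum n" | x Qs F where "H = MCase (MVar x Qs) F" by (auto simp: is_val_def)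
  then show ?case
  proof cases
    case (1 n)
    then have "n = v" using H' num_relpow by simp
    then show ?thesis by (simp add: E 1 run_Num)
  next
    case (2 x Qs F)
    let ?Qs = "map (substP ?s) Qs" and ?F = "\<lambda>i. substE ?s (F i)"
    have T: "(hredE ^^ (k - k')) (MCase (MApp (embP (dt_proc (D x))) ?Qs) ?F) (MNum v)"
      using H' by (simp add: 2)
    then obtain l where l: "k - k' = Suc l" by (cases "k - k'") auto
    with T obtain T1 where T1: "hredE (MCase (MApp (embP (dt_proc (D x))) ?Qs) ?F) T1" "(hredE ^^ l) T1 (MNum v)"
      by (metis relpowp_Suc_D2)
    then obtain Q where Q: "Qs = [Q]" and T1': "T1 = MCase (MExp (substE (inst [substP ?s Q]) (embE (dt_exp (D x) 0 0)))) ?F"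
      by (auto simp: dt_proc_def length_Suc_conv)
    from relpow_MCase_MNum[OF T1(2)[unfolded T1']] obtain j k1 k2 where
      j: "k1 + k2 < l" "(hredE ^^ k1) (substE (inst [substP ?s Q]) (embE (dt_exp (D x) 0 0))) (MNum j)"
        "(hredE ^^ k2) (?F j) (MNum v)" by blast
    have "dt_run d w (\<lambda>n u. run D (appN (nfP Q) [num n]) u) j"
      if "(hredE ^^ m) (substE (inst [substP ?s Q]) (embE (dt_exp d 0 w))) (MNum j)" "m < k" for d w m
      using that
    proof (induction d arbitrary: w m)
      case (Ask n d)
      obtain \<sigma>s B where B: "Q = MLam \<sigma>s B" by (cases Q)
      let ?K = "\<lambda>u. substE (inst [substP ?s Q]) (embE (dt_exp d 0 u))"
      have S: "(hredE ^^ m) (MCase (MApp (substP ?s Q) [embP (num n)]) ?K) (MNum j)"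
      proof -
        have "inst [substP ?s Q] 0 = Inr (substP ?s Q)" by (simp add: inst_def)
        then show ?thesis using Ask.prems(1) by simp
      qed
      then obtain m' where m': "m = Suc m'" by (cases m) auto
      with S obtain S1 where S1: "hredE (MCase (MApp (substP ?s Q) [embP (num n)]) ?K) S1" "(hredE ^^ m') S1 (MNum j)"
        by (metis relpowp_Suc_D2)
      then have len: "length \<sigma>s = 1" and S1': "S1 = MCase (MExp (substE (inst [embP (num n)]) (substE (up_subst 1 ?s) B))) ?K"
        by (auto simp: B)
      \<comment> \<open>Numerals are closed, so the call of \<open>Q\<close> at \<open>n\<close> is
        again an instance under \<open>?s\<close> and falls under the outer induction
        hypothesis.\<close>
      have "substE (inst [embP (num n)]) (substE (up_subst 1 ?s) B) = substE ?s (substE (inst [embP (num n)]) B)"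
        by (subst subst_inst[of _ 1]) simp_all
      with relpow_MCase_MNum[OF S1(2)[unfolded S1']] obtain u l1 l2 where
        u: "l1 + l2 < m'" "(hredE ^^ l1) (substE ?s (substE (inst [embP (num n)]) B)) (MNum u)" "(hredE ^^ l2) (?K u) (MNum j)"
        by auto
      have "run D (nfE (substE (inst [embP (num n)]) B)) u"
        by (rule less.IH[OF _ u(2)]) (use u(1) m' Ask.prems(2) in simp)
      moreover have "appN (nfP Q) [num n] = nfE (substE (inst [embP (num n)]) B)" by (simp add: B)
      moreover have "dt_run d u (\<lambda>n u. run D (appN (nfP Q) [num n]) u) j"
        by (rule Ask.IH[OF u(3)]) (use u(1) m' Ask.prems(2) in simp)
      ultimately show ?case by auto
    qed (auto dest: num_relpow split: if_splits)
    from this[OF j(2)] have "dt_run (D x) 0 (\<lambda>n u. run D (appN (nfP Q) [num n]) u) j"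
      using j(1) l H(1) by simp
    moreover have "run D (nfE (F j)) v"
      by (rule less.IH[OF _ j(3)]) (use j(1) l H(1) in simp)
    ultimately show ?thesis unfolding E by (simp add: 2 Q run_Case del: appN_Lam)
  qed
qed

section \<open>The adversary\<close>

text \<open>The value that the first recursion equation assigns to the leaf \<open>ys @ [0]\<close>,
  the child 0 of the node \<open>ys\<close>. It identifies that node.\<close>

definition leafcode :: "nat list \<Rightarrow> nat" where
  "leafcode ys = 2 * list_encode (ys @ [0]) + 1"

lemma le_list_encode: "x \<in> set xs \<Longrightarrow> x \<le> list_encode xs"
proof (induction xs)
  case (Cons y xs)
  have "y \<le> prod_encode (y, list_encode xs)" "list_encode xs \<le> prod_encode (y, list_encode xs)"
    by (rule le_prod_encode_1, rule le_prod_encode_2)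
  with Cons show ?case by auto
qed simp

text \<open>Sequence codes dominate their entries. Hence an answer below a new entry
  \<open>y\<close> is not the code of any path through \<open>y\<close>, and \<open>G\<close> does
  not notice the extension.\<close>

lemma less_leafcode: "y \<in> set ys \<Longrightarrow> y < leafcode ys"
  using le_list_encode[of y "ys @ [0]"] by (simp add: leafcode_def)

text \<open>
  \<open>F_dt ys 0\<close> maps \<open>g\<close> to \<open>g k\<close>, where \<open>k\<close> is the length of the longest common prefix of \<open>g\<close> and \<open>ys\<close>.
\<close>

primrec F_dt :: "nat list \<Rightarrow> nat \<Rightarrow> dt" where
  "F_dt [] k = Ask k RetV"
| "F_dt (y # ys) k = Ask k (IfV y (F_dt ys (Suc k)) RetV)"

text \<open>
  \<open>G_dt\<close> recognises a node on the path \<open>ys\<close> by the value of its child \<open>0\<close>, which is a leaf. It then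
  queries the child on the path; if \<open>b\<close> holds, it passes on the value \<open>leafcode ys\<close>.
\<close>

primrec G_body :: "bool \<Rightarrow> nat \<Rightarrow> nat list \<Rightarrow> nat list \<Rightarrow> dt" where
  "G_body b r us [] = IfV (leafcode us) (Ret (if b then r else 0)) (Ret 0)"
| "G_body b r us (y # ys) = IfV (leafcode us) (Ask y (if b then IfV r (Ret r) (Ret 0) else Ret 0)) (G_body b r (us @ [y]) ys)"

definition G_dt :: "bool \<Rightarrow> nat list \<Rightarrow> dt" where
  "G_dt b ys = Ask 0 (G_body b (leafcode ys) [] ys)"

definition FG :: "bool \<Rightarrow> nat list \<Rightarrow> nat \<Rightarrow> dt" where
  "FG b ys x = (if x = 0 then G_dt b ys else F_dt ys 0)"

section \<open>The well-founded order of calls\<close>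

definition callee :: "(nsp_exp \<times> nsp_exp) set" where
  "callee = {(e', e). good e \<and> (\<exists>k x q n. reach k e x [q] \<and> e' = appN q [num n])}"

lemma callee_good: "(e', e) \<in> callee \<Longrightarrow> good e'"
proof -
  assume "(e', e) \<in> callee"
  then obtain k x q n where e: "good e" "reach k e x [q]" "e' = appN q [num n]" by (auto simp: callee_def)
  then have "good_args [q]" using good_iff[of e] by blast
  then show "good e'" unfolding good_args_def e(3) by blast
qed

lemma wf_callee: "wf callee"
proof -
  have acc: "e \<in> Wellfounded.acc callee" if "good e" for e
    using that
  proof (induction rule: good.induct)
    case (goodI e)
    show ?case
    proof (rule accI)
      fix e' assume "(e', e) \<in> callee"
      then obtain k x q n where "reach k e x [q]" "e' = appN q [num n]" by (auto simp: callee_def)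
      with goodI[of k x "[q]"] show "e' \<in> Wellfounded.acc callee" by auto
    qed
  qed
  have "e \<in> Wellfounded.acc callee" for e
    by (rule accI) (use acc callee_good in blast)
  then show ?thesis by (simp add: wf_iff_acc)
qed

lemma callee_branch: "(d, K i) \<in> callee\<^sup>+ \<Longrightarrow> good (Case a K) \<Longrightarrow> (d, Case a K) \<in> callee\<^sup>+"
proof -
  assume d: "(d, K i) \<in> callee\<^sup>+" and g: "good (Case a K)"
  have *: "(z, Case a K) \<in> callee" if "(z, K i) \<in> callee" for z
    using that g unfolding callee_def by (blast intro: reach_branch)
  from d show ?thesis
  proof (cases rule: tranclE)
    case base
    then show ?thesis using * by blast
  next
    case (step z)
    then show ?thesis using * by (meson trancl.trancl_into_trancl)
  qed
qed

text \<open>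
  \<open>stable ys A a C\<close>: extending the path \<open>ys\<close> by a fresh entry \<open>y\<close> leaves the outcome \<open>a\<close> of the
  computation \<open>A\<close> unchanged, provided that none of the procedures in \<open>C\<close>, all of which get called
  at \<open>y\<close>, returns the new value \<open>leafcode (ys @ y # zs)\<close>.
\<close>

definition stable :: "nat list \<Rightarrow> (bool \<Rightarrow> nat \<Rightarrow> nat list \<Rightarrow> nat \<Rightarrow> bool) \<Rightarrow> nat \<Rightarrow> nsp_proc set \<Rightarrow> bool" where
  "stable ys A a C \<longleftrightarrow> (\<exists>M. \<forall>y > M. \<forall>zs b a'. A b y zs a' \<longrightarrow>
     (b \<longrightarrow> (\<forall>q \<in> C. \<not> run (FG b (ys @ y # zs)) (appN q [num y]) (leafcode (ys @ y # zs)))) \<longrightarrow>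
     a' = a \<and> (\<forall>q \<in> C. \<exists>w. run (FG b (ys @ y # zs)) (appN q [num y]) w))"

text \<open>For a computation in two stages the sets of new calls are united and the bounds joined,
  together with the intermediate outcome \<open>a\<close>: a fresh \<open>y > a\<close> cannot be
  confused with that answer.\<close>

lemma stable_seq:
  assumes A: "stable ys A a C" and B: "stable ys B i C'"
    and step: "\<And>b y zs i'. y > a \<Longrightarrow> A' b y zs i' \<Longrightarrow> \<exists>a'. A b y zs a' \<and> (a' = a \<longrightarrow> B b y zs i')"
  shows "stable ys A' i (C \<union> C')"
proof -
  let ?Q = "\<lambda>C b y zs. b \<longrightarrow> (\<forall>q \<in> C. \<not> run (FG b (ys @ y # zs)) (appN q [num y]) (leafcode (ys @ y # zs)))"
  let ?R = "\<lambda>C b y zs. \<forall>q \<in> C. \<exists>w. run (FG b (ys @ y # zs)) (appN q [num y]) w"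
  from A obtain M where M: "\<And>y zs b a'. y > M \<Longrightarrow> A b y zs a' \<Longrightarrow> ?Q C b y zs \<Longrightarrow> a' = a \<and> ?R C b y zs"
    unfolding stable_def by blast
  from B obtain M' where M': "\<And>y zs b a'. y > M' \<Longrightarrow> B b y zs a' \<Longrightarrow> ?Q C' b y zs \<Longrightarrow> a' = i \<and> ?R C' b y zs"
    unfolding stable_def by blast
  have "i' = i \<and> ?R (C \<union> C') b y zs" if y: "y > max a (max M M')" and i': "A' b y zs i'" and Q: "?Q (C \<union> C') b y zs" for y zs b i'
  proof -
    from step[OF _ i'] y obtain a' where a': "A b y zs a'" "a' = a \<longrightarrow> B b y zs i'" by auto
    from M[OF _ a'(1)] y Q have 1: "a' = a" "?R C b y zs" by auto
    from M'[of y b zs i'] a'(2) 1(1) y Q have "i' = i" "?R C' b y zs" by auto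
    with 1 show ?thesis by blast
  qed
  then show ?thesis unfolding stable_def by blast
qed

lemma stable_const: "(\<And>b y zs a'. y > M \<Longrightarrow> A b y zs a' \<Longrightarrow> a' = a) \<Longrightarrow> stable ys A a {}"
  unfolding stable_def by (intro exI[of _ M]) simp

text \<open>With \<open>y\<close> on the part already passed, all codes still to be tested exceed
  \<open>v\<close>, so the tree falls through to its default 0.\<close>

lemma G_body_fresh: "v < y \<Longrightarrow> y \<in> set us \<Longrightarrow> dt_run (G_body b r us zs) v R i \<Longrightarrow> i = 0"
proof (induction zs arbitrary: us)
  case Nil
  then show ?case using less_leafcode[of y us] by auto
next
  case (Cons z zs)
  then show ?case using less_leafcode[of y us] Cons.IH[of "us @ [z]"] by (auto split: if_splits)
qed

text \<open>The calls lie below \<open>e\<close> for every numeral \<open>n\<close>, because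
  \<open>y\<close> is chosen only after the set \<open>C\<close>. Finiteness lets them be gathered
  in a multiset.\<close>

definition stable_calls :: "nat list \<Rightarrow> nsp_exp \<Rightarrow> (bool \<Rightarrow> nat \<Rightarrow> nat list \<Rightarrow> nat \<Rightarrow> bool) \<Rightarrow> nat \<Rightarrow> bool" where
  "stable_calls ys e A a \<longleftrightarrow> (\<exists>C. finite C \<and> (\<forall>q \<in> C. \<forall>n. (appN q [num n], e) \<in> callee\<^sup>+) \<and> stable ys A a C)"

lemma stable_calls_seq:
  assumes "stable_calls ys e A a" "stable_calls ys e B i"
    and "\<And>b y zs i'. y > a \<Longrightarrow> A' b y zs i' \<Longrightarrow> \<exists>a'. A b y zs a' \<and> (a' = a \<longrightarrow> B b y zs i')"
  shows "stable_calls ys e A' i"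
proof -
  from assms(1) obtain C where C: "finite C" "\<forall>q \<in> C. \<forall>n. (appN q [num n], e) \<in> callee\<^sup>+" "stable ys A a C"
    unfolding stable_calls_def by blast
  from assms(2) obtain C' where C': "finite C'" "\<forall>q \<in> C'. \<forall>n. (appN q [num n], e) \<in> callee\<^sup>+" "stable ys B i C'"
    unfolding stable_calls_def by blast
  from stable_seq[OF C(3) C'(3) assms(3)] C C' show ?thesis
    unfolding stable_calls_def by (intro exI[of _ "C \<union> C'"]) auto
qed

lemma stable_calls_const: "(\<And>b y zs a'. y > M \<Longrightarrow> A b y zs a' \<Longrightarrow> a' = a) \<Longrightarrow> stable_calls ys e A a"
  unfolding stable_calls_def by (intro exI[of _ "{}"]) (simp add: stable_const[of M])

lemma stable_calls_mono:
  "stable_calls ys e A a \<Longrightarrow> (\<And>d. (d, e) \<in> callee\<^sup>+ \<Longrightarrow> (d, e') \<in> callee\<^sup>+) \<Longrightarrow> stable_calls ys e' A a"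
  unfolding stable_calls_def by blast

text \<open>While the answers follow the old path nothing changes. Where the old tree ends, the new
  one compares the answer with \<open>y\<close>; as \<open>y\<close> exceeds it, the answer is
  returned as before.\<close>

lemma F_dt_stable:
  assumes "dt_run (F_dt us k) v (\<lambda>n w. stable_calls ys e (\<lambda>b y zs. R b y zs n) w) i"
  shows "stable_calls ys e (\<lambda>b y zs. dt_run (F_dt (us @ y # zs) k) v (R b y zs)) i"
  using assms
proof (induction us arbitrary: k v)
  case Nil
  then have "stable_calls ys e (\<lambda>b y zs. R b y zs k) i" by auto
  then show ?case
    by (rule stable_calls_seq[where B="\<lambda>b y zs i'. i' = i"]) (auto intro: stable_calls_const[of 0] split: if_splits)
next
  case (Cons u us)
  then obtain w where w: "stable_calls ys e (\<lambda>b y zs. R b y zs k) w"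
    "dt_run (IfV u (F_dt us (Suc k)) RetV) w (\<lambda>n w. stable_calls ys e (\<lambda>b y zs. R b y zs n) w) i" by auto
  show ?case
  proof (cases "w = u")
    case True
    with w(2) Cons.IH[of "Suc k" w] have "stable_calls ys e (\<lambda>b y zs. dt_run (F_dt (us @ y # zs) (Suc k)) w (R b y zs)) i" by simp
    with w(1) show ?thesis by (rule stable_calls_seq) (auto simp: True)
  next
    case False
    with w(2) have "i = w" by simp
    from w(1) show ?thesis
      by (rule stable_calls_seq[where B="\<lambda>b y zs i'. i' = i"]) (auto intro: stable_calls_const[of 0] simp: False \<open>i = w\<close>)
  qed
qed

text \<open>On an inner node the answer of the next node is below the new code, so \<open>G\<close>
  returns 0 for either flag. A value that matches no old node matches no new one, by
  \<open>G_body_fresh\<close>. At the old end \<open>q\<close> is now called at \<open>y\<close>,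
  but stability assumes that it does not return the new code, so the outcome is 0 again.\<close>

lemma G_body_stable:
  assumes "dt_run (G_body False r us vs) v (\<lambda>n w. stable_calls ys e (\<lambda>b y zs. run (FG b (ys @ y # zs)) (appN q [num n])) w) i"
    and "us @ vs = ys" and e: "\<And>n. (appN q [num n], e) \<in> callee\<^sup>+"
  shows "stable_calls ys e (\<lambda>b y zs. dt_run (G_body b (leafcode (ys @ y # zs)) us (vs @ y # zs)) v
     (\<lambda>n. run (FG b (ys @ y # zs)) (appN q [num n]))) i"
  using assms(1,2)
proof (induction vs arbitrary: us)
  case Nil
  then have i: "i = 0" and us: "us = ys" by (auto split: if_splits)
  show ?case
  proof (cases "v = leafcode ys")
    case True
    \<comment> \<open>The one place where a new call enters \<open>C\<close>: the old end of the
      path has become an inner node.\<close>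
    have "stable ys (\<lambda>b y zs. dt_run (G_body b (leafcode (ys @ y # zs)) us ([] @ y # zs)) v
     (\<lambda>n. run (FG b (ys @ y # zs)) (appN q [num n]))) i {q}"
      unfolding stable_def by (auto simp: us i True split: if_splits)
    then show ?thesis unfolding stable_calls_def using e by blast
  next
    case False
    show ?thesis
    proof (rule stable_calls_const[of v])
      fix b y zs a'
      assume y: "v < y" and "dt_run (G_body b (leafcode (ys @ y # zs)) us ([] @ y # zs)) v (\<lambda>n. run (FG b (ys @ y # zs)) (appN q [num n])) a'"
      then have "dt_run (G_body b (leafcode (ys @ y # zs)) (ys @ [y]) zs) v (\<lambda>n. run (FG b (ys @ y # zs)) (appN q [num n])) a'"
        using False by (simp add: us)
      from G_body_fresh[OF y _ this] show "a' = i" by (simp add: i)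
    qed
  qed
next
  case (Cons u vs)
  show ?case
  proof (cases "v = leafcode us")
    case True
    then obtain w where w: "stable_calls ys e (\<lambda>b y zs. run (FG b (ys @ y # zs)) (appN q [num u])) w" and i: "i = 0"
      using Cons.prems(1) by auto
    from w show ?thesis
    proof (rule stable_calls_seq[where B="\<lambda>b y zs i'. i' = i"])
      fix b y zs i'
      assume y: "w < y" and r: "dt_run (G_body b (leafcode (ys @ y # zs)) us ((u # vs) @ y # zs)) v (\<lambda>n. run (FG b (ys @ y # zs)) (appN q [num n])) i'"
      have "w \<noteq> leafcode (ys @ y # zs)" using y less_leafcode[of y "ys @ y # zs"] by simp
      with r show "\<exists>a'. run (FG b (ys @ y # zs)) (appN q [num u]) a' \<and> (a' = w \<longrightarrow> i' = i)"
        by (auto simp: True i split: if_splits)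
    qed (auto intro: stable_calls_const[of 0])
  next
    case False
    with Cons.prems Cons.IH[of "us @ [u]"] show ?thesis by simp
  qed
qed

text \<open>Induction on the run: the query to \<open>F\<close> or \<open>G\<close> is the first
  stage, the branch taken is the second. New calls made inside a call lie below it in the call
  order, hence below \<open>e\<close>.\<close>

lemma run_stable:
  assumes "run (FG False ys) e v" "good e"
  shows "stable_calls ys e (\<lambda>b y zs. run (FG b (ys @ y # zs)) e) v"
  using assms
proof (induction rule: run.induct)
  case (run_Num v)
  show ?case by (rule stable_calls_const) (auto elim: run.cases)
next
  case (run_Case x q i K v)
  let ?e = "Case (App x [q]) K"
  from run_Case.prems have g: "good (appN q [num n])" "good (K i)" for n i
    by (auto simp: good_Case good_args_def)
  have callee: "(appN q [num n], ?e) \<in> callee" for n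
    using run_Case.prems reach_head[of x "[q]" K] unfolding callee_def by blast
  have "stable_calls ys ?e A w" if "stable_calls ys (appN q [num n]) A w" for n w A
    by (rule stable_calls_mono[OF that]) (rule trancl_into_trancl[OF _ callee])
  then have "dt_run (FG False ys x) 0 (\<lambda>n w. stable_calls ys ?e (\<lambda>b y zs. run (FG b (ys @ y # zs)) (appN q [num n])) w) i"
    by (intro dt_run_mono[rule_format, OF _ run_Case.IH(1)]) (use g(1) in blast)
  then have 1: "stable_calls ys ?e (\<lambda>b y zs. dt_run (FG b (ys @ y # zs) x) 0 (\<lambda>n. run (FG b (ys @ y # zs)) (appN q [num n]))) i"
  proof (cases "x = 0")
    case True
    assume "dt_run (FG False ys x) 0 (\<lambda>n w. stable_calls ys ?e (\<lambda>b y zs. run (FG b (ys @ y # zs)) (appN q [num n])) w) i"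
    then obtain v0 where v0: "stable_calls ys ?e (\<lambda>b y zs. run (FG b (ys @ y # zs)) (appN q [num 0])) v0"
       "dt_run (G_body False (leafcode ys) [] ys) v0 (\<lambda>n w. stable_calls ys ?e (\<lambda>b y zs. run (FG b (ys @ y # zs)) (appN q [num n])) w) i"
      by (auto simp: True FG_def G_dt_def)
    from G_body_stable[OF v0(2)] callee have "stable_calls ys ?e (\<lambda>b y zs. dt_run (G_body b (leafcode (ys @ y # zs)) [] (ys @ y # zs)) v0
     (\<lambda>n. run (FG b (ys @ y # zs)) (appN q [num n]))) i" by (auto simp del: appN_Lam)
    with v0(1) show ?thesis
      by (rule stable_calls_seq) (auto simp: True FG_def G_dt_def simp del: appN_Lam)
  next
    case False
    assume "dt_run (FG False ys x) 0 (\<lambda>n w. stable_calls ys ?e (\<lambda>b y zs. run (FG b (ys @ y # zs)) (appN q [num n])) w) i"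
    with F_dt_stable[of ys 0 0 ys ?e "\<lambda>b y zs n. run (FG b (ys @ y # zs)) (appN q [num n])" i] False
    show ?thesis by (simp add: FG_def del: appN_Lam)
  qed
  have 2: "stable_calls ys ?e (\<lambda>b y zs. run (FG b (ys @ y # zs)) (K i)) v"
    using run_Case.IH(2)[OF g(2)] by (rule stable_calls_mono) (rule callee_branch[OF _ run_Case.prems])
  from 1 2 show ?case
  proof (rule stable_calls_seq)
    fix b y zs v' assume "run (FG b (ys @ y # zs)) ?e v'"
    then show "\<exists>a'. dt_run (FG b (ys @ y # zs) x) 0 (\<lambda>n. run (FG b (ys @ y # zs)) (appN q [num n])) a' \<and>
       (a' = i \<longrightarrow> run (FG b (ys @ y # zs)) (K i) v')"
      by cases (auto simp del: appN_Lam)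
  qed
qed

text \<open>Each extension replaces \<open>S\<close> by the calls it newly provokes, each strictly
  below an element of \<open>S\<close> in the call order, and the multiset extension of that order
  is well-founded. With no calls left the current path works, and stability carries the conclusion
  back to the earlier sets.\<close>

lemma adversary:
  assumes "finite S" "\<And>s. s \<in> S \<Longrightarrow> good s"
    and "\<And>s zs. s \<in> S \<Longrightarrow> \<forall>z \<in> set zs. 2 \<le> z \<Longrightarrow> \<exists>v. run (FG False (ys @ zs)) s v"
  shows "\<exists>zs. (\<forall>z \<in> set zs. 2 \<le> z) \<and> (\<forall>s \<in> S. \<not> run (FG True (ys @ zs)) s (leafcode (ys @ zs)))"
proof -
  have "wf (mult (callee\<^sup>+))" by (intro wf_mult wf_trancl wf_callee)
  then show ?thesis using assms
  proof (induction "mset_set S" arbitrary: S ys rule: wf_induct_rule)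
    case (less S)
    show ?case
    proof (cases "S = {}")
      case True
      then show ?thesis by (intro exI[of _ "[]"]) simp
    next
      case False
      define Q where "Q s v C M \<longleftrightarrow> finite C \<and> (\<forall>q \<in> C. \<forall>n. (appN q [num n], s) \<in> callee\<^sup>+) \<and>
        (\<forall>y > M. \<forall>zs b a'. run (FG b (ys @ y # zs)) s a' \<longrightarrow>
        (b \<longrightarrow> (\<forall>q \<in> C. \<not> run (FG b (ys @ y # zs)) (appN q [num y]) (leafcode (ys @ y # zs)))) \<longrightarrow>
        a' = v \<and> (\<forall>q \<in> C. \<exists>w. run (FG b (ys @ y # zs)) (appN q [num y]) w))" for s v C and M :: nat
      have "\<forall>s \<in> S. \<exists>v C M. Q s v C M"
      proof
        fix s assume s: "s \<in> S"
        obtain v where "run (FG False ys) s v" using less.prems(3)[OF s, of "[]"] by auto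
        from run_stable[OF this less.prems(2)[OF s]] show "\<exists>v C M. Q s v C M"
          unfolding stable_calls_def stable_def Q_def by blast
      qed
      then obtain v C M where Q: "\<And>s. s \<in> S \<Longrightarrow> Q s (v s) (C s) (M s)"
        by (auto dest!: bchoice)
      have *: "finite (C s)" "q \<in> C s \<Longrightarrow> (appN q [num n], s) \<in> callee\<^sup>+"
        "y > M s \<Longrightarrow> run (FG b (ys @ y # zs)) s a' \<Longrightarrow>
        b \<longrightarrow> (\<forall>q \<in> C s. \<not> run (FG b (ys @ y # zs)) (appN q [num y]) (leafcode (ys @ y # zs))) \<Longrightarrow>
        a' = v s \<and> (\<forall>q \<in> C s. \<exists>w. run (FG b (ys @ y # zs)) (appN q [num y]) w)" if "s \<in> S" for s q n y zs b a'
        using Q[OF that] unfolding Q_def by blast+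
      \<comment> \<open>\<open>y\<close> exceeds every bound \<open>M s\<close>, so all runs are
        stable, and every outcome \<open>v s\<close>, so none of these is the code of a path through
        \<open>y\<close>; the summand 2 keeps the entry admissible.\<close>
      define y where "y = 2 + (\<Sum>s\<in>S. M s + v s)"
      have y: "M s < y" "v s < y" if "s \<in> S" for s
        using member_le_sum[OF that, of "\<lambda>s. M s + v s"] less.prems(1) by (auto simp: y_def)
      have y2: "2 \<le> y" by (simp add: y_def)
      define S' where "S' = (\<Union>s\<in>S. (\<lambda>q. appN q [num y]) ` C s)"
      have fin: "finite S'" unfolding S'_def using less.prems(1) *(1) by blast
      have S': "\<exists>s \<in> S. (s', s) \<in> callee\<^sup>+" if "s' \<in> S'" for s'
        using that *(2) unfolding S'_def by blast
      have dec: "(mset_set S', mset_set S) \<in> mult (callee\<^sup>+)"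
        using one_step_implies_mult[of "mset_set S" "mset_set S'" "callee\<^sup>+" "{#}"] False less.prems(1) fin S'
        by (simp add: mset_set_empty_iff)
      have good': "good s'" if "s' \<in> S'" for s'
        using S'[OF that] by (auto dest: tranclD callee_good)
      \<comment> \<open>Stability for the flag \<open>False\<close>, where it puts no premise on the
        values of the calls, shows that the new calls terminate.\<close>
      have conv': "\<exists>v. run (FG False ((ys @ [y]) @ zs)) s' v" if s': "s' \<in> S'" and zs: "\<forall>z \<in> set zs. 2 \<le> z" for s' zs
      proof -
        from s' obtain s q where s: "s \<in> S" "q \<in> C s" "s' = appN q [num y]" unfolding S'_def by blast
        from less.prems(3)[OF s(1), of "y # zs"] zs y2 obtain a where "run (FG False (ys @ y # zs)) s a" by auto
        from *(3)[OF s(1) y(1)[OF s(1)] this] s(2,3) show ?thesis by auto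
      qed
      from less.hyps[OF dec fin good' conv'] obtain zs where zs: "\<forall>z \<in> set zs. 2 \<le> z"
        "\<forall>s' \<in> S'. \<not> run (FG True (ys @ y # zs)) s' (leafcode (ys @ y # zs))" by auto
      have "\<not> run (FG True (ys @ y # zs)) s (leafcode (ys @ y # zs))" if s: "s \<in> S" for s
      proof
        assume r: "run (FG True (ys @ y # zs)) s (leafcode (ys @ y # zs))"
        have "leafcode (ys @ y # zs) = v s"
          using *(3)[OF s y(1)[OF s] r] zs(2) s unfolding S'_def by blast
        with y(2)[OF s] less_leafcode[of y "ys @ y # zs"] show False by simp
      qed
      with zs(1) y2 show ?thesis by (intro exI[of _ "y # zs"]) simp
    qed
  qed
qed

section \<open>Closed procedures\<close>

lemma sb_etas_Inl:
  "(\<And>i. i < length \<sigma>s \<Longrightarrow> s (k + i) = Inl (k + i)) \<Longrightarrow> map (sbP s) (etas k \<sigma>s) = etas k \<sigma>s"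
proof (rule nth_equalityI)
  fix i assume s: "\<And>i. i < length \<sigma>s \<Longrightarrow> s (k + i) = Inl (k + i)" and "i < length (map (sbP s) (etas k \<sigma>s))"
  then have i: "i < length \<sigma>s" "length \<sigma>s - 1 - i < length \<sigma>s" by auto
  then have "k + length \<sigma>s - 1 - i = k + (length \<sigma>s - 1 - i)" by simp
  then show "map (sbP s) (etas k \<sigma>s) ! i = etas k \<sigma>s ! i" using i s[OF i(2)] by (simp add: nth_etas sb_eta_Inl)
qed simp

lemma sb_pcf_den [simp]: "sbP s (pcf_den c) = pcf_den c"
proof (cases c)
  case (Y \<sigma>)
  have "substP (up_subst 1 s) (embP (yproc \<sigma> 0)) = substP (\<lambda>_. Inl 0) (embP (yproc \<sigma> 0))"
    using ren_emb_yproc[of "\<lambda>_. 0" \<sigma> 0] subst_ren(1)[of "up_subst 1 s" "\<lambda>_. 0" "embP (yproc \<sigma> 0)"]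
    by (simp add: up_subst_def)
  also have "\<dots> = embP (yproc \<sigma> 0)"
    using ren_emb_yproc[of "\<lambda>_. 0" \<sigma> 0] by (simp add: ren_eq_subst)
  finally have "sbP (up_subst 1 s) (yproc \<sigma> 0) = yproc \<sigma> 0" by (simp add: sbP_def)
  then show ?thesis by (simp add: Y lam_sb)
next
  case (Byval \<sigma>s \<tau>)
  let ?r = "length (args \<tau>)" let ?t = "up_subst (Suc (Suc (length \<sigma>s + ?r))) s"
  have t: "?t i = Inl i" if "i < Suc (Suc (length \<sigma>s + ?r))" for i using that by (simp add: up_subst_def)
  have "map (sbP ?t) (etas 0 (args \<tau>)) = etas 0 (args \<tau>)" by (rule sb_etas_Inl) (simp add: t)
  moreover have "map (sbP ?t) (etas (Suc ?r) \<sigma>s) = etas (Suc ?r) \<sigma>s" by (rule sb_etas_Inl) (simp add: t)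
  ultimately show ?thesis
    by (simp add: Byval Let_def sbE_var[where s="?t", OF t] add_ac)
qed (auto simp: sbE_var up_subst_def fun_eq_iff split: nat.split)

lemma sb_dot': "has_arity (\<sigma> \<Rrightarrow> \<tau>) p \<Longrightarrow> sbP s (p \<cdot> q) = sbP s p \<cdot> sbP s q"
  unfolding has_arity_def by (auto simp: sb_dot simp del: sbP_Lam)

lemma sb_den:
  "ty_of pcf_ty \<Gamma> M = Some \<tau> \<Longrightarrow> (\<And>i. i < length \<Gamma> \<Longrightarrow> s i = Inl i) \<Longrightarrow> sbP s (den \<Gamma> M) = den \<Gamma> M"
proof (induction M arbitrary: \<Gamma> \<tau> s)
  case (Var x)
  then show ?case by (auto simp: sb_eta_Inl split: if_splits)
next
  case (Abs \<sigma> M)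
  then obtain \<tau>' where t: "ty_of pcf_ty (\<sigma> # \<Gamma>) M = Some \<tau>'" by auto
  have "sbP (up_subst 1 s) (den (\<sigma> # \<Gamma>) M) = den (\<sigma> # \<Gamma>) M"
    by (rule Abs.IH[OF t]) (use Abs.prems(2) in \<open>auto simp: up_subst_def\<close>)
  then show ?case by (simp add: lam_sb)
next
  case (Ap M L)
  then obtain \<sigma> where t: "ty_of pcf_ty \<Gamma> M = Some (\<sigma> \<Rrightarrow> \<tau>)" "ty_of pcf_ty \<Gamma> L = Some \<sigma>"
    by (auto split: if_splits option.splits ty.splits)
  with Ap.IH Ap.prems(2) show ?case by (simp add: sb_dot'[OF has_arity_den])
qed simp

inductive_cases wtE_Case: "wtE \<Gamma> (Case a F)" and wtA_App: "wtA \<Gamma> (App x qs)" and wtP_Lam: "wtP \<Gamma> (Lam \<sigma>s e) \<tau>"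

text \<open>A coinduction, since typed terms may be infinite: every free variable lies in the
  context, where \<open>s\<close> is the identity, and lifting preserves this.\<close>

lemma sb_wt:
  assumes "wtP \<Gamma> p \<tau>" "\<And>i. i < length \<Gamma> \<Longrightarrow> s i = Inl i"
  shows "sbP s p = p"
proof -
  define XA where "XA p p' \<longleftrightarrow> (\<exists>\<Gamma> \<tau> s. wtP \<Gamma> p' \<tau> \<and> (\<forall>i < length \<Gamma>. s i = Inl i) \<and> p = sbP s p')" for p p'
  define XB where "XB p p' \<longleftrightarrow> (\<exists>\<Gamma> s. wtE \<Gamma> p' \<and> (\<forall>i < length \<Gamma>. s i = Inl i) \<and> p = sbE s p')" for p p'
  have "XA (sbP s p) p" using assms by (auto simp: XA_def)
  then show ?thesis
  proof (rule nsp_coinduct(1)[of XA XB, rotated -1])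
    fix q q' assume "XA q q'"
    then obtain \<Gamma> \<tau> s where q: "wtP \<Gamma> q' \<tau>" "\<forall>i < length \<Gamma>. s i = Inl i" "q = sbP s q'" unfolding XA_def by blast
    obtain \<sigma>s e where e: "q' = Lam \<sigma>s e" by (cases q')
    with q(1) have "wtE (rev \<sigma>s @ \<Gamma>) e" by (auto elim: wtP_Lam)
    moreover have "\<forall>i < length (rev \<sigma>s @ \<Gamma>). up_subst (length \<sigma>s) s i = Inl i" using q(2) by (auto simp: up_subst_def)
    ultimately have "XB (sbE (up_subst (length \<sigma>s) s) e) e" unfolding XB_def by blast
    then show "nlam_step XB q q'" by (simp add: q(3) e)
  next
    fix d e assume "XB d e"
    then obtain \<Gamma> s where q: "wtE \<Gamma> e" "\<forall>i < length \<Gamma>. s i = Inl i" "d = sbE s e" unfolding XB_def by blast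
    show "nexp_step XA XB d e"
    proof (cases e)
      case (Case a F)
      obtain x qs where a: "a = App x qs" by (cases a)
      from q(1) have "wtA \<Gamma> (App x qs)" and F: "\<And>i. wtE \<Gamma> (F i)" unfolding Case a by (auto elim: wtE_Case)
      then obtain \<sigma>s where x: "x < length \<Gamma>" "list_all2 (wtP \<Gamma>) qs \<sigma>s" by (auto elim: wtA_App)
      have "XA (sbP s q') q'" if "q' \<in> set qs" for q'
      proof -
        from that obtain i where "i < length qs" "q' = qs ! i" by (auto simp: in_set_conv_nth)
        then have "wtP \<Gamma> q' (\<sigma>s ! i)" using x(2) by (simp add: list_all2_conv_all_nth)
        then show ?thesis unfolding XA_def using q(2) by blast
      qed
      then have "list_all2 XA (map (sbP s) qs) qs" by (simp add: list_all2_conv_all_nth)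
      moreover have "\<forall>i. XB (sbE s (F i)) (F i)" using F q(2) unfolding XB_def by blast
      moreover have "d = Case (App x (map (sbP s) qs)) (\<lambda>i. sbE s (F i))"
        unfolding q(3) Case a by (rule sbE_var) (use q(2) x(1) in simp)
      ultimately show ?thesis using Case a by blast
    qed (use q(3) in auto)
  qed
qed

lemma ren_emb_dt_exp: "renE r (embE (dt_exp d g v)) = embE (dt_exp d (r g) v)"
  by (induction d arbitrary: v) auto

lemma ren_emb_dt_proc: "renP r (embP (dt_proc d)) = embP (dt_proc d)"
  by (simp add: dt_proc_def ren_emb_dt_exp up_ren_def)

lemma sb_dt_exp: "s g = Inl g \<Longrightarrow> sbE s (dt_exp d g v) = dt_exp d g v"
  by (induction d arbitrary: v) (auto simp: sbE_var)

lemma sb_dt_proc: "sbP s (dt_proc d) = dt_proc d"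
  by (simp add: dt_proc_def sb_dt_exp up_subst_def)

lemma has_arity_dt_proc: "has_arity (pure_ty 2) (dt_proc d)"
  by (simp add: has_arity_def dt_proc_def numeral_2_eq_2)

lemma dt_exp_eta: "sbE (inst [embP (eta (TN \<Rrightarrow> TN) 0)]) (dt_exp d 0 v) = dt_exp d 0 v"
proof (induction d arbitrary: v)
  case (Ask n d)
  let ?s = "inst [embP (eta (TN \<Rrightarrow> TN) 0)]"
  have "?s 0 = Inr (embP (eta (TN \<Rrightarrow> TN) 0))" by (simp add: inst_def)
  then have "sbE ?s (Case (App 0 [num n]) (dt_exp d 0)) = bind (appN (eta (TN \<Rrightarrow> TN) 0) (map (sbP ?s) [num n])) (\<lambda>i. sbE ?s (dt_exp d 0 i))"
    using has_arity_eta by (rule sbE_call) simp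
  then show ?case by (simp add: appN_eta Ask del: appN_Lam)
qed auto

lemma etaN_dt_proc: "etaN (pure_ty 2) (dt_proc d) = dt_proc d"
proof -
  let ?s = "up_subst 1 (\<lambda>_. Inr (embP (dt_proc d)))"
  have s: "?s 1 = Inr (embP (dt_proc d))" by (simp add: up_subst_def ren_emb_dt_proc)
  have z: "sbP ?s (eta (TN \<Rrightarrow> TN) 0) = eta (TN \<Rrightarrow> TN) 0" by (rule sb_eta_Inl) (simp add: up_subst_def)
  have "appN (dt_proc d) [eta (TN \<Rrightarrow> TN) 0] = dt_exp d 0 0" by (simp add: dt_proc_def dt_exp_eta)
  then have "sbE ?s (Case (App 1 [eta (TN \<Rrightarrow> TN) 0]) Num) = dt_exp d 0 0"
    using z by (subst sbE_call[where s="?s", OF s has_arity_dt_proc]) (simp_all add: numeral_2_eq_2 del: appN_Lam)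
  then show ?thesis
    unfolding etaN_def by (subst eta.simps) (simp add: dt_proc_def numeral_2_eq_2 etas.simps)
qed

section \<open>Values of a bar recursor\<close>

primrec F_val :: "nat list \<Rightarrow> nat \<Rightarrow> (nat \<Rightarrow> nat) \<Rightarrow> nat" where
  "F_val [] k g = g k"
| "F_val (y # ys) k g = (if g k = y then F_val ys (Suc k) g else g k)"

lemma dt_run_F: "(\<And>n. R n (g n)) \<Longrightarrow> dt_run (F_dt us k) v R (F_val us k g)"
  by (induction us arbitrary: k v) auto

lemma F_val_drop:
  "j \<le> length us \<Longrightarrow> (\<And>i. i < j \<Longrightarrow> g (k + i) = us ! i) \<Longrightarrow> F_val us k g = F_val (drop j us) (k + j) g"
proof (induction j arbitrary: us k)
  case (Suc j)
  then obtain u us' where us: "us = u # us'" by (cases us) auto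
  have "g k = u" using Suc.prems(2)[of 0] by (simp add: us)
  moreover have "F_val us' (Suc k) g = F_val (drop j us') (Suc k + j) g"
  proof (rule Suc.IH)
    fix i assume "i < j"
    then show "g (Suc k + i) = us' ! i" using Suc.prems(2)[of "Suc i"] by (simp add: us)
  qed (use Suc.prems(1) us in simp)
  ultimately show ?case by (simp add: us)
qed simp

text \<open>A value below 2 differs from every path entry, so \<open>F\<close> returns it at once;
  if \<open>j\<close> is the end of the path, there is nothing left to compare with.\<close>

lemma F_val_stop:
  assumes "\<forall>y \<in> set ys. 2 \<le> y" "j \<le> length ys" "\<And>i. i < j \<Longrightarrow> g i = ys ! i" "g j < 2"
  shows "F_val ys 0 g = g j"
proof -
  have "F_val ys 0 g = F_val (drop j ys) j g"
    using F_val_drop[of j ys g 0] assms by simp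
  also have "\<dots> = g j"
  proof (cases "drop j ys")
    case (Cons y us)
    then have "y \<in> set ys" by (metis in_set_dropD list.set_intros(1))
    with assms(1,4) have "g j \<noteq> y" by auto
    then show ?thesis by (simp add: Cons)
  qed simp
  finally show ?thesis .
qed

lemma leafcode_inject [simp]: "leafcode us = leafcode vs \<longleftrightarrow> us = vs"
  by (simp add: leafcode_def list_encode_eq)

lemma dt_run_G_body:
  "j \<le> length vs \<Longrightarrow> dt_run (G_body b r us vs) (leafcode (us @ take j vs)) R i \<longleftrightarrow>
    (if j < length vs then \<exists>w. R (vs ! j) w \<and> i = (if b \<and> w = r then r else 0) else i = (if b then r else 0))"
proof (induction vs arbitrary: us j)
  case (Cons v vs)
  show ?case
  proof (cases j)
    case (Suc l)
    with Cons show ?thesis using Cons.IH[of l "us @ [v]"] by simp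
  qed auto
qed simp

lemma definable_arity: "definable L \<sigma> p \<Longrightarrow> has_arity \<sigma> p"
  unfolding definable_def wt_iff by (auto intro: has_arity_den ty_of_translate)

lemma definable_closed: "definable L \<sigma> p \<Longrightarrow> sbP s p = p"
  unfolding definable_def wt_iff by (auto intro!: sb_den ty_of_translate)

locale recursor =
  fixes add basic \<Phi> :: nsp_proc
  assumes add: "is_add add" and basic: "is_basic basic"
    and \<Phi>: "simplified_weak_kohlenbach_bar_recursor add basic \<Phi>"
begin

lemma \<Phi>_wt: "wtP [] \<Phi> (pure_ty 2 \<Rrightarrow> pure_ty 2 \<Rrightarrow> pure_ty 1)"
  using \<Phi> by (simp add: simplified_weak_kohlenbach_bar_recursor_def SP0_def)

lemma \<Phi>_arity: "has_arity (pure_ty 2 \<Rrightarrow> pure_ty 2 \<Rrightarrow> TN \<Rrightarrow> TN) \<Phi>"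
proof -
  obtain \<sigma>s e where e: "\<Phi> = Lam \<sigma>s e" by (cases \<Phi>)
  have "args (funs \<sigma>s TN) = \<sigma>s" by (simp add: args_funs)
  moreover have "pure_ty 2 \<Rrightarrow> pure_ty 2 \<Rrightarrow> pure_ty 1 = funs \<sigma>s TN"
    using \<Phi>_wt unfolding e by (auto elim: wtP_Lam)
  ultimately have "\<sigma>s = args (pure_ty 2 \<Rrightarrow> pure_ty 2 \<Rrightarrow> pure_ty 1)" by metis
  then show ?thesis by (simp add: has_arity_def e)
qed

context
  fixes b :: bool and ys :: "nat list"
  assumes ys: "\<forall>y \<in> set ys. 2 \<le> y"
begin

abbreviation "Fp \<equiv> dt_proc (F_dt ys 0)"
abbreviation "Gp \<equiv> dt_proc (G_dt b ys)"
abbreviation "val xs \<equiv> \<Phi> \<cdot> Fp \<cdot> Gp \<cdot> code xs"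

lemma definable_FG: "definable lang_T0str (pure_ty 2) Fp" "definable lang_T0str (pure_ty 2) Gp"
proof -
  have "\<exists>n d. F_dt ys 0 = Ask n d" by (cases ys) auto
  then show "definable lang_T0str (pure_ty 2) Fp" using definable_dt_proc by auto
  show "definable lang_T0str (pure_ty 2) Gp" unfolding G_dt_def by (rule definable_dt_proc)
qed

lemma Fp_basic: "Fp \<cdot> (basic \<cdot> code xs \<cdot> num c) = num (F_val ys 0 (\<lambda>i. if i < length xs then xs ! i else c))"
proof (rule dt_proc_dot)
  have "has_arity (TN \<Rrightarrow> TN \<Rrightarrow> TN \<Rrightarrow> TN) basic" using basic definable_arity by (auto simp: is_basic_def)
  then show "has_arity (TN \<Rrightarrow> TN) (basic \<cdot> code xs \<cdot> num c)" by (intro has_arity_dot)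
  show "dt_run (F_dt ys 0) 0 (\<lambda>n w. basic \<cdot> code xs \<cdot> num c \<cdot> num n = num w) (F_val ys 0 (\<lambda>i. if i < length xs then xs ! i else c))"
    by (rule dt_run_F) (use basic in \<open>simp add: is_basic_def\<close>)
qed

lemma bar_iff: "kohlenbach_bar basic Fp xs \<longleftrightarrow>
  F_val ys 0 (\<lambda>i. if i < length xs then xs ! i else 0) = F_val ys 0 (\<lambda>i. if i < length xs then xs ! i else 1)"
  unfolding kohlenbach_bar_def Fp_basic by simp

text \<open>\<open>F\<close> leaves the path at position \<open>j\<close> for both defaults and
  returns the default, which is 0 in one case and 1 in the other.\<close>

lemma not_bar: "j \<le> length ys \<Longrightarrow> \<not> kohlenbach_bar basic Fp (take j ys)"
  unfolding bar_iff
  by (subst (1 2) F_val_stop[where j=j]) (use ys in auto)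

text \<open>The entry 0 already leaves the path, so \<open>F\<close> returns 0 for both
  defaults.\<close>

lemma bar: "j \<le> length ys \<Longrightarrow> kohlenbach_bar basic Fp (take j ys @ [0])"
  unfolding bar_iff
  by (subst (1 2) F_val_stop[where j=j]) (use ys in \<open>auto simp: nth_append\<close>)

lemma internal: "j \<le> length ys \<Longrightarrow> take j ys \<in> internal_nodes (ktree basic Fp)"
proof -
  assume j: "j \<le> length ys"
  have "\<not> kohlenbach_bar basic Fp zs" if "prefix zs (take j ys)" for zs
  proof -
    from that obtain i where "zs = take i ys" "i \<le> length ys"
      using j by (metis append_eq_conv_conj length_take min.absorb2 prefix_def prefix_length_le take_take le_trans)
    then show ?thesis using not_bar by simp
  qed
  then show ?thesis
    unfolding internal_nodes_def ktree_def
    by (auto simp: strict_prefix_def prefix_snoc)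
qed

lemma leaf: "j \<le> length ys \<Longrightarrow> take j ys @ [0] \<in> leaves (ktree basic Fp)"
proof -
  assume j: "j \<le> length ys"
  have "take j ys @ [0] \<in> ktree basic Fp" using internal[OF j] by (simp add: internal_nodes_def)
  moreover have "(take j ys @ [0]) @ [y] \<notin> ktree basic Fp" for y
  proof -
    have "strict_prefix (take j ys @ [0]) ((take j ys @ [0]) @ [y])" by (rule strict_prefixI') (rule refl)
    then show ?thesis using bar[OF j] unfolding ktree_def by blast
  qed
  ultimately show ?thesis by (simp add: leaves_def)
qed

lemma val_leaf: "j \<le> length ys \<Longrightarrow> val (take j ys @ [0]) = num (leafcode (take j ys))"
  using \<Phi> definable_FG leaf unfolding simplified_weak_kohlenbach_bar_recursor_def leafcode_def by blast

abbreviation "sec xs \<equiv> lam TN (\<Phi> \<cdot> Fp \<cdot> Gp \<cdot> (add \<cdot> code xs \<cdot> eta TN 0))"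

lemma val_internal: "j \<le> length ys \<Longrightarrow> val (take j ys) = Gp \<cdot> sec (take j ys)"
  using \<Phi> definable_FG internal unfolding simplified_weak_kohlenbach_bar_recursor_def by blast

lemma sec_arity: "has_arity (TN \<Rrightarrow> TN) (sec xs)"
  by (rule has_arity_lam[OF has_arity_dot[OF has_arity_dot[OF has_arity_dot[OF \<Phi>_arity]]]])

lemma sec_dot: "sec xs \<cdot> num n = val (xs @ [n])"
proof -
  let ?s = "ext_subst (num n) Inl"
  have ad: "definable lang_T0str (TN \<Rrightarrow> TN \<Rrightarrow> TN) add" using add by (simp add: is_add_def)
  note ar = \<Phi>_arity has_arity_dot[OF \<Phi>_arity] has_arity_dot[OF has_arity_dot[OF \<Phi>_arity]]
    definable_arity[OF ad] has_arity_dot[OF definable_arity[OF ad]]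
  have cl: "sbP ?s \<Phi> = \<Phi>" by (rule sb_wt[OF \<Phi>_wt]) simp
  have z: "sbP ?s (eta TN 0) = num n" by (subst sb_eta[where q="num n"]) simp_all
  have "sec xs \<cdot> num n = sbP ?s (\<Phi> \<cdot> Fp \<cdot> Gp \<cdot> (add \<cdot> code xs \<cdot> eta TN 0))"
    using lam_dot[of Inl] by (simp del: dot.simps sbP_Lam)
  also have "\<dots> = \<Phi> \<cdot> Fp \<cdot> Gp \<cdot> (add \<cdot> code xs \<cdot> num n)"
    by (simp only: ar[THEN sb_dot'] cl z sb_dt_proc definable_closed[OF ad]) simp
  also have "add \<cdot> code xs \<cdot> num n = code (xs @ [n])" using add by (simp add: is_add_def)
  finally show ?thesis .
qed

text \<open>From the end of the path back to the root: the leaf at child 0 tells \<open>G\<close>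
  which node it is at, and the next node on the path has the required value by induction.\<close>

lemma val_path: "j \<le> length ys \<Longrightarrow> val (take j ys) = num (if b then leafcode ys else 0)"
proof (induction j rule: measure_induct_rule[of "\<lambda>j. length ys - j"])
  case (less j)
  let ?R = "\<lambda>n w. sec (take j ys) \<cdot> num n = num w" let ?v = "if b then leafcode ys else 0"
  have "?R 0 (leafcode (take j ys))" using val_leaf[OF less.prems] by (simp add: sec_dot)
  moreover have "dt_run (G_body b (leafcode ys) [] ys) (leafcode (take j ys)) ?R ?v"
  proof (cases "j < length ys")
    case True
    then have "?R (ys ! j) ?v" using less.IH[of "Suc j"] by (simp add: sec_dot take_Suc_conv_app_nth)
    with dt_run_G_body[of j ys b "leafcode ys" "[]" ?R ?v] True show ?thesis by auto
  next
    case False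
    with dt_run_G_body[of j ys b "leafcode ys" "[]" ?R ?v] less.prems show ?thesis by simp
  qed
  ultimately have "dt_run (G_dt b ys) 0 ?R ?v" by (auto simp: G_dt_def)
  from dt_proc_dot[OF sec_arity this] show ?case using val_internal[OF less.prems] by simp
qed

text \<open>The recursion equations give the value at the root. Read as a substitution of the trees
  for two free variables, this value becomes a reduction of an instance of the open term, and so a
  run by \<open>run_complete\<close>.\<close>

lemma run_recursor: "run (FG b ys) (appN \<Phi> [eta (pure_ty 2) 1, eta (pure_ty 2) 0, code []]) (if b then leafcode ys else 0)"
proof -
  let ?v = "if b then leafcode ys else 0" let ?t = "[eta (pure_ty 2) 1, eta (pure_ty 2) 0, code []]"
  let ?s = "\<lambda>x. Inr (embP (dt_proc (FG b ys x))) :: nat + mproc"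
  have "Num ?v = appN (num ?v) []" by (simp add: appN_nil del: appN_Lam)
  also have "num ?v = val []" using val_path[of 0] by simp
  also have "appN (val []) [] = appN \<Phi> [Fp, Gp, code []]"
    by (simp add: appN_dot'[OF has_arity_dot[OF has_arity_dot[OF \<Phi>_arity]]] appN_dot'[OF has_arity_dot[OF \<Phi>_arity]]
        appN_dot'[OF \<Phi>_arity] del: appN_Lam)
  also have "\<Phi> = sbP ?s \<Phi>" by (rule sb_wt[OF \<Phi>_wt, symmetric]) simp
  finally have v: "Num ?v = appN (sbP ?s \<Phi>) [Fp, Gp, code []]" .
  obtain e where e: "\<Phi> = Lam [pure_ty 2, pure_ty 2, TN] e" using \<Phi>_arity by (auto simp: has_arity_def)
  define E where "E = substE (inst (map embP ?t)) (embE e)"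
  have t: "appN \<Phi> ?t = nfE E" by (simp add: e E_def sbE_def)
  have "nfE (substE ?s E) = sbE (comp_subst ?s (inst (map embP ?t))) e"
    by (simp add: E_def sbE_def subst_subst)
  also have "\<dots> = sbE (close_subst [Fp, Gp, code []] ?s) e"
  proof (rule sb_cong)
    fix i
    have eta: "eqvS (Inr (substP ?s (embP (eta (pure_ty 2) x)))) (Inr (embP (dt_proc (FG b ys x))))" for x
      by (rule eqvS_nf) (simp add: nf_subst_eta[where s="?s" and x=x, OF refl] etaN_dt_proc)
    consider "i = 0" | "i = 1" | "i = 2" | k where "i = Suc (Suc (Suc k))"
      by (metis One_nat_def Suc_1 not0_implies_Suc)
    then show "eqvS (comp_subst ?s (inst (map embP ?t)) i) (close_subst [Fp, Gp, code []] ?s i)"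
    proof cases
      case 1
      then show ?thesis by (simp add: comp_subst_def inst_def close_subst_def eqv_refl)
    next
      case 2
      then show ?thesis using eta[of 0] by (simp add: comp_subst_def inst_def close_subst_def FG_def)
    next
      case 3
      then show ?thesis using eta[of 1] by (simp add: comp_subst_def inst_def close_subst_def FG_def numeral_2_eq_2)
    next
      case (4 k)
      then show ?thesis by (simp add: comp_subst_def inst_def close_subst_def eqvS_refl)
    qed
  qed
  also have "\<dots> = Num ?v" unfolding v e by (subst appN_sb) simp_all
  finally have nf: "nfE (substE ?s E) = Num ?v" .
  then have "conv (substE ?s E)" using nf_simps(4) by fastforce
  then obtain k where "(hredE ^^ k) (substE ?s E) (MNum ?v)"
    by (cases rule: conv_cases) (use nf in \<open>auto simp: nf_simps rtranclp_power\<close>)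
  then show ?thesis unfolding t by (rule run_complete)
qed

end

lemma not_good: "\<not> good (appN \<Phi> [eta (pure_ty 2) 1, eta (pure_ty 2) 0, code []])"
proof
  let ?t = "appN \<Phi> [eta (pure_ty 2) 1, eta (pure_ty 2) 0, code []]"
  assume g: "good ?t"
  have "\<exists>zs. (\<forall>z \<in> set zs. 2 \<le> z) \<and> (\<forall>s \<in> {?t}. \<not> run (FG True ([] @ zs)) s (leafcode ([] @ zs)))"
  proof (rule adversary)
    fix s zs assume "s \<in> {?t}" "\<forall>z \<in> set zs. (2 :: nat) \<le> z"
    then show "\<exists>v. run (FG False ([] @ zs)) s v" using run_recursor[of zs False] by auto
  qed (use g in auto)
  then show False using run_recursor[of _ True] by auto
qed

end

section \<open>Left-well-founded procedures\<close>

text \<open>An argument of a type-2 variable is reducible, hence good at every numeral, which is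
  exactly what \<open>good_args\<close> demands.\<close>

lemma RED_eta2: "RED (pure_ty 2) (eta (pure_ty 2) x)"
proof (rule RED_I)
  fix qs assume "list_all2 RED (args (pure_ty 2)) qs"
  then obtain q where q: "qs = [q]" "RED (TN \<Rrightarrow> TN) q"
    by (auto simp: numeral_2_eq_2 list_all2_Cons1 simp del: RED.simps)
  have "good_args [etaN (TN \<Rrightarrow> TN) q]"
    unfolding good_args_def using RED_good[OF RED_etaN[OF q(2)]] by (simp del: appN_Lam)
  then show "good (appN (eta (pure_ty 2) x) qs)"
    by (subst appN_eta) (simp_all add: q(1) numeral_2_eq_2 good_Case)
qed (rule has_arity_eta)

lemma definable_good:
  assumes "definable L (pure_ty 2 \<Rrightarrow> pure_ty 2 \<Rrightarrow> pure_ty 1) \<Phi>" "L \<subseteq> lang_Tmin \<union> lang_W"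
  shows "good (appN \<Phi> [eta (pure_ty 2) x, eta (pure_ty 2) y, num n])"
proof -
  from assms obtain M where M: "set_tm M \<subseteq> lang_Tmin \<union> lang_W"
    "ty_of const_ty [] M = Some (pure_ty 2 \<Rrightarrow> pure_ty 2 \<Rrightarrow> pure_ty 1)" "\<Phi> = den [] (translate M)"
    unfolding definable_def wt_iff by blast
  have "RED (pure_ty 2 \<Rrightarrow> pure_ty 2 \<Rrightarrow> pure_ty 1) (ev Inl [] (translate M))"
    by (rule RED_den[OF M(2,1)]) (simp add: RED_subst_def)
  then have "RED (pure_ty 2 \<Rrightarrow> pure_ty 2 \<Rrightarrow> pure_ty 1) \<Phi>" by (simp only: ev_def sb_Inl M(3))
  then show ?thesis by (rule RED_good) (simp add: RED_eta2 del: RED.simps)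
qed

text \<open>An inductive form of left-well-foundedness that descends by whole spines;
  \<open>un_Lam2 q\<close> is the body of \<open>q\<close>.\<close>

inductive lwf_exp :: "nsp_exp \<Rightarrow> bool" where
  lwf_expI: "(\<And>k x qs q. reach k e x qs \<Longrightarrow> q \<in> set qs \<Longrightarrow> lwf_exp (un_Lam2 q)) \<Longrightarrow> lwf_exp e"

lemma reach_occ:
  "reach k e x qs \<Longrightarrow> \<exists>\<beta>. occE (\<beta> @ [Hd]) e \<and>
    (\<forall>j < length qs. \<forall>\<pi>. occE \<pi> (un_Lam2 (qs ! j)) \<longrightarrow> occE (\<beta> @ [Hd, Arg j] @ \<pi>) e)"
proof (induction rule: reach.induct)
  case (reach_head x qs F)
  have "occE (Hd # Arg j # \<pi>) (Case (App x qs) F)" if "j < length qs" "occE \<pi> (un_Lam2 (qs ! j))" for j \<pi>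
    using that by (cases "qs ! j") (auto intro!: occP_occE.intros)
  then show ?case by (intro exI[of _ "[]"]) (auto intro: occP_occE.intros)
next
  case (reach_branch k F i x qs a)
  then obtain \<beta> where "occE (\<beta> @ [Hd]) (F i)"
    "\<forall>j < length qs. \<forall>\<pi>. occE \<pi> (un_Lam2 (qs ! j)) \<longrightarrow> occE (\<beta> @ [Hd, Arg j] @ \<pi>) (F i)" by blast
  then show ?case by (intro exI[of _ "Br i # \<beta>"]) (auto intro: occP_occE.intros)
qed

text \<open>A failure of \<open>lwf_exp\<close> recurs in the body of some argument, and so on
  forever by dependent choice; the concatenated paths form a forbidden sequence of nested
  occurrences.\<close>

lemma lwf_imp_lwf_exp: "lwf (Lam \<sigma>s e) \<Longrightarrow> lwf_exp e"
proof (rule ccontr)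
  assume lwf: "lwf (Lam \<sigma>s e)" and e: "\<not> lwf_exp e"
  have step: "\<exists>d \<beta> j. \<not> lwf_exp d \<and> occE (\<beta> @ [Hd]) c \<and> (\<forall>\<pi>. occE \<pi> d \<longrightarrow> occE (\<beta> @ [Hd, Arg j] @ \<pi>) c)"
    if c: "\<not> lwf_exp c" for c
  proof -
    from c obtain k x qs q where q: "reach k c x qs" "q \<in> set qs" "\<not> lwf_exp (un_Lam2 q)" using lwf_expI[of c] by blast
    from q(2) obtain j where "j < length qs" "q = qs ! j" by (auto simp: in_set_conv_nth)
    with reach_occ[OF q(1)] q(3) show ?thesis by blast
  qed
  then obtain nx \<beta> j where nx: "\<And>c. \<not> lwf_exp c \<Longrightarrow> \<not> lwf_exp (nx c)" "\<And>c. \<not> lwf_exp c \<Longrightarrow> occE (\<beta> c @ [Hd]) c"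
    "\<And>c \<pi>. \<not> lwf_exp c \<Longrightarrow> occE \<pi> (nx c) \<Longrightarrow> occE (\<beta> c @ [Hd, Arg (j c)] @ \<pi>) c" by metis
  define es where "es n = (nx ^^ n) e" for n
  have es: "\<not> lwf_exp (es n)" for n by (induction n) (auto simp: es_def e nx(1))
  \<comment> \<open>\<open>pre n\<close> leads to the \<open>n\<close>-th chosen body, and
    \<open>f n\<close> below to the application on its spine whose argument contains the next
    body.\<close>
  define pre where "pre n = concat (map (\<lambda>i. \<beta> (es i) @ [Hd, Arg (j (es i))]) [0..<n])" for n
  have pre: "occE \<pi> (es n) \<Longrightarrow> occE (pre n @ \<pi>) e" for n \<pi>
  proof (induction n arbitrary: \<pi>)
    case (Suc n)
    from nx(3)[OF es[of n]] Suc.prems have "occE (\<beta> (es n) @ [Hd, Arg (j (es n))] @ \<pi>) (es n)" by (simp add: es_def)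
    from Suc.IH[OF this] show ?case by (simp add: pre_def)
  qed (simp add: es_def pre_def)
  define f where "f n = pre n @ \<beta> (es n) @ [Hd]" for n
  have "occP (f n) (Lam \<sigma>s e)" for n
    unfolding f_def using pre[OF nx(2)[OF es]] by (auto intro: occP_occE.intros)
  moreover have "strict_prefix (f n) (f (Suc n))" for n
    by (simp add: f_def pre_def strict_prefix_def)
  ultimately show False using lwf unfolding lwf_def by blast
qed

text \<open>Inside the body of \<open>\<Phi>\<close> only arguments of type-2 variables bind
  anything, and what they bind has type \<open>TN\<close>; so all contexts met have this
  shape.\<close>

definition ground_subst :: "ty list \<Rightarrow> msubst \<Rightarrow> bool" where
  "ground_subst \<Gamma> s \<longleftrightarrow> (\<forall>i < length \<Gamma>. (\<Gamma> ! i = TN \<and> (\<exists>n. s i = Inr (embP (num n)))) \<or>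
     (\<Gamma> ! i = pure_ty 2 \<and> (\<exists>x. s i = Inr (embP (eta (pure_ty 2) x)))))"

lemma conv_nf: "nfE E \<noteq> Bot \<Longrightarrow> \<exists>m H. (hredE ^^ m) E H \<and> is_val H"
  using nf_simps(4)[of E] by (auto simp: conv_def rtranclp_power)

lemma funs_inject: "funs \<sigma>s TN = \<sigma> \<Longrightarrow> \<sigma>s = args \<sigma>"
  by (auto simp: args_funs)

text \<open>
  The number \<open>m\<close> of reduction steps takes care of consecutive case distinctions on variables of
  ground type, which vanish under the substitution.
\<close>

lemma lwf_exp_good_aux:
  assumes "\<And>k x qs q \<Gamma> s. reach k e x qs \<Longrightarrow> q \<in> set qs \<Longrightarrow> wtE \<Gamma> (un_Lam2 q) \<Longrightarrow> ground_subst \<Gamma> s \<Longrightarrow> good (sbE s (un_Lam2 q))"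
    and "wtE \<Gamma> e" "ground_subst \<Gamma> s"
    and "reach k (sbE s e) y ps" "(hredE ^^ m) (substE s (embE e)) H" "is_val H"
  shows "good_args ps"
  using assms
proof (induction k arbitrary: e m H rule: less_induct)
  case (less k)
  note outer = less.IH
  from less.prems show ?case
  proof (induction m arbitrary: e rule: less_induct)
    case (less m)
    note IH = less.prems(1)
    show ?case
    proof (cases e)
      case (Case a F)
      obtain x qs where a: "a = App x qs" by (cases a)
      from less.prems(2) have "wtA \<Gamma> (App x qs)" and F: "\<And>i. wtE \<Gamma> (F i)" unfolding Case a by (auto elim: wtE_Case)
      then obtain \<sigma>s where x: "x < length \<Gamma>" "\<Gamma> ! x = funs \<sigma>s TN" "list_all2 (wtP \<Gamma>) qs \<sigma>s" by (auto elim: wtA_App)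
      have IHF: "good (sbE s' (un_Lam2 q))" if "reach k' (F i) x' qs'" "q \<in> set qs'" "wtE \<Gamma>' (un_Lam2 q)" "ground_subst \<Gamma>' s'"
        for i k' x' qs' q \<Gamma>' s'
        using IH[of "Suc k'" x' qs' q \<Gamma>' s'] that by (auto simp: Case intro: reach_branch)
      from less.prems(3) x(1) consider n where "\<Gamma> ! x = TN" "s x = Inr (embP (num n))"
        | z where "\<Gamma> ! x = pure_ty 2" "s x = Inr (embP (eta (pure_ty 2) z))"
        unfolding ground_subst_def by blast
      then show ?thesis
      proof cases
        case (1 n)
        have "qs = []" using x(2,3) 1(1) funs_inject[of \<sigma>s TN] by auto
        let ?T = "substE s (embE e)"
        have "hredE ?T (MCase (MExp (MNum n)) (\<lambda>i. substE s (embE (F i))))"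
          using 1(2) by (simp add: Case a \<open>qs = []\<close>)
        \<comment> \<open>A case on a ground variable vanishes in two steps, one instantiating
          \<open>num n\<close> and one selecting the branch; \<open>k\<close> stays the same while
          \<open>m\<close> drops.\<close>
        then have T: "(hredE ^^ 2) ?T (substE s (embE (F n)))"
          by (auto simp: numeral_2_eq_2)
        from relpow_val[OF less.prems(5,6) T] have m: "m - 2 < m" "(hredE ^^ (m - 2)) (substE s (embE (F n))) H" by auto
        have "sbE s e = sbE s (F n)" unfolding sbE_def by (rule nf_red[OF relpowp_imp_rtranclp[OF T]])
        with less.prems(4) have "reach k (sbE s (F n)) y ps" by simp
        from less.IH[OF m(1) IHF F less.prems(3) this m(2) less.prems(6)] show ?thesis .
      next
        case (2 z)
        have "\<sigma>s = [TN \<Rrightarrow> TN]" 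
        proof -
          have "\<sigma>s = args (pure_ty 2)" using x(2) 2(1) by (intro funs_inject) simp
          then show ?thesis by (simp add: numeral_2_eq_2)
        qed
        with x(3) obtain q where q: "qs = [q]" "wtP \<Gamma> q (TN \<Rrightarrow> TN)" by (auto simp: list_all2_Cons2)
        obtain ts d where ts: "q = Lam ts d" by (cases q)
        from q(2) have t: "funs ts TN = (TN \<Rrightarrow> TN)" "wtE (rev ts @ \<Gamma>) d" unfolding ts by (auto elim: wtP_Lam)
        then have "ts = [TN]" using funs_inject[of ts "TN \<Rrightarrow> TN"] by simp
        with t ts have d: "wtE (TN # \<Gamma>) d" "q = Lam [TN] d" by auto
        have q1: "has_arity (TN \<Rrightarrow> TN) (sbP s q)" by (simp add: d(2) has_arity_def)
        have "appN (eta (pure_ty 2) z) [sbP s q] = Case (App z [etaN (TN \<Rrightarrow> TN) (sbP s q)]) Num"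
          by (subst appN_eta) (simp_all add: numeral_2_eq_2)
        then have eq: "sbE s e = Case (App z [etaN (TN \<Rrightarrow> TN) (sbP s q)]) (\<lambda>i. sbE s (F i))"
          unfolding Case a q(1) by (subst sbE_call[where s=s, OF 2(2) has_arity_eta]) (simp_all add: numeral_2_eq_2 del: appN_Lam)
        show ?thesis
        proof (cases k)
          case 0
          with less.prems(4) have ps: "ps = [etaN (TN \<Rrightarrow> TN) (sbP s q)]" by (auto simp: eq reach_Case)
          have "good (appN (etaN (TN \<Rrightarrow> TN) (sbP s q)) [num n])" for n
          proof -
            have "appN (etaN (TN \<Rrightarrow> TN) (sbP s q)) [num n] = appN (sbP s q) [num n]"
              by (subst appN_etaN[OF q1]) simp_all
            also have "\<dots> = sbE (close_subst [num n] s) d" unfolding d(2) by (rule appN_sb) simp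
            also have "good \<dots>"
            proof -
              have "ground_subst (TN # \<Gamma>) (close_subst [num n] s)"
                unfolding ground_subst_def
              proof (intro allI impI)
                fix i assume i: "i < length (TN # \<Gamma>)"
                show "((TN # \<Gamma>) ! i = TN \<and> (\<exists>m. close_subst [num n] s i = Inr (embP (num m)))) \<or>
                  ((TN # \<Gamma>) ! i = pure_ty 2 \<and> (\<exists>x. close_subst [num n] s i = Inr (embP (eta (pure_ty 2) x))))"
                proof (cases i)
                  case (Suc l)
                  then have "close_subst [num n] s i = s l" "(TN # \<Gamma>) ! i = \<Gamma> ! l" by (simp_all add: close_subst_def)
                  then show ?thesis using less.prems(3) i Suc unfolding ground_subst_def by (simp only: length_Cons Suc_less_eq)
                qed (simp add: close_subst_def)
              qed
              then show ?thesis using IH[of 0 x qs q "TN # \<Gamma>" "close_subst [num n] s"] d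
                by (simp add: Case a q(1) reach_head)
            qed
            finally show ?thesis .
          qed
          then show ?thesis by (simp add: ps good_args_def del: appN_Lam)
        next
          case (Suc l)
          with less.prems(4) obtain i where i: "reach l (sbE s (F i)) y ps" by (auto simp: eq reach_Case)
          then have "nfE (substE s (embE (F i))) \<noteq> Bot" by (metis reach_simps(1) sbE_def)
          \<comment> \<open>The depth \<open>k\<close> has dropped, so the number of steps may start
            afresh.\<close>
          then obtain m' H' where m': "(hredE ^^ m') (substE s (embE (F i))) H'" "is_val H'" using conv_nf by blast
          show ?thesis
            by (rule outer[OF _ IHF F less.prems(3) i m']) (simp_all add: Suc)
        qed
      qed
    qed (use less.prems(4) in auto)
  qed
qed

lemma lwf_exp_good: "lwf_exp e \<Longrightarrow> wtE \<Gamma> e \<Longrightarrow> ground_subst \<Gamma> s \<Longrightarrow> good (sbE s e)"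
proof (induction arbitrary: \<Gamma> s rule: lwf_exp.induct)
  case (lwf_expI e)
  show ?case unfolding good_iff
  proof (intro allI impI)
    fix k x qs assume r: "reach k (sbE s e) x qs"
    then have "nfE (substE s (embE e)) \<noteq> Bot" by (metis reach_simps(1) sbE_def)
    then obtain m H where m: "(hredE ^^ m) (substE s (embE e)) H" "is_val H" using conv_nf by blast
    show "good_args qs" by (rule lwf_exp_good_aux[OF lwf_expI.IH lwf_expI.prems r m])
  qed
qed

theorem theorem24:
  fixes add basic :: nsp_proc
  assumes "is_add add" and "is_basic basic"
  shows "(\<forall>\<Phi>. simplified_weak_kohlenbach_bar_recursor add basic \<Phi> \<longrightarrow> \<not> lwf \<Phi>)
    \<and> \<not> (\<exists>\<Phi>. simplified_weak_kohlenbach_bar_recursor add basic \<Phi> \<and>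
            definable lang_Tmin (pure_ty 2 \<Rrightarrow> pure_ty 2 \<Rrightarrow> pure_ty 1) \<Phi>)
    \<and> \<not> (\<exists>\<Phi>. simplified_weak_kohlenbach_bar_recursor add basic \<Phi> \<and>
            definable lang_W (pure_ty 2 \<Rrightarrow> pure_ty 2 \<Rrightarrow> pure_ty 1) \<Phi>)"
proof (intro conjI allI impI notI; (elim exE conjE)?)
  fix \<Phi> assume \<Phi>: "simplified_weak_kohlenbach_bar_recursor add basic \<Phi>" and "lwf \<Phi>"
  interpret recursor add basic \<Phi> by unfold_locales fact+
  obtain e where e: "\<Phi> = Lam [pure_ty 2, pure_ty 2, TN] e" using \<Phi>_arity by (auto simp: has_arity_def)
  have "wtE [TN, pure_ty 2, pure_ty 2] e" using \<Phi>_wt unfolding e by (auto elim: wtP_Lam)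
  moreover have "ground_subst [TN, pure_ty 2, pure_ty 2] (inst (map embP [eta (pure_ty 2) 1, eta (pure_ty 2) 0, code []]))"
    by (auto simp: ground_subst_def inst_def less_Suc_eq numeral_2_eq_2)
  ultimately have "good (appN \<Phi> [eta (pure_ty 2) 1, eta (pure_ty 2) 0, code []])"
    using lwf_exp_good[OF lwf_imp_lwf_exp] \<open>lwf \<Phi>\<close> unfolding e appN_Lam by blast
  with not_good show False by blast
next
  fix \<Phi> assume \<Phi>: "simplified_weak_kohlenbach_bar_recursor add basic \<Phi>"
    and d: "definable lang_Tmin (pure_ty 2 \<Rrightarrow> pure_ty 2 \<Rrightarrow> pure_ty 1) \<Phi>"
  interpret recursor add basic \<Phi> by unfold_locales fact+
  from not_good definable_good[OF d] show False by blast
next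
  fix \<Phi> assume \<Phi>: "simplified_weak_kohlenbach_bar_recursor add basic \<Phi>"
    and d: "definable lang_W (pure_ty 2 \<Rrightarrow> pure_ty 2 \<Rrightarrow> pure_ty 1) \<Phi>"
  interpret recursor add basic \<Phi> by unfold_locales fact+
  from not_good definable_good[OF d] show False by blast
qed

end
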